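(* Let $(N^4,\overline g)$ be a spacetime, $M^3\subset N$ a spacelike hypersurface, and $(\Sigma^2,g_\Sigma)\subset M$ a closed embedded surface. Suppose $\Sigma$ is area expanding. Then there exists a unique smooth steering parameter $Q=Q_\Sigma\in C^\infty(N)$ such that in the steered spacetime metric $\overline g_Q$ the mean curvature vector $\vec H_\Sigma$ is tangential to $M$ everywhere on $\Sigma$.
   Context: A spacetime is a connected, smooth, time-oriented Lorentzian 4-manifold of signature $(-,+,+,+)$. For a spacelike surface $\Sigma$ in a Lorentzian manifold, $\vec H_\Sigma$ is the trace, with respect to the induced metric, of $\vec{\mathrm{II}}(X,Y)=$ the normal component of the Levi-Civita derivative of $Y$ along $X$. Setup. The normal bundle of $\Sigma$ is assumed trivial. Let $e_r$ be the unit outward normal vector field of $\Sigma$ in $M$ (spacelike), and let $e_t$ be the unit normal vector field of $\Sigma$ in $N$ perpendicular to $e_r$ (timelike). Let $\{\theta,\phi\}$ be a local coordinate chart on $\Sigma$ with coordinate frame $\{\partial_\theta,\partial_\phi\}$. The frame $\{e_t,e_r,\partial_\theta,\partial_\phi\}$ is extended to a frame on a neighborhood of $\Sigma$ in $N$, and is identified with its extension. The extension used is the following: take a local area expanding normal variation $\{\Sigma_s\}$ of $\Sigma=\Sigma_0$ in $M$; $e_r$ remains the outward unit normal in $M$ to each $\Sigma_s$; a coordinate $r$ is defined by setting the area of $\Sigma_s$ equal to $4\pi r^2$; $\partial_\theta,\partial_\phi$ (with $[\partial_\theta,\partial_\phi]=0$) are extended by keeping $\theta,\phi$ constant along the normal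 directions of $\Sigma$ in $M$, so that $\partial_r$ is perpendicular to each $\Sigma_s$ and $e_r=\lambda\,\partial_r$ for some function $\lambda$. Let $\{\beta_t,\beta_r,d\theta,d\phi\}$ be the associated dual coframe ($\beta_i(e_j)=\delta_{ij}$ for $i,j\in\{t,r\}$). In the order $(e_t,e_r,\partial_\theta,\partial_\phi)$ the spacetime metric is $$[\overline g]=\begin{pmatrix}-1&0&0&0\\0&1&0&0\\0&0&a&c\\0&0&c&b\end{pmatrix}$$ with $a,b,c$ smooth functions. Area expanding: $\Sigma\subset M$ is said to be area expanding if $e_r(ab-c^2)>0$. Steering: a metric $\overline g_Q$ on $N$ is a steering of $\overline g$ if $\overline g_Q=\overline g+Q(\beta_t\otimes\beta_r+\beta_r\otimes\beta_t)$ for some $Q\in C^\infty(N)$; $Q$ is called a steering parameter.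
   Formalization: Uniqueness of Q is asserted only along Σ (any two such steering parameters agree on Σ), since changing Q away from Σ does not affect the mean curvature vector on Σ, so uniqueness in C^∞(N) fails; the steered metric is taken equal to the original one outside the neighborhood carrying the coframe. *)

theory Defs
  imports "HOL-Analysis.Analysis"
begin

section \<open>Smooth maps between open subsets of Euclidean spaces\<close>

primrec Ck_on :: "nat \<Rightarrow> ('a::euclidean_space \<Rightarrow> 'b::real_normed_vector) \<Rightarrow> 'a set \<Rightarrow> bool" where
  "Ck_on 0 f S \<longleftrightarrow> continuous_on S f"
| "Ck_on (Suc k) f S \<longleftrightarrow> (\<forall>x\<in>S. f differentiable (at x)) \<and>
     (\<forall>v. Ck_on k (\<lambda>x. frechet_derivative f (at x) v) S)"

definition smooth_on :: "'a::euclidean_space set \<Rightarrow> ('a \<Rightarrow> 'b::real_normed_vector) \<Rightarrow> bool" where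
  "smooth_on S f \<longleftrightarrow> (\<forall>k. Ck_on k f S)"

section \<open>Smooth 4-manifolds\<close>

text \<open>The manifold is the whole type \<open>'n\<close>, whose topology is required to be Hausdorff and second
  countable by type classes. A chart is a pair of an open domain and a coordinate map; values of the
  coordinate map outside the domain are irrelevant.\<close>

type_synonym 'n chart = "'n set \<times> ('n \<Rightarrow> real^4)"
type_synonym 'n atlas = "'n chart set"

abbreviation cinv :: "'n chart \<Rightarrow> real^4 \<Rightarrow> 'n" where
  "cinv c \<equiv> inv_into (fst c) (snd c)"

definition smooth_atlas :: "('n::topological_space) atlas \<Rightarrow> bool" where
  "smooth_atlas A \<longleftrightarrow>
     \<Union> (fst ` A) = UNIV \<and>
     (\<forall>c\<in>A. open (fst c) \<and> open (snd c ` fst c) \<and>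
            homeomorphism (fst c) (snd c ` fst c) (snd c) (cinv c)) \<and>
     (\<forall>c\<in>A. \<forall>d\<in>A. smooth_on (snd c ` (fst c \<inter> fst d)) (snd d \<circ> cinv c))"

text \<open>A tangent vector at \<open>p\<close> is its family of components in the charts around \<open>p\<close>, subject to the
  transformation law under changes of charts. A component family has junk values at charts that are
  not in the atlas or not around \<open>p\<close>; \<open>tv_eq\<close> is equality of tangent vectors disregarding these.\<close>

type_synonym 'n tvec = "'n chart \<Rightarrow> real^4"

definition trans_deriv :: "'n chart \<Rightarrow> 'n chart \<Rightarrow> 'n \<Rightarrow> real^4 \<Rightarrow> real^4" where
  "trans_deriv c d p = frechet_derivative (snd d \<circ> cinv c) (at (snd c p))"

definition tangent_vector :: "'n atlas \<Rightarrow> 'n \<Rightarrow> 'n tvec \<Rightarrow> bool" where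
  "tangent_vector A p v \<longleftrightarrow>
     (\<forall>c\<in>A. \<forall>d\<in>A. p \<in> fst c \<inter> fst d \<longrightarrow> v d = trans_deriv c d p (v c))"

definition tv_eq :: "'n atlas \<Rightarrow> 'n \<Rightarrow> 'n tvec \<Rightarrow> 'n tvec \<Rightarrow> bool" where
  "tv_eq A p v w \<longleftrightarrow> (\<forall>c\<in>A. p \<in> fst c \<longrightarrow> v c = w c)"

definition smooth_vfield :: "'n atlas \<Rightarrow> 'n set \<Rightarrow> ('n \<Rightarrow> 'n tvec) \<Rightarrow> bool" where
  "smooth_vfield A U X \<longleftrightarrow>
     (\<forall>p\<in>U. tangent_vector A p (X p)) \<and>
     (\<forall>c\<in>A. smooth_on (snd c ` (U \<inter> fst c)) (\<lambda>y. X (cinv c y) c))"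

definition smooth_fun :: "'n atlas \<Rightarrow> 'n set \<Rightarrow> ('n \<Rightarrow> real) \<Rightarrow> bool" where
  "smooth_fun A U f \<longleftrightarrow> (\<forall>c\<in>A. smooth_on (snd c ` (U \<inter> fst c)) (f \<circ> cinv c))"

text \<open>Scalars attached to a point are computed in an arbitrary chart around it; for tensorial data
  the choice does not matter.\<close>

definition chart_at :: "'n atlas \<Rightarrow> 'n \<Rightarrow> 'n chart" where
  "chart_at A p = (SOME c. c \<in> A \<and> p \<in> fst c)"

definition deriv_along :: "'n atlas \<Rightarrow> 'n \<Rightarrow> 'n tvec \<Rightarrow> ('n \<Rightarrow> real) \<Rightarrow> real" where
  "deriv_along A p v f =
     (let c = chart_at A p in frechet_derivative (f \<circ> cinv c) (at (snd c p)) (v c))"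

definition lie_bracket :: "('n \<Rightarrow> 'n tvec) \<Rightarrow> ('n \<Rightarrow> 'n tvec) \<Rightarrow> 'n \<Rightarrow> 'n tvec" where
  "lie_bracket X Y p = (\<lambda>c.
     frechet_derivative (\<lambda>y. Y (cinv c y) c) (at (snd c p)) (X p c)
     - frechet_derivative (\<lambda>y. X (cinv c y) c) (at (snd c p)) (Y p c))"

definition smooth_into ::
  "('n::topological_space) atlas \<Rightarrow> 'a::euclidean_space set \<Rightarrow> ('a \<Rightarrow> 'n) \<Rightarrow> bool" where
  "smooth_into A D u \<longleftrightarrow> continuous_on D u \<and>
     (\<forall>c\<in>A. smooth_on (D \<inter> u -` fst c) (snd c \<circ> u))"

definition push :: "('a::euclidean_space \<Rightarrow> 'n) \<Rightarrow> 'a \<Rightarrow> 'a \<Rightarrow> 'n tvec" where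
  "push u x a = (\<lambda>c. frechet_derivative (snd c \<circ> u) (at x) a)"

section \<open>Embedded submanifolds\<close>

definition local_param ::
  "('n::topological_space) atlas \<Rightarrow> 'n set \<Rightarrow> 'a::euclidean_space set \<Rightarrow> ('a \<Rightarrow> 'n) \<Rightarrow> bool" where
  "local_param A S D u \<longleftrightarrow> open D \<and> smooth_into A D u \<and>
     (\<exists>W. open W \<and> u ` D = S \<inter> W) \<and> homeomorphism D (u ` D) u (inv_into D u) \<and>
     (\<forall>x\<in>D. \<forall>c\<in>A. u x \<in> fst c \<longrightarrow> inj (\<lambda>a. push u x a c))"

definition embedded_surface :: "('n::topological_space) atlas \<Rightarrow> 'n set \<Rightarrow> bool" where
  "embedded_surface A S \<longleftrightarrow> (\<forall>p\<in>S. \<exists>(D::(real^2) set) u. local_param A S D u \<and> p \<in> u ` D)"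

definition embedded_hypersurface :: "('n::topological_space) atlas \<Rightarrow> 'n set \<Rightarrow> bool" where
  "embedded_hypersurface A M \<longleftrightarrow> (\<forall>p\<in>M. \<exists>(D::(real^3) set) u. local_param A M D u \<and> p \<in> u ` D)"

text \<open>Tangent vectors of a submanifold are the velocities of smooth curves inside it.\<close>

definition tangent_to :: "('n::topological_space) atlas \<Rightarrow> 'n set \<Rightarrow> 'n \<Rightarrow> 'n tvec \<Rightarrow> bool" where
  "tangent_to A S p v \<longleftrightarrow> (\<exists>(\<gamma>::real \<Rightarrow> 'n) \<epsilon>. 0 < \<epsilon> \<and> smooth_into A {-\<epsilon><..<\<epsilon>} \<gamma> \<and>
     \<gamma> ` {-\<epsilon><..<\<epsilon>} \<subseteq> S \<and> \<gamma> 0 = p \<and> tv_eq A p v (push \<gamma> 0 1))"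

section \<open>Lorentzian metrics\<close>

type_synonym 'n metric = "'n \<Rightarrow> 'n chart \<Rightarrow> real^4^4"

definition minkowski :: "real^4^4" where
  "minkowski = (\<chi> i j. if i \<noteq> j then 0 else if i = 1 then -1 else 1)"

definition lorentz_metric :: "'n atlas \<Rightarrow> 'n metric \<Rightarrow> bool" where
  "lorentz_metric A g \<longleftrightarrow>
     (\<forall>c\<in>A. \<forall>p\<in>fst c. transpose (g p c) = g p c \<and>
        (\<exists>P. invertible P \<and> transpose P ** g p c ** P = minkowski)) \<and>
     (\<forall>c\<in>A. \<forall>d\<in>A. \<forall>p\<in>fst c \<inter> fst d. \<forall>v w.
        trans_deriv c d p v \<bullet> (g p d *v trans_deriv c d p w) = v \<bullet> (g p c *v w)) \<and>
     (\<forall>c\<in>A. smooth_on (snd c ` fst c) (\<lambda>y. g (cinv c y) c))"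

definition ip :: "'n atlas \<Rightarrow> 'n metric \<Rightarrow> 'n \<Rightarrow> 'n tvec \<Rightarrow> 'n tvec \<Rightarrow> real" where
  "ip A g p v w = (let c = chart_at A p in v c \<bullet> (g p c *v w c))"

text \<open>A time orientation is given by a nowhere vanishing timelike vector field \<open>T\<close>.\<close>

definition spacetime ::
  "('n::{t2_space,second_countable_topology}) atlas \<Rightarrow> 'n metric \<Rightarrow> ('n \<Rightarrow> 'n tvec) \<Rightarrow> bool" where
  "spacetime A g T \<longleftrightarrow> connected (UNIV :: 'n set) \<and> smooth_atlas A \<and> lorentz_metric A g \<and>
     smooth_vfield A UNIV T \<and> (\<forall>p. ip A g p (T p) (T p) < 0)"

definition spacelike :: "('n::topological_space) atlas \<Rightarrow> 'n metric \<Rightarrow> 'n set \<Rightarrow> bool" where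
  "spacelike A g S \<longleftrightarrow>
     (\<forall>p\<in>S. \<forall>v. tangent_to A S p v \<and> \<not> tv_eq A p v (\<lambda>c. 0) \<longrightarrow> ip A g p v v > 0)"

section \<open>Levi-Civita derivative and mean curvature vector\<close>

definition metric_deriv :: "'n metric \<Rightarrow> 'n chart \<Rightarrow> 'n \<Rightarrow> 4 \<Rightarrow> 4 \<Rightarrow> 4 \<Rightarrow> real" where
  "metric_deriv g c p l i j =
     frechet_derivative (\<lambda>y. g (cinv c y) c) (at (snd c p)) (axis l 1) $ i $ j"

text \<open>Connection coefficients (upper index first) of the Levi-Civita connection; the lemmas
  \<open>christoffel_torsion_free\<close> and \<open>christoffel_metric\<close> below state that it is torsion-free and
  compatible with the metric.\<close>

definition christoffel :: "'n metric \<Rightarrow> 'n chart \<Rightarrow> 'n \<Rightarrow> 4 \<Rightarrow> 4 \<Rightarrow> 4 \<Rightarrow> real" where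
  "christoffel g c p k i j = (1/2) * (\<Sum>l\<in>UNIV. matrix_inv (g p c) $ k $ l *
     (metric_deriv g c p i j l + metric_deriv g c p j i l - metric_deriv g c p l i j))"

text \<open>Levi-Civita derivative, in the parameter direction \<open>a\<close>, of a vector field \<open>V\<close> along a map
  \<open>u\<close>. For \<open>V = Y \<circ> u\<close> it is the derivative of \<open>Y\<close> in direction \<open>push u x a\<close>.\<close>

definition cov_deriv ::
  "'n metric \<Rightarrow> ('a::euclidean_space \<Rightarrow> 'n) \<Rightarrow> 'a \<Rightarrow> 'a \<Rightarrow> ('a \<Rightarrow> 'n tvec) \<Rightarrow> 'n tvec" where
  "cov_deriv g u x a V = (\<lambda>c. \<chi> k. frechet_derivative (\<lambda>y. V y c) (at x) a $ k +
     (\<Sum>i\<in>UNIV. \<Sum>j\<in>UNIV. christoffel g c (u x) k i j * push u x a c $ i * V x c $ j))"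

definition induced_metric :: "'n atlas \<Rightarrow> 'n metric \<Rightarrow> (real^2 \<Rightarrow> 'n) \<Rightarrow> real^2 \<Rightarrow> real^2^2" where
  "induced_metric A g u x =
     (\<chi> i j. ip A g (u x) (push u x (axis i 1)) (push u x (axis j 1)))"

definition normal_part ::
  "'n atlas \<Rightarrow> 'n metric \<Rightarrow> (real^2 \<Rightarrow> 'n) \<Rightarrow> real^2 \<Rightarrow> 'n tvec \<Rightarrow> 'n tvec" where
  "normal_part A g u x v = (\<lambda>c. v c - (\<Sum>i\<in>UNIV. \<Sum>j\<in>UNIV.
     (matrix_inv (induced_metric A g u x) $ i $ j * ip A g (u x) v (push u x (axis i 1)))
       *\<^sub>R push u x (axis j 1) c))"

definition second_ff ::
  "'n atlas \<Rightarrow> 'n metric \<Rightarrow> (real^2 \<Rightarrow> 'n) \<Rightarrow> real^2 \<Rightarrow> 2 \<Rightarrow> 2 \<Rightarrow> 'n tvec" where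
  "second_ff A g u x i j =
     normal_part A g u x (cov_deriv g u x (axis i 1) (\<lambda>y. push u y (axis j 1)))"

definition mean_curvature_param ::
  "'n atlas \<Rightarrow> 'n metric \<Rightarrow> (real^2 \<Rightarrow> 'n) \<Rightarrow> real^2 \<Rightarrow> 'n tvec" where
  "mean_curvature_param A g u x = (\<lambda>c. \<Sum>i\<in>UNIV. \<Sum>j\<in>UNIV.
     matrix_inv (induced_metric A g u x) $ i $ j *\<^sub>R second_ff A g u x i j c)"

text \<open>At a point of a spacelike embedded surface the value does not depend on the chosen
  parametrization.\<close>

definition mean_curvature_vector ::
  "('n::topological_space) atlas \<Rightarrow> 'n metric \<Rightarrow> 'n set \<Rightarrow> 'n \<Rightarrow> 'n tvec" where
  "mean_curvature_vector A g S p = (SOME H. \<exists>D u x.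
     local_param A S D u \<and> x \<in> D \<and> u x = p \<and> H = mean_curvature_param A g u x)"

text \<open>The area measure of a closed surface is the Borel measure concentrated on it that is
  \<open>sqrt (det h) dx\<close> in every parametrization, \<open>h\<close> being the induced metric.\<close>

definition area_measure ::
  "('n::topological_space) atlas \<Rightarrow> 'n metric \<Rightarrow> 'n set \<Rightarrow> 'n measure \<Rightarrow> bool" where
  "area_measure A g S \<mu> \<longleftrightarrow> sets \<mu> = sets borel \<and> emeasure \<mu> (- S) = 0 \<and>
     (\<forall>D u B. local_param A S D u \<and> B \<in> sets borel \<and> B \<subseteq> u ` D \<longrightarrow>
        emeasure \<mu> B = (\<integral>\<^sup>+ x\<in>D \<inter> u -` B. ennreal (sqrt (det (induced_metric A g u x))) \<partial>lborel))"

definition surface_area :: "('n::topological_space) atlas \<Rightarrow> 'n metric \<Rightarrow> 'n set \<Rightarrow> ennreal" where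
  "surface_area A g S = (THE a. \<exists>\<mu>. area_measure A g S \<mu> \<and> a = emeasure \<mu> S)"

section \<open>Adapted frames\<close>

definition unit_normal_in ::
  "('n::topological_space) atlas \<Rightarrow> 'n metric \<Rightarrow> 'n set \<Rightarrow> 'n set \<Rightarrow> 'n \<Rightarrow> 'n tvec \<Rightarrow> bool" where
  "unit_normal_in A g M S p v \<longleftrightarrow> tangent_to A M p v \<and> ip A g p v v = 1 \<and>
     (\<forall>w. tangent_to A S p w \<longrightarrow> ip A g p v w = 0)"

text \<open>The leaves of the variation are \<open>F r ` S\<close> for \<open>r\<close> in an open interval \<open>I\<close>, with
  \<open>F R ` S = S\<close>. The label \<open>r\<close> is the area radius of the leaf, which makes the variation area
  expanding. The map \<open>(r,p) \<mapsto> F r p\<close> is a diffeomorphism of \<open>I \<times> S\<close> onto an open part of \<open>M\<close>, and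
  points of \<open>S\<close> move orthogonally to the leaves.\<close>

definition normal_variation ::
  "('n::topological_space) atlas \<Rightarrow> 'n metric \<Rightarrow> 'n set \<Rightarrow> 'n set \<Rightarrow> real set \<Rightarrow> real \<Rightarrow>
     (real \<Rightarrow> 'n \<Rightarrow> 'n) \<Rightarrow> bool" where
  "normal_variation A g M S I R F \<longleftrightarrow>
     (\<exists>a b. 0 < a \<and> I = {a<..<b}) \<and> R \<in> I \<and> (\<forall>p\<in>S. F R p = p) \<and>
     inj_on (\<lambda>(r, p). F r p) (I \<times> S) \<and>
     (\<forall>(D::(real^2) set) u. local_param A S D u \<longrightarrow>
        local_param A M (I \<times> D) (\<lambda>(r, x). F r (u x))) \<and>
     (\<forall>r\<in>I. \<forall>p\<in>S. \<forall>w. tangent_to A (F r ` S) (F r p) w \<longrightarrow>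
        ip A g (F r p) (push (\<lambda>s. F s p) r 1) w = 0) \<and>
     (\<forall>r\<in>I. surface_area A g (F r ` S) = ennreal (4 * pi * r\<^sup>2))"

text \<open>Local frames \<open>(et, er, X\<theta>, X\<phi>)\<close> on the open set \<open>W\<close>. The pair \<open>(D, u)\<close> is the inverse of the
  coordinate chart \<open>(\<theta>, \<phi>)\<close> of \<open>S\<close>. On \<open>M\<close> the fields \<open>X\<theta>\<close>, \<open>X\<phi>\<close> are the coordinate fields for
  \<open>\<theta>\<close>, \<open>\<phi>\<close> kept constant along the curves \<open>r \<mapsto> F r p\<close>. The inner products express the
  block form of the metric matrix, whose remaining block is arbitrary.\<close>

definition adapted_frame ::
  "('n::topological_space) atlas \<Rightarrow> 'n metric \<Rightarrow> 'n set \<Rightarrow> 'n set \<Rightarrow> real set \<Rightarrow>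
     (real \<Rightarrow> 'n \<Rightarrow> 'n) \<Rightarrow> ('n \<Rightarrow> 'n tvec) \<Rightarrow> ('n \<Rightarrow> 'n tvec) \<Rightarrow>
     'n set \<Rightarrow> (real^2) set \<Rightarrow> (real^2 \<Rightarrow> 'n) \<Rightarrow> ('n \<Rightarrow> 'n tvec) \<Rightarrow> ('n \<Rightarrow> 'n tvec) \<Rightarrow> bool" where
  "adapted_frame A g M S I F et er W D u X\<theta> X\<phi> \<longleftrightarrow>
     open W \<and> local_param A S D u \<and>
     smooth_vfield A W et \<and> smooth_vfield A W er \<and>
     smooth_vfield A W X\<theta> \<and> smooth_vfield A W X\<phi> \<and>
     (\<forall>p\<in>W. \<forall>c\<in>A. p \<in> fst c \<longrightarrow>
        det (vector [et p c, er p c, X\<theta> p c, X\<phi> p c] :: real^4^4) \<noteq> 0) \<and>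
     (\<forall>p\<in>W. tv_eq A p (lie_bracket X\<theta> X\<phi> p) (\<lambda>c. 0)) \<and>
     (\<forall>p\<in>W. ip A g p (et p) (et p) = -1 \<and> ip A g p (er p) (er p) = 1 \<and>
        ip A g p (et p) (er p) = 0 \<and>
        ip A g p (et p) (X\<theta> p) = 0 \<and> ip A g p (et p) (X\<phi> p) = 0 \<and>
        ip A g p (er p) (X\<theta> p) = 0 \<and> ip A g p (er p) (X\<phi> p) = 0) \<and>
     W \<inter> M \<subseteq> {F r (u x) | r x. r \<in> I \<and> x \<in> D} \<and>
     (\<forall>r\<in>I. \<forall>x\<in>D. F r (u x) \<in> W \<longrightarrow>
        tv_eq A (F r (u x)) (X\<theta> (F r (u x))) (push (\<lambda>y. F r (u y)) x (axis 1 1)) \<and>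
        tv_eq A (F r (u x)) (X\<phi> (F r (u x))) (push (\<lambda>y. F r (u y)) x (axis 2 1)))"

text \<open>The normal fields \<open>et\<close>, \<open>er\<close> are defined on a whole neighbourhood \<open>U\<close> of \<open>S\<close> (in particular the
  normal bundle of \<open>S\<close> is trivial), whereas \<open>X\<theta>\<close>, \<open>X\<phi>\<close> exist only locally. Which side of \<open>S\<close> in
  \<open>M\<close> is the outward one is part of the data \<open>er\<close>.\<close>

definition frame_extension ::
  "('n::topological_space) atlas \<Rightarrow> 'n metric \<Rightarrow> 'n set \<Rightarrow> 'n set \<Rightarrow> real set \<Rightarrow> real \<Rightarrow>
     (real \<Rightarrow> 'n \<Rightarrow> 'n) \<Rightarrow> 'n set \<Rightarrow> ('n \<Rightarrow> 'n tvec) \<Rightarrow> ('n \<Rightarrow> 'n tvec) \<Rightarrow> bool" where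
  "frame_extension A g M S I R F U et er \<longleftrightarrow>
     normal_variation A g M S I R F \<and> open U \<and> S \<subseteq> U \<and>
     smooth_vfield A U et \<and> smooth_vfield A U er \<and>
     (\<forall>r\<in>I. \<forall>p\<in>S. F r p \<in> U \<longrightarrow>
        unit_normal_in A g M (F r ` S) (F r p) (er (F r p)) \<and>
        (\<exists>l. tv_eq A (F r p) (er (F r p)) (\<lambda>c. l *\<^sub>R push (\<lambda>s. F s p) r 1 c))) \<and>
     (\<forall>p\<in>U. \<exists>W D u X\<theta> X\<phi>. p \<in> W \<and> W \<subseteq> U \<and> adapted_frame A g M S I F et er W D u X\<theta> X\<phi>)"

definition area_expanding ::
  "('n::topological_space) atlas \<Rightarrow> 'n metric \<Rightarrow> 'n set \<Rightarrow> 'n set \<Rightarrow> real set \<Rightarrow>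
     (real \<Rightarrow> 'n \<Rightarrow> 'n) \<Rightarrow> 'n set \<Rightarrow> ('n \<Rightarrow> 'n tvec) \<Rightarrow> ('n \<Rightarrow> 'n tvec) \<Rightarrow> bool" where
  "area_expanding A g M S I F U et er \<longleftrightarrow>
     (\<forall>W D u X\<theta> X\<phi>. W \<subseteq> U \<and> adapted_frame A g M S I F et er W D u X\<theta> X\<phi> \<longrightarrow>
        (\<forall>p\<in>W \<inter> S. deriv_along A p (er p)
           (\<lambda>q. ip A g q (X\<theta> q) (X\<theta> q) * ip A g q (X\<phi> q) (X\<phi> q) - (ip A g q (X\<theta> q) (X\<phi> q))\<^sup>2) > 0))"

text \<open>The two normal members of the dual coframe; the components of a covector \<open>\<beta>\<close> at \<open>p\<close> are such
  that its value on a tangent vector \<open>v\<close> is \<open>\<beta> p c \<bullet> v c\<close> in any chart \<open>c\<close> around \<open>p\<close>.\<close>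

definition dual_coframe ::
  "('n::topological_space) atlas \<Rightarrow> 'n metric \<Rightarrow> 'n set \<Rightarrow> 'n set \<Rightarrow> real set \<Rightarrow>
     (real \<Rightarrow> 'n \<Rightarrow> 'n) \<Rightarrow> 'n set \<Rightarrow> ('n \<Rightarrow> 'n tvec) \<Rightarrow> ('n \<Rightarrow> 'n tvec) \<Rightarrow>
     ('n \<Rightarrow> 'n chart \<Rightarrow> real^4) \<Rightarrow> ('n \<Rightarrow> 'n chart \<Rightarrow> real^4) \<Rightarrow> bool" where
  "dual_coframe A g M S I F U et er \<beta>t \<beta>r \<longleftrightarrow>
     (\<forall>W D u X\<theta> X\<phi>. W \<subseteq> U \<and> adapted_frame A g M S I F et er W D u X\<theta> X\<phi> \<longrightarrow>
        (\<forall>p\<in>W. \<forall>c\<in>A. p \<in> fst c \<longrightarrow>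
           \<beta>t p c \<bullet> et p c = 1 \<and> \<beta>t p c \<bullet> er p c = 0 \<and>
           \<beta>t p c \<bullet> X\<theta> p c = 0 \<and> \<beta>t p c \<bullet> X\<phi> p c = 0 \<and>
           \<beta>r p c \<bullet> et p c = 0 \<and> \<beta>r p c \<bullet> er p c = 1 \<and>
           \<beta>r p c \<bullet> X\<theta> p c = 0 \<and> \<beta>r p c \<bullet> X\<phi> p c = 0))"

section \<open>Steering\<close>

text \<open>The coframe exists only on \<open>U\<close>. The steered metric is \<open>g\<close> off \<open>U\<close>, and \<open>Q\<close> is a steering
  parameter only if this yields a smooth Lorentzian metric on the whole manifold.\<close>

definition steer ::
  "'n metric \<Rightarrow> 'n set \<Rightarrow> ('n \<Rightarrow> 'n chart \<Rightarrow> real^4) \<Rightarrow> ('n \<Rightarrow> 'n chart \<Rightarrow> real^4) \<Rightarrow>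
     ('n \<Rightarrow> real) \<Rightarrow> 'n metric" where
  "steer g U \<beta>t \<beta>r Q p c = (if p \<in> U
     then g p c + Q p *\<^sub>R (\<chi> i j. \<beta>t p c $ i * \<beta>r p c $ j + \<beta>r p c $ i * \<beta>t p c $ j)
     else g p c)"

definition steering_parameter ::
  "'n atlas \<Rightarrow> 'n metric \<Rightarrow> 'n set \<Rightarrow> ('n \<Rightarrow> 'n chart \<Rightarrow> real^4) \<Rightarrow> ('n \<Rightarrow> 'n chart \<Rightarrow> real^4) \<Rightarrow>
     ('n \<Rightarrow> real) \<Rightarrow> bool" where
  "steering_parameter A g U \<beta>t \<beta>r Q \<longleftrightarrow>
     smooth_fun A UNIV Q \<and> lorentz_metric A (steer g U \<beta>t \<beta>r Q)"

definition mean_curvature_tangential ::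
  "('n::topological_space) atlas \<Rightarrow> 'n metric \<Rightarrow> 'n set \<Rightarrow> 'n set \<Rightarrow> bool" where
  "mean_curvature_tangential A g M S \<longleftrightarrow>
     (\<forall>p\<in>S. tangent_to A M p (mean_curvature_vector A g S p))"

section \<open>The connection is the Levi-Civita connection\<close>

lemma metric_deriv_sym:
  assumes "smooth_atlas A" "lorentz_metric A g" "c \<in> A" "p \<in> fst c"
  shows "metric_deriv g c p l i j = metric_deriv g c p l j i"
proof -
  let ?f = "\<lambda>y. g (cinv c y) c" and ?y = "snd c p"
  have op: "open (snd c ` fst c)" and y: "?y \<in> snd c ` fst c"
    using assms by (auto simp: smooth_atlas_def)
  have "smooth_on (snd c ` fst c) ?f" using assms by (auto simp: lorentz_metric_def)
  then have "Ck_on (Suc 0) ?f (snd c ` fst c)" unfolding smooth_on_def by blast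
  then have "?f differentiable (at ?y)" using assms(4) by simp
  then have d: "(?f has_derivative frechet_derivative ?f (at ?y)) (at ?y)"
    by (simp add: frechet_derivative_works)
  have bl: "bounded_linear (\<lambda>m::real^4^4. m $ a $ b)" for a b
    using bounded_linear_compose[OF bounded_linear_vec_nth bounded_linear_vec_nth] by blast
  have c: "((\<lambda>y. ?f y $ a $ b) has_derivative (\<lambda>h. frechet_derivative ?f (at ?y) h $ a $ b)) (at ?y)" for a b
    by (rule bounded_linear.has_derivative[OF bl d])
  have s: "?f y $ i $ j = ?f y $ j $ i" if "y \<in> snd c ` fst c" for y
  proof -
    have "cinv c y \<in> fst c" using that by (rule inv_into_into)
    then have "transpose (?f y) = ?f y" using assms by (auto simp: lorentz_metric_def)
    then have "transpose (?f y) $ i $ j = ?f y $ i $ j" by simp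
    then show ?thesis by (simp add: transpose_def)
  qed
  have "((\<lambda>y. ?f y $ i $ j) has_derivative (\<lambda>h. frechet_derivative ?f (at ?y) h $ j $ i)) (at ?y)"
    by (rule has_derivative_transform_within_open[OF c[of j i] op y]) (use s in simp)
  from has_derivative_unique[OF this c[of i j]] show ?thesis
    unfolding metric_deriv_def by (metis (no_types))
qed

lemma christoffel_torsion_free:
  assumes "smooth_atlas A" "lorentz_metric A g" "c \<in> A" "p \<in> fst c"
  shows "christoffel g c p k i j = christoffel g c p k j i"
  unfolding christoffel_def by (simp add: metric_deriv_sym[OF assms, of _ i j] add.commute)

lemma christoffel_metric:
  assumes "smooth_atlas A" "lorentz_metric A g" "c \<in> A" "p \<in> fst c"
  shows "metric_deriv g c p i j k =
    (\<Sum>l\<in>UNIV. christoffel g c p l i j * g p c $ l $ k) + (\<Sum>l\<in>UNIV. christoffel g c p l i k * g p c $ j $ l)"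
proof -
  let ?G = "g p c"
  let ?K = "\<lambda>i j l. metric_deriv g c p i j l + metric_deriv g c p j i l - metric_deriv g c p l i j"
  have sym: "transpose ?G = ?G" and "\<exists>P. invertible P \<and> transpose P ** ?G ** P = minkowski"
    using assms by (auto simp: lorentz_metric_def)
  then obtain P where P: "transpose P ** ?G ** P = minkowski" by blast
  have "det minkowski = (\<Prod>i\<in>UNIV. minkowski $ i $ i)"
    by (rule det_diagonal) (simp add: minkowski_def)
  then have "det minkowski \<noteq> 0" by (simp add: minkowski_def)
  then have "det ?G \<noteq> 0" unfolding P[symmetric] det_mul by auto
  then have "\<exists>B. ?G ** B = mat 1 \<and> B ** ?G = mat 1"
    by (simp add: invertible_det_nz[symmetric] invertible_def)
  then have inv: "?G ** matrix_inv ?G = mat 1"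
    unfolding matrix_inv_def by (rule someI2_ex) simp
  have symc: "?G $ a $ b = ?G $ b $ a" for a b
    using arg_cong[OF sym, of "\<lambda>m. m $ a $ b"] by (simp add: transpose_def)
  have low: "(\<Sum>l\<in>UNIV. ?G $ m $ l * christoffel g c p l a b) = ?K a b m / 2" for m a b
  proof -
    have "(\<Sum>l\<in>UNIV. ?G $ m $ l * christoffel g c p l a b)
        = (1/2) * (\<Sum>l\<in>UNIV. \<Sum>n\<in>UNIV. ?G $ m $ l * matrix_inv ?G $ l $ n * ?K a b n)"
      unfolding christoffel_def by (simp add: sum_distrib_left ac_simps)
    also have "\<dots> = (1/2) * (\<Sum>n\<in>UNIV. (\<Sum>l\<in>UNIV. ?G $ m $ l * matrix_inv ?G $ l $ n) * ?K a b n)"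
      by (subst sum.swap) (simp add: sum_distrib_right)
    also have "\<dots> = (1/2) * (\<Sum>n\<in>UNIV. (?G ** matrix_inv ?G) $ m $ n * ?K a b n)"
      by (simp add: matrix_matrix_mult_def)
    also have "\<dots> = (1/2) * (\<Sum>n\<in>UNIV. if n = m then ?K a b n else 0)"
      unfolding inv by (intro arg_cong[where f="(*) (1/2)"] sum.cong) (auto simp: mat_def)
    finally show ?thesis by simp
  qed
  have "(\<Sum>l\<in>UNIV. christoffel g c p l i j * ?G $ l $ k) = ?K i j k / 2"
    using low[of k i j] by (simp add: mult.commute symc[of _ k])
  moreover have "(\<Sum>l\<in>UNIV. christoffel g c p l i k * ?G $ j $ l) = ?K i k j / 2"
    using low[of j i k] by (simp add: mult.commute)
  ultimately show ?thesis
    using metric_deriv_sym[OF assms, of i j k] metric_deriv_sym[OF assms, of k i j]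
      metric_deriv_sym[OF assms, of j i k] by (simp add: field_simps)
qed

end

theory Submission
  imports Defs
begin


text \<open>Let \<open>K = Q (\<beta>\<^sub>t \<otimes> \<beta>\<^sub>r + \<beta>\<^sub>r \<otimes> \<beta>\<^sub>t)\<close> be the term that steering adds to \<open>g\<close>. Vectors tangent to the
  surface \<open>S\<close> are killed by both \<open>\<beta>\<^sub>t\<close> and \<open>\<beta>\<^sub>r\<close>. So \<open>K\<close> changes neither the induced metric of \<open>S\<close> nor
  what is normal to it, and since \<open>K(v, w)\<close> is a sum of products of two vanishing factors when
  \<open>v, w\<close> are tangent to \<open>S\<close>, no derivative of \<open>K(v, w)\<close> survives on \<open>S\<close> either.

  For a normal field \<open>E\<close>, differentiating \<open>g(\<partial>\<^sub>i u, E) = 0\<close> along a parametrization \<open>u\<close> of \<open>S\<close> gives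
  \<open>g(H, E) = - tr (L\<^sub>E g) / 2\<close>, where \<open>L\<^sub>E g\<close> is the Lie derivative of the metric and the trace is taken over
  the tangent plane (\<open>mean_curvature_param_lie\<close>). By the remark above the right-hand side is the
  same for every steered metric. Write \<open>\<eta>\<^sub>t\<close>, \<open>\<eta>\<^sub>r\<close> for its values at \<open>e\<^sub>t\<close>, \<open>e\<^sub>r\<close>. If \<open>H\<close> is the mean
  curvature vector of the steered metric, \<open>\<alpha> = g(H, e\<^sub>t)\<close> and \<open>\<beta> = g(H, e\<^sub>r)\<close>, then pairing \<open>H\<close> with the
  normal frame in the steered metric yields \<open>\<eta>\<^sub>t = \<alpha> + Q \<beta>\<close> and \<open>\<eta>\<^sub>r = \<beta> - Q \<alpha>\<close>. Being tangential to \<open>M\<close> means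
  \<open>\<alpha> = 0\<close>, and \<open>Q \<eta>\<^sub>r - \<eta>\<^sub>t = - (1 + Q\<^sup>2) \<alpha>\<close>, so it is equivalent to the linear equation
  \<open>Q \<eta>\<^sub>r = \<eta>\<^sub>t\<close> (\<open>mean_curvature_tangential_iff\<close>).

  This determines \<open>Q\<close> on \<open>S\<close> as soon as \<open>\<eta>\<^sub>r \<noteq> 0\<close>, which is where area expansion enters. Along the
  variation \<open>e\<^sub>r\<close> is a multiple of the radial coordinate field, so its brackets with \<open>X\<^sub>\<theta>\<close>, \<open>X\<^sub>\<phi>\<close> are
  multiples of \<open>e\<^sub>r\<close> and drop out of \<open>L\<^sub>e\<^sub>r g\<close> on the tangent plane; the trace becomes
  \<open>e\<^sub>r(ab - c\<^sup>2) / (ab - c\<^sup>2) > 0\<close> and \<open>\<eta>\<^sub>r < 0\<close> (\<open>outward_mean_curvature_negative\<close>).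

  For existence, the quotient \<open>\<eta>\<^sub>t / \<eta>\<^sub>r\<close> must be extended smoothly from \<open>S\<close>. The traces over the local fields
  \<open>X\<^sub>\<theta>\<close>, \<open>X\<^sub>\<phi>\<close> are defined and smooth near each point of \<open>S\<close>, also off the surface, which gives local extensions; they are
  glued with bump functions supported in the domain of the coframe
  (\<open>smooth_extension_from_compact\<close>). Steering by any such function keeps the metric Lorentzian, because the
  steered form is the pullback of \<open>g\<close> under a linear isomorphism (\<open>steered_form_signature\<close>).\<close>

section \<open>Calculus of smooth maps\<close>

lemma Ck_on_cong:
  fixes f g :: "'a::euclidean_space \<Rightarrow> 'b::real_normed_vector"
  assumes "open S" and "\<And>x. x \<in> S \<Longrightarrow> f x = g x" and "Ck_on k f S"
  shows "Ck_on k g S"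
  using assms(2,3)
proof (induction k arbitrary: f g)
  case 0
  then show ?case by (simp cong: continuous_on_cong)
next
  case (Suc k)
  have d: "(g has_derivative frechet_derivative f (at x)) (at x)" if x: "x \<in> S" for x
    using Suc.prems that assms(1)
    by (auto intro: has_derivative_transform_within_open simp: frechet_derivative_works)
  have e: "frechet_derivative g (at x) = frechet_derivative f (at x)" if "x \<in> S" for x
    using frechet_derivative_at[OF d[OF that]] by simp
  have "Ck_on k (\<lambda>x. frechet_derivative g (at x) v) S" for v
    by (rule Suc.IH[where f="\<lambda>x. frechet_derivative f (at x) v"]) (use e Suc.prems in auto)
  moreover have "g differentiable at x" if "x \<in> S" for x
    using d[OF that] by (rule differentiableI)
  ultimately show ?case by auto
qed

lemma Ck_on_SucD:
  fixes f :: "'a::euclidean_space \<Rightarrow> 'b::real_normed_vector"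
  shows "Ck_on (Suc k) f S \<Longrightarrow> Ck_on k f S"
proof (induction k arbitrary: f)
  case 0
  then show ?case
    by (auto intro!: continuous_at_imp_continuous_on differentiable_imp_continuous_within)
qed (simp del: Ck_on.simps(1))

lemma Ck_on_subset: "Ck_on k f S \<Longrightarrow> T \<subseteq> S \<Longrightarrow> Ck_on k f T"
  by (induction k arbitrary: f) (auto intro: continuous_on_subset)

lemma Ck_on_local:
  fixes f :: "'a::euclidean_space \<Rightarrow> 'b::real_normed_vector"
  assumes "\<And>x. x \<in> S \<Longrightarrow> \<exists>T. open T \<and> x \<in> T \<and> Ck_on k f T"
  shows "Ck_on k f S"
  using assms
proof (induction k arbitrary: f)
  case 0
  show ?case
  proof (simp, rule continuous_at_imp_continuous_on, rule ballI)
    fix x assume "x \<in> S"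
    then obtain T where "open T" "x \<in> T" "continuous_on T f" using 0 by force
    then show "isCont f x" by (simp add: continuous_on_eq_continuous_at)
  qed
next
  case (Suc k)
  have "Ck_on k (\<lambda>x. frechet_derivative f (at x) v) S" for v
    by (rule Suc.IH) (use Suc.prems in \<open>fastforce\<close>)
  moreover have "f differentiable at x" if "x \<in> S" for x
    using Suc.prems[OF that] by auto
  ultimately show ?case by simp
qed

lemma Ck_on_const: "Ck_on k (\<lambda>x. c) S"
  by (induction k arbitrary: c) simp_all

lemma Ck_on_linear:
  assumes "bounded_linear f"
  shows "Ck_on k f S"
proof (cases k)
  case 0
  then show ?thesis using assms by (simp add: linear_continuous_on)
next
  case (Suc j)
  have d: "(f has_derivative f) (at x)" for x
    by (rule bounded_linear_imp_has_derivative[OF assms])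
  have "frechet_derivative f (at x) = f" for x
    using frechet_derivative_at[OF d] by simp
  then show ?thesis using Suc d by (auto simp: Ck_on_const intro: differentiableI)
qed

lemma Ck_on_add:
  fixes f g :: "'a::euclidean_space \<Rightarrow> 'b::real_normed_vector"
  assumes "open S"
  shows "Ck_on k f S \<Longrightarrow> Ck_on k g S \<Longrightarrow> Ck_on k (\<lambda>x. f x + g x) S"
proof (induction k arbitrary: f g)
  case 0
  then show ?case by (simp add: continuous_on_add)
next
  case (Suc k)
  have d: "((\<lambda>x. f x + g x) has_derivative (\<lambda>v. frechet_derivative f (at x) v + frechet_derivative g (at x) v)) (at x)"
    if "x \<in> S" for x
    using Suc.prems that by (auto intro!: has_derivative_add simp: frechet_derivative_works)
  have "Ck_on k (\<lambda>x. frechet_derivative (\<lambda>x. f x + g x) (at x) v) S" for v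
    by (rule Ck_on_cong[OF assms _ Suc.IH[of "\<lambda>x. frechet_derivative f (at x) v" "\<lambda>x. frechet_derivative g (at x) v"]])
      (use frechet_derivative_at[OF d] Suc.prems in \<open>auto simp: fun_eq_iff\<close>)
  then show ?case using d by (auto intro: differentiableI)
qed

lemma Ck_on_sum:
  fixes f :: "'i \<Rightarrow> 'a::euclidean_space \<Rightarrow> 'b::real_normed_vector"
  assumes "open S" and "\<And>i. i \<in> X \<Longrightarrow> Ck_on k (f i) S"
  shows "Ck_on k (\<lambda>x. \<Sum>i\<in>X. f i x) S"
  using assms(2)
  by (induction X rule: infinite_finite_induct) (auto simp: Ck_on_const intro!: Ck_on_add[OF assms(1)])

lemma Ck_on_bilinear:
  fixes f :: "'a::euclidean_space \<Rightarrow> 'b::real_normed_vector" and g :: "'a \<Rightarrow> 'c::real_normed_vector"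
  assumes "open S" and B: "bounded_bilinear B"
  shows "Ck_on k f S \<Longrightarrow> Ck_on k g S \<Longrightarrow> Ck_on k (\<lambda>x. B (f x) (g x)) S"
proof (induction k arbitrary: f g)
  case 0
  then show ?case by (simp add: bounded_bilinear.continuous_on[OF B])
next
  case (Suc k)
  have d: "((\<lambda>x. B (f x) (g x)) has_derivative
      (\<lambda>v. B (f x) (frechet_derivative g (at x) v) + B (frechet_derivative f (at x) v) (g x))) (at x)"
    if "x \<in> S" for x
    using Suc.prems that by (auto intro!: bounded_bilinear.FDERIV[OF B] simp: frechet_derivative_works)
  have "Ck_on k (\<lambda>x. B (f x) (frechet_derivative g (at x) v) + B (frechet_derivative f (at x) v) (g x)) S" for v
    using Suc.prems Ck_on_SucD[OF Suc.prems(1)] Ck_on_SucD[OF Suc.prems(2)]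
    by (intro Ck_on_add assms Suc.IH) auto
  then have "Ck_on k (\<lambda>x. frechet_derivative (\<lambda>x. B (f x) (g x)) (at x) v) S" for v
    by (rule Ck_on_cong[OF assms(1), rotated]) (use frechet_derivative_at[OF d] in \<open>auto simp: fun_eq_iff\<close>)
  then show ?case using d by (auto intro: differentiableI)
qed

lemma frechet_basis_sum:
  fixes f :: "'a::euclidean_space \<Rightarrow> 'b::real_normed_vector"
  assumes "f differentiable at x"
  shows "frechet_derivative f (at x) w = (\<Sum>b\<in>Basis. (w \<bullet> b) *\<^sub>R frechet_derivative f (at x) b)"
proof -
  interpret bounded_linear "frechet_derivative f (at x)"
    using assms by (simp add: frechet_derivative_works has_derivative_bounded_linear)
  show ?thesis
    by (subst euclidean_representation[of w, symmetric], subst sum) (simp add: scaleR)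
qed

text \<open>The chain rule expresses the derivative of a composite through the partial derivatives of the outer
  map, so the induction also needs sums and products of maps of lower order.\<close>

lemma Ck_on_compose:
  fixes f :: "'b::euclidean_space \<Rightarrow> 'c::real_normed_vector" and g :: "'a::euclidean_space \<Rightarrow> 'b"
  assumes "open S" and "g ` S \<subseteq> T"
  shows "Ck_on k f T \<Longrightarrow> Ck_on k g S \<Longrightarrow> Ck_on k (\<lambda>x. f (g x)) S"
proof (induction k arbitrary: f)
  case 0
  then show ?case using assms by (auto intro: continuous_on_compose2)
next
  case (Suc k)
  have d: "((\<lambda>x. f (g x)) has_derivative (\<lambda>v. frechet_derivative f (at (g x)) (frechet_derivative g (at x) v))) (at x)"
    if "x \<in> S" for x
  proof (rule has_derivative_compose[of g])
    show "(g has_derivative frechet_derivative g (at x)) (at x)"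
      using Suc.prems(2) that unfolding Ck_on.simps frechet_derivative_works by blast
    show "(f has_derivative frechet_derivative f (at (g x))) (at (g x))"
      using Suc.prems(1) that assms(2) unfolding Ck_on.simps frechet_derivative_works by blast
  qed
  have "Ck_on k (\<lambda>x. \<Sum>b\<in>Basis. (frechet_derivative g (at x) v \<bullet> b) *\<^sub>R frechet_derivative f (at (g x)) b) S" for v
    using Suc.prems Ck_on_SucD[OF Suc.prems(2)]
    by (intro Ck_on_sum Ck_on_bilinear[OF assms(1) bounded_bilinear_scaleR]
        Ck_on_bilinear[OF assms(1) bounded_bilinear_inner] Ck_on_const Suc.IH assms(1)) auto
  then have "Ck_on k (\<lambda>x. frechet_derivative (\<lambda>x. f (g x)) (at x) v) S" for v
  proof (rule Ck_on_cong[OF assms(1), rotated])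
    fix x assume x: "x \<in> S"
    then have "f differentiable at (g x)" using Suc.prems(1) assms(2) by auto
    from frechet_basis_sum[OF this, of "frechet_derivative g (at x) v"] frechet_derivative_at[OF d[OF x]]
    show "(\<Sum>b\<in>Basis. (frechet_derivative g (at x) v \<bullet> b) *\<^sub>R frechet_derivative f (at (g x)) b) =
      frechet_derivative (\<lambda>x. f (g x)) (at x) v" by (auto simp: fun_eq_iff)
  qed
  then show ?case using d by (auto intro: differentiableI)
qed

lemma Ck_on_inverse:
  fixes f :: "'a::euclidean_space \<Rightarrow> real"
  assumes "open S" and nz: "\<And>x. x \<in> S \<Longrightarrow> f x \<noteq> 0"
  shows "Ck_on k f S \<Longrightarrow> Ck_on k (\<lambda>x. inverse (f x)) S"
proof (induction k)
  case 0
  then show ?case using nz by (auto intro: continuous_on_inverse)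
next
  case (Suc k)
  have d: "((\<lambda>x. inverse (f x)) has_derivative
      (\<lambda>v. - (inverse (f x) * frechet_derivative f (at x) v * inverse (f x)))) (at x)" if "x \<in> S" for x
    using Suc.prems that nz by (intro Deriv.has_derivative_inverse) (auto simp: frechet_derivative_works)
  have I: "Ck_on k (\<lambda>x. inverse (f x)) S" using Suc.IH Ck_on_SucD[OF Suc.prems] by blast
  have "Ck_on k (\<lambda>x. - 1 * (inverse (f x) * frechet_derivative f (at x) v * inverse (f x))) S" for v
    using Suc.prems by (intro Ck_on_bilinear[OF assms(1) bounded_bilinear_mult] Ck_on_const I) auto
  then have "Ck_on k (\<lambda>x. frechet_derivative (\<lambda>x. inverse (f x)) (at x) v) S" for v
    by (rule Ck_on_cong[OF assms(1), rotated]) (use frechet_derivative_at[OF d] in \<open>auto simp: fun_eq_iff\<close>)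
  then show ?case using d by (auto intro: differentiableI)
qed

lemma smooth_on_cong: "smooth_on S f \<Longrightarrow> open S \<Longrightarrow> (\<And>x. x \<in> S \<Longrightarrow> f x = g x) \<Longrightarrow> smooth_on S g"
  unfolding smooth_on_def using Ck_on_cong by blast

lemma smooth_on_subset: "smooth_on S f \<Longrightarrow> T \<subseteq> S \<Longrightarrow> smooth_on T f"
  unfolding smooth_on_def using Ck_on_subset by blast

lemma smooth_on_local:
  assumes "\<And>x. x \<in> S \<Longrightarrow> \<exists>T. open T \<and> x \<in> T \<and> smooth_on T f"
  shows "smooth_on S f"
  unfolding smooth_on_def by (intro allI Ck_on_local) (use assms in \<open>auto simp: smooth_on_def\<close>)

lemma smooth_on_differentiable: "smooth_on S f \<Longrightarrow> x \<in> S \<Longrightarrow> f differentiable at x"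
  unfolding smooth_on_def using Ck_on.simps(2) by blast

lemma smooth_on_has_derivative:
  "smooth_on S f \<Longrightarrow> x \<in> S \<Longrightarrow> (f has_derivative frechet_derivative f (at x)) (at x)"
  using smooth_on_differentiable frechet_derivative_works by blast

lemma smooth_on_imp_continuous_on: "smooth_on S f \<Longrightarrow> continuous_on S f"
  unfolding smooth_on_def using Ck_on.simps(1) by blast

named_theorems smooth_intros

lemma smooth_on_const [smooth_intros]: "smooth_on S (\<lambda>x. c)"
  by (simp add: smooth_on_def Ck_on_const)

lemma smooth_on_linear: "bounded_linear f \<Longrightarrow> smooth_on S f"
  by (simp add: smooth_on_def Ck_on_linear)

lemma smooth_on_id [smooth_intros]: "smooth_on S (\<lambda>x. x)"
  by (simp add: smooth_on_linear bounded_linear_ident)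

lemma smooth_on_add [smooth_intros]:
  "open S \<Longrightarrow> smooth_on S f \<Longrightarrow> smooth_on S g \<Longrightarrow> smooth_on S (\<lambda>x. f x + g x)"
  by (simp add: smooth_on_def Ck_on_add)

lemma smooth_on_sum [smooth_intros]:
  "open S \<Longrightarrow> (\<And>i. i \<in> X \<Longrightarrow> smooth_on S (f i)) \<Longrightarrow> smooth_on S (\<lambda>x. \<Sum>i\<in>X. f i x)"
  by (simp add: smooth_on_def Ck_on_sum)

lemma smooth_on_bilinear:
  "bounded_bilinear B \<Longrightarrow> open S \<Longrightarrow> smooth_on S f \<Longrightarrow> smooth_on S g \<Longrightarrow> smooth_on S (\<lambda>x. B (f x) (g x))"
  by (simp add: smooth_on_def Ck_on_bilinear)

lemma smooth_on_compose:
  "smooth_on T f \<Longrightarrow> open S \<Longrightarrow> smooth_on S g \<Longrightarrow> g ` S \<subseteq> T \<Longrightarrow> smooth_on S (\<lambda>x. f (g x))"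
  unfolding smooth_on_def using Ck_on_compose by blast

lemma smooth_on_bounded_linear:
  fixes f :: "'b::euclidean_space \<Rightarrow> 'c::real_normed_vector"
  assumes "bounded_linear f" "open S" "smooth_on S g"
  shows "smooth_on S (\<lambda>x. f (g x))"
  using smooth_on_compose[OF smooth_on_linear[OF assms(1), of UNIV] assms(2,3)] by simp

lemmas smooth_on_mult [smooth_intros] = smooth_on_bilinear[OF bounded_bilinear_mult]
lemmas smooth_on_scaleR [smooth_intros] = smooth_on_bilinear[OF bounded_bilinear_scaleR]
lemmas smooth_on_inner [smooth_intros] = smooth_on_bilinear[OF bounded_bilinear_inner]
lemmas smooth_on_vec_nth [smooth_intros] = smooth_on_bounded_linear[OF bounded_linear_vec_nth]
lemmas smooth_on_minus [smooth_intros] = smooth_on_bounded_linear[OF bounded_linear_minus[OF bounded_linear_ident]]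

lemma smooth_on_diff [smooth_intros]:
  "open S \<Longrightarrow> smooth_on S f \<Longrightarrow> smooth_on S g \<Longrightarrow> smooth_on S (\<lambda>x. f x - g x)"
  using smooth_on_add[of S f "\<lambda>x. - 1 *\<^sub>R g x"] smooth_on_scaleR[of S "\<lambda>x. - 1" g]
  by (simp add: smooth_on_const)

lemma smooth_on_inverse [smooth_intros]:
  fixes f :: "'a::euclidean_space \<Rightarrow> real"
  shows "open S \<Longrightarrow> smooth_on S f \<Longrightarrow> (\<And>x. x \<in> S \<Longrightarrow> f x \<noteq> 0) \<Longrightarrow> smooth_on S (\<lambda>x. inverse (f x))"
  unfolding smooth_on_def using Ck_on_inverse by blast

lemma smooth_on_divide [smooth_intros]:
  fixes f :: "'a::euclidean_space \<Rightarrow> real"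
  shows "open S \<Longrightarrow> smooth_on S f \<Longrightarrow> smooth_on S g \<Longrightarrow> (\<And>x. x \<in> S \<Longrightarrow> g x \<noteq> 0) \<Longrightarrow>
    smooth_on S (\<lambda>x. f x / g x)"
  by (simp add: divide_inverse smooth_on_mult smooth_on_inverse)

lemma bounded_bilinear_matrix_vector_mult:
  "bounded_bilinear (\<lambda>(A::real^'n^'m) x. A *v x)"
  unfolding bilinear_conv_bounded_bilinear[symmetric] bilinear_def
  by (auto intro!: linearI simp: matrix_vector_right_distrib matrix_vector_mult_add_rdistrib
      matrix_vector_mult_scaleR scaleR_matrix_vector_assoc)

lemmas smooth_on_matrix_vector_mult [smooth_intros] = smooth_on_bilinear[OF bounded_bilinear_matrix_vector_mult]

lemma smooth_on_frechet_derivative: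
  fixes f :: "'a::euclidean_space \<Rightarrow> 'b::real_normed_vector"
  assumes "smooth_on S f" and "open S" and w: "smooth_on S w"
  shows "smooth_on S (\<lambda>x. frechet_derivative f (at x) (w x))"
proof -
  have "smooth_on S (\<lambda>x. frechet_derivative f (at x) v)" for v
    using assms(1) unfolding smooth_on_def using Ck_on.simps(2) by blast
  then have "smooth_on S (\<lambda>x. \<Sum>b\<in>Basis. (w x \<bullet> b) *\<^sub>R frechet_derivative f (at x) b)"
    using assms by (intro smooth_intros)
  then show ?thesis
    by (rule smooth_on_cong[OF _ assms(2)]) (metis frechet_basis_sum smooth_on_differentiable assms(1))
qed

lemma smooth_on_components:
  fixes f :: "'a::euclidean_space \<Rightarrow> 'b::euclidean_space"
  assumes "open S" and "\<And>b. b \<in> Basis \<Longrightarrow> smooth_on S (\<lambda>x. f x \<bullet> b)"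
  shows "smooth_on S f"
proof -
  have "smooth_on S (\<lambda>x. \<Sum>b\<in>Basis. (f x \<bullet> b) *\<^sub>R b)"
    by (intro smooth_on_sum smooth_on_scaleR smooth_on_const assms)
  then show ?thesis by (simp add: euclidean_representation)
qed

subsection \<open>Symmetry of second derivatives\<close>

text \<open>The mean value theorem, applied once in each direction, turns a second difference into a mixed
  second derivative at a nearby point. The second difference is symmetric in the two directions, so comparing
  both orders as \<open>s\<close> tends to \<open>0\<close> shows that mixed derivatives agree.\<close>

lemma second_difference_mean_value:
  fixes f :: "'a::euclidean_space \<Rightarrow> real"
  assumes f: "Ck_on (Suc (Suc 0)) f (ball x e)" and s: "0 < s"
    and small: "s * norm v + s * norm w < e"
  shows "\<exists>z. norm (z - x) \<le> s * norm v + s * norm w \<and>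
    f (x + s *\<^sub>R v + s *\<^sub>R w) - f (x + s *\<^sub>R v) - f (x + s *\<^sub>R w) + f x =
      s\<^sup>2 * frechet_derivative (\<lambda>y. frechet_derivative f (at y) v) (at z) w"
proof -
  define D where "D = (\<lambda>y. frechet_derivative f (at y) v)"
  have in_ball: "x + t *\<^sub>R v + r *\<^sub>R w \<in> ball x e" if "0 \<le> t" "t \<le> s" "0 \<le> r" "r \<le> s" for t r
  proof -
    have "norm (t *\<^sub>R v + r *\<^sub>R w) \<le> t * norm v + r * norm w"
      using norm_triangle_ineq[of "t *\<^sub>R v" "r *\<^sub>R w"] that by simp
    also have "\<dots> \<le> s * norm v + s * norm w"
      using that by (intro add_mono mult_right_mono) auto
    finally have "norm (t *\<^sub>R v + r *\<^sub>R w) < e" using small by simp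
    moreover have "dist x (x + t *\<^sub>R v + r *\<^sub>R w) = norm (t *\<^sub>R v + r *\<^sub>R w)"
      by (metis (no_types, lifting) add.assoc add_diff_cancel_left' dist_norm norm_minus_commute)
    ultimately show ?thesis by simp
  qed
  have df: "(f has_derivative frechet_derivative f (at y)) (at y)" if "y \<in> ball x e" for y
    using f that by (simp add: frechet_derivative_works del: mem_ball)
  have dD: "(D has_derivative frechet_derivative D (at y)) (at y)" if "y \<in> ball x e" for y
    using f that by (simp add: frechet_derivative_works D_def del: mem_ball)
  have line: "((\<lambda>t. h (y + t *\<^sub>R u)) has_real_derivative frechet_derivative h (at (y + t *\<^sub>R u)) u) (at t)"
    if "(h has_derivative frechet_derivative h (at (y + t *\<^sub>R u))) (at (y + t *\<^sub>R u))"
    for h :: "'a \<Rightarrow> real" and y u t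
  proof -
    have "((\<lambda>t. y + t *\<^sub>R u) has_derivative (\<lambda>r. r *\<^sub>R u)) (at t)"
      by (auto intro!: derivative_eq_intros)
    from has_derivative_compose[OF this that]
    have "((\<lambda>t. h (y + t *\<^sub>R u)) has_derivative (\<lambda>r. frechet_derivative h (at (y + t *\<^sub>R u)) (r *\<^sub>R u))) (at t)" .
    moreover have "frechet_derivative h (at (y + t *\<^sub>R u)) (r *\<^sub>R u) = frechet_derivative h (at (y + t *\<^sub>R u)) u * r" for r
      using linear_scale[OF has_derivative_linear[OF that]] by simp
    ultimately show ?thesis by (simp add: has_field_derivative_def)
  qed
  have "\<exists>t>0. t < s \<and> (f (x + s *\<^sub>R w + s *\<^sub>R v) - f (x + s *\<^sub>R v)) - (f (x + s *\<^sub>R w + 0 *\<^sub>R v) - f (x + 0 *\<^sub>R v)) =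
      (s - 0) * (D (x + s *\<^sub>R w + t *\<^sub>R v) - D (x + t *\<^sub>R v))"
    unfolding D_def
  proof (rule MVT2[OF s])
    fix t assume t: "0 \<le> t" "t \<le> s"
    show "((\<lambda>t. f (x + s *\<^sub>R w + t *\<^sub>R v) - f (x + t *\<^sub>R v)) has_real_derivative
        frechet_derivative f (at (x + s *\<^sub>R w + t *\<^sub>R v)) v - frechet_derivative f (at (x + t *\<^sub>R v)) v) (at t)"
      using in_ball[of t s] in_ball[of t 0] t s
      by (intro DERIV_diff line df) (auto simp: algebra_simps)
  qed
  then obtain t where t: "0 < t" "t < s"
    and 1: "(f (x + s *\<^sub>R w + s *\<^sub>R v) - f (x + s *\<^sub>R v)) - (f (x + s *\<^sub>R w) - f x) =
      s * (D (x + s *\<^sub>R w + t *\<^sub>R v) - D (x + t *\<^sub>R v))" by auto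
  have "\<exists>r>0. r < s \<and> D (x + t *\<^sub>R v + s *\<^sub>R w) - D (x + t *\<^sub>R v + 0 *\<^sub>R w) =
      (s - 0) * frechet_derivative D (at (x + t *\<^sub>R v + r *\<^sub>R w)) w"
    using t in_ball[of t] by (intro MVT2[OF s] line dD) auto
  then obtain r where r: "0 < r" "r < s"
    and 2: "D (x + t *\<^sub>R v + s *\<^sub>R w) - D (x + t *\<^sub>R v) = s * frechet_derivative D (at (x + t *\<^sub>R v + r *\<^sub>R w)) w"
    by auto
  have "norm (x + t *\<^sub>R v + r *\<^sub>R w - x) \<le> t * norm v + r * norm w"
    using norm_triangle_ineq[of "t *\<^sub>R v" "r *\<^sub>R w"] t r by (simp add: add.assoc)
  also have "\<dots> \<le> s * norm v + s * norm w"
    using t r by (intro add_mono mult_right_mono) auto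
  finally show ?thesis
    using 1 2 by (intro exI[of _ "x + t *\<^sub>R v + r *\<^sub>R w"]) (simp add: D_def algebra_simps power2_eq_square)
qed

lemma second_derivative_symmetric_real:
  fixes f :: "'a::euclidean_space \<Rightarrow> real"
  assumes "Ck_on (Suc (Suc 0)) f S" "open S" "x \<in> S"
  shows "frechet_derivative (\<lambda>y. frechet_derivative f (at y) v) (at x) w =
    frechet_derivative (\<lambda>y. frechet_derivative f (at y) w) (at x) v"
proof (rule ccontr)
  define P where "P = (\<lambda>y. frechet_derivative (\<lambda>y. frechet_derivative f (at y) v) (at y) w)"
  define R where "R = (\<lambda>y. frechet_derivative (\<lambda>y. frechet_derivative f (at y) w) (at y) v)"
  assume "\<not> ?thesis"
  then have ne: "P x \<noteq> R x" by (simp add: P_def R_def)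
  have cont: "continuous (at x) P" "continuous (at x) R"
    using assms by (auto simp: P_def R_def continuous_on_eq_continuous_at)
  define \<delta> where "\<delta> = \<bar>P x - R x\<bar> / 2"
  have \<delta>: "\<delta> > 0" using ne by (simp add: \<delta>_def)
  obtain d1 where d1: "d1 > 0" "\<And>y. dist y x < d1 \<Longrightarrow> dist (P y) (P x) < \<delta>"
    using cont(1) \<delta> unfolding continuous_at_eps_delta by metis
  obtain d2 where d2: "d2 > 0" "\<And>y. dist y x < d2 \<Longrightarrow> dist (R y) (R x) < \<delta>"
    using cont(2) \<delta> unfolding continuous_at_eps_delta by metis
  obtain e where e: "e > 0" "ball x e \<subseteq> S"
    using assms(2,3) by (meson openE)
  define m where "m = min e (min d1 d2)"
  have m: "m > 0" "m \<le> e" "m \<le> d1" "m \<le> d2" using e d1 d2 by (auto simp: m_def)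
  \<comment> \<open>the step is chosen so that both intermediate points lie within all three radii\<close>
  define s where "s = m / (2 * (norm v + norm w + 1))"
  have nvw: "norm v + norm w + 1 > 0" by (simp add: add_nonneg_pos)
  have s: "s > 0" using m nvw by (simp add: s_def)
  have "s * norm v + s * norm w < s * (norm v + norm w + 1)" using s by (simp add: algebra_simps)
  also have "\<dots> = m / 2" unfolding s_def using nvw by (simp add: field_simps)
  finally have sm: "s * norm v + s * norm w < m" using m by simp
  have f: "Ck_on (Suc (Suc 0)) f (ball x e)" using Ck_on_subset[OF assms(1) e(2)] .
  obtain z1 where z1: "norm (z1 - x) \<le> s * norm v + s * norm w"
    "f (x + s *\<^sub>R v + s *\<^sub>R w) - f (x + s *\<^sub>R v) - f (x + s *\<^sub>R w) + f x = s\<^sup>2 * P z1"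
    using second_difference_mean_value[OF f s, of v w] sm m unfolding P_def by auto
  obtain z2 where z2: "norm (z2 - x) \<le> s * norm w + s * norm v"
    "f (x + s *\<^sub>R w + s *\<^sub>R v) - f (x + s *\<^sub>R w) - f (x + s *\<^sub>R v) + f x = s\<^sup>2 * R z2"
    using second_difference_mean_value[OF f s, of w v] sm m unfolding R_def by auto
  have "s\<^sup>2 * P z1 = s\<^sup>2 * R z2" using z1(2) z2(2) by (simp add: algebra_simps)
  then have "P z1 = R z2" using s by simp
  moreover have "dist (P z1) (P x) < \<delta>" using d1(2)[of z1] z1(1) sm m by (simp add: dist_norm)
  moreover have "dist (R z2) (R x) < \<delta>" using d2(2)[of z2] z2(1) sm m by (simp add: dist_norm)
  ultimately show False by (simp add: \<delta>_def dist_real_def split: abs_split) argo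
qed

lemma second_derivative_symmetric:
  fixes f :: "'a::euclidean_space \<Rightarrow> 'b::euclidean_space"
  assumes f: "smooth_on S f" and S: "open S" "x \<in> S"
  shows "frechet_derivative (\<lambda>y. frechet_derivative f (at y) v) (at x) w =
    frechet_derivative (\<lambda>y. frechet_derivative f (at y) w) (at x) v"
proof (rule euclidean_eqI)
  fix b :: 'b assume "b \<in> Basis"
  define h where "h = (\<lambda>y. f y \<bullet> b)"
  have comp: "frechet_derivative (\<lambda>y. g y \<bullet> b) (at y) = (\<lambda>v. frechet_derivative g (at y) v \<bullet> b)"
    if "smooth_on S g" "y \<in> S" for g :: "'a \<Rightarrow> 'b" and y
    using frechet_derivative_at[OF bounded_linear.has_derivative[OF bounded_linear_inner_left smooth_on_has_derivative[OF that]]]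
    by simp
  have D: "smooth_on S (\<lambda>y. frechet_derivative f (at y) v)" for v
    using smooth_on_frechet_derivative[OF f S(1) smooth_on_const] .
  have "frechet_derivative (\<lambda>y. frechet_derivative h (at y) v) (at x) w =
      frechet_derivative (\<lambda>y. frechet_derivative f (at y) v) (at x) w \<bullet> b" for v w
  proof -
    have *: "frechet_derivative (\<lambda>y. frechet_derivative f (at y) v \<bullet> b) (at x) =
      frechet_derivative (\<lambda>y. frechet_derivative h (at y) v) (at x)"
      by (rule frechet_derivative_transform_within_open[OF _ S])
        (use comp[OF f] smooth_on_differentiable[OF smooth_on_inner[OF S(1) D smooth_on_const] S(2)]
         in \<open>auto simp: h_def\<close>)
    show ?thesis using fun_cong[OF *, of w] fun_cong[OF comp[OF D S(2), of v], of w] by metis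
  qed
  moreover have "smooth_on S h" unfolding h_def by (intro smooth_intros S f)
  then have "Ck_on (Suc (Suc 0)) h S" unfolding smooth_on_def by blast
  from second_derivative_symmetric_real[OF this S]
  have "frechet_derivative (\<lambda>y. frechet_derivative h (at y) v) (at x) w =
    frechet_derivative (\<lambda>y. frechet_derivative h (at y) w) (at x) v" .
  ultimately show "frechet_derivative (\<lambda>y. frechet_derivative f (at y) v) (at x) w \<bullet> b =
      frechet_derivative (\<lambda>y. frechet_derivative f (at y) w) (at x) v \<bullet> b" by simp
qed

subsection \<open>Lifting through an immersion\<close>

text \<open>If \<open>f\<close> has injective derivative \<open>L\<close>, a continuous \<open>\<tau>\<close> is differentiable as soon as \<open>f \<circ> \<tau>\<close> is. With a left
  inverse \<open>K\<close> of \<open>L\<close>, the increment of \<open>\<tau>\<close> is \<open>K\<close> applied to that of \<open>f \<circ> \<tau>\<close> up to a term small compared with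
  the increment of \<open>\<tau>\<close> itself. Absorbing that term shows that \<open>\<tau>\<close> is Lipschitz at \<open>y\<close>, and then it is small
  compared with \<open>z - y\<close>. This is how curves in a submanifold are lifted to its parameter domain.\<close>

lemma has_derivative_lift_immersion:
  fixes f :: "'b::euclidean_space \<Rightarrow> 'c::euclidean_space" and \<tau> :: "'a::real_normed_vector \<Rightarrow> 'b"
  assumes f: "(f has_derivative L) (at (\<tau> y))" and inj: "inj L"
    and \<tau>: "continuous (at y) \<tau>" and B: "((\<lambda>z. f (\<tau> z)) has_derivative B) (at y)"
  obtains J where "(\<tau> has_derivative J) (at y)" "\<And>v. L (J v) = B v"
proof -
  have linL: "linear L" using f by (rule has_derivative_linear)
  obtain K where K: "linear K" "K \<circ> L = id"
    using linear_injective_left_inverse[OF linL inj] by blast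
  have KL: "K (L v) = v" for v using K(2) by (metis comp_apply id_apply)
  have bK: "bounded_linear K" using K(1) by (simp add: linear_conv_bounded_linear)
  then interpret K: bounded_linear K .
  have bB: "bounded_linear B" using B by (rule has_derivative_bounded_linear)
  obtain C where C: "C > 0" "\<And>z. norm (K z) \<le> norm z * C" using K.pos_bounded by blast
  obtain C' where C': "C' > 0" "\<And>z. norm (B z) \<le> norm z * C'" using bounded_linear.pos_bounded[OF bB] by blast
  have f': "\<exists>d>0. \<forall>z. norm (z - \<tau> y) < d \<longrightarrow> norm (f z - f (\<tau> y) - L (z - \<tau> y)) \<le> e * norm (z - \<tau> y)"
    if "e > 0" for e using f that unfolding has_derivative_at_alt by blast
  have B': "\<exists>d>0. \<forall>z. norm (z - y) < d \<longrightarrow> norm (f (\<tau> z) - f (\<tau> y) - B (z - y)) \<le> e * norm (z - y)"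
    if "e > 0" for e using B that unfolding has_derivative_at_alt by blast
  have c': "\<exists>d>0. \<forall>z. norm (z - y) < d \<longrightarrow> norm (\<tau> z - \<tau> y) < e" if "e > 0" for e
    using \<tau> that unfolding continuous_at_eps_delta dist_norm by blast
  have main: "\<exists>d>0. \<forall>z. norm (z - y) < d \<longrightarrow> norm (\<tau> z - \<tau> y - K (B (z - y))) \<le> C * e * norm (\<tau> z - \<tau> y) + C * e * norm (z - y)"
    if e: "e > 0" for e
  proof -
    obtain d1 where d1: "d1 > 0" "\<And>z. norm (z - \<tau> y) < d1 \<Longrightarrow> norm (f z - f (\<tau> y) - L (z - \<tau> y)) \<le> e * norm (z - \<tau> y)"
      using f'[OF e] by blast
    obtain d2 where d2: "d2 > 0" "\<And>z. norm (z - y) < d2 \<Longrightarrow> norm (\<tau> z - \<tau> y) < d1" using c'[OF d1(1)] by blast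
    obtain d3 where d3: "d3 > 0" "\<And>z. norm (z - y) < d3 \<Longrightarrow> norm (f (\<tau> z) - f (\<tau> y) - B (z - y)) \<le> e * norm (z - y)"
      using B'[OF e] by blast
    have "norm (\<tau> z - \<tau> y - K (B (z - y))) \<le> C * e * norm (\<tau> z - \<tau> y) + C * e * norm (z - y)"
      if z: "norm (z - y) < min d2 d3" for z
    proof -
      let ?r1 = "f (\<tau> z) - f (\<tau> y) - L (\<tau> z - \<tau> y)" and ?r2 = "f (\<tau> z) - f (\<tau> y) - B (z - y)"
      have "\<tau> z - \<tau> y - K (B (z - y)) = K ?r2 - K ?r1" by (simp add: K.diff KL)
      also have "norm \<dots> \<le> norm (K ?r2) + norm (K ?r1)" by (rule norm_triangle_ineq4)
      also have "\<dots> \<le> C * norm ?r2 + C * norm ?r1" using C(2)[of ?r1] C(2)[of ?r2] by (simp add: mult.commute)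
      also have "\<dots> \<le> C * (e * norm (z - y)) + C * (e * norm (\<tau> z - \<tau> y))"
        using C(1) z d1(2)[OF d2(2)] d3(2) by (intro add_mono mult_left_mono) auto
      finally show ?thesis by simp
    qed
    then show ?thesis using d2(1) d3(1) by (intro exI[of _ "min d2 d3"]) auto
  qed
  \<comment> \<open>with \<open>C e = 1/2\<close> half of the increment of \<open>\<tau>\<close> can be absorbed on the left\<close>
  have "C * (1 / (2 * C)) = 1 / 2" using C by simp
  then obtain d0 where d0: "d0 > 0" "\<And>z. norm (z - y) < d0 \<Longrightarrow>
      norm (\<tau> z - \<tau> y - K (B (z - y))) \<le> 1/2 * norm (\<tau> z - \<tau> y) + 1/2 * norm (z - y)"
    using main[of "1 / (2 * C)"] C by auto
  define N where "N = 2 * C * C' + 1"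
  have N: "N > 0" using C C' by (simp add: N_def add_pos_pos)
  have lip: "norm (\<tau> z - \<tau> y) \<le> N * norm (z - y)" if z: "norm (z - y) < d0" for z
  proof -
    have "norm (\<tau> z - \<tau> y) \<le> norm (\<tau> z - \<tau> y - K (B (z - y))) + norm (K (B (z - y)))"
      using norm_triangle_ineq[of "\<tau> z - \<tau> y - K (B (z - y))" "K (B (z - y))"] by simp
    moreover have "norm (K (B (z - y))) \<le> norm (z - y) * C' * C"
      using order_trans[OF C(2)[of "B (z - y)"] mult_right_mono[OF C'(2)[of "z - y"], of C]] C(1) by simp
    ultimately show ?thesis using d0(2)[OF z] by (simp add: N_def algebra_simps)
  qed
  have "(\<tau> has_derivative (\<lambda>v. K (B v))) (at y)"
    unfolding has_derivative_at_alt
  proof (intro conjI allI impI)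
    show "bounded_linear (\<lambda>v. K (B v))" by (rule bounded_linear_compose[OF bK bB])
    fix e :: real assume e: "e > 0"
    define e' where "e' = e / (C * (N + 1))"
    have e': "e' > 0" using e C N by (simp add: e'_def)
    obtain d where d: "d > 0" "\<And>z. norm (z - y) < d \<Longrightarrow>
        norm (\<tau> z - \<tau> y - K (B (z - y))) \<le> C * e' * norm (\<tau> z - \<tau> y) + C * e' * norm (z - y)"
      using main[OF e'] by blast
    have "norm (\<tau> z - \<tau> y - K (B (z - y))) \<le> e * norm (z - y)" if z: "norm (z - y) < min d d0" for z
    proof -
      have "norm (\<tau> z - \<tau> y - K (B (z - y))) \<le> C * e' * (N * norm (z - y)) + C * e' * norm (z - y)"
        using add_right_mono[OF mult_left_mono[OF lip[of z], of "C * e'"], of "C * e' * norm (z - y)"]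
          order_trans[OF d(2)[of z]] C(1) e' z by (metis less_eq_real_def min_less_iff_conj mult_pos_pos)
      also have "\<dots> = C * e' * (N + 1) * norm (z - y)" by (simp add: algebra_simps)
      also have "C * e' * (N + 1) = e" using C N by (simp add: e'_def)
      finally show ?thesis .
    qed
    then show "\<exists>d>0. \<forall>z. norm (z - y) < d \<longrightarrow> norm (\<tau> z - \<tau> y - K (B (z - y))) \<le> e * norm (z - y)"
      using d(1) d0(1) by (intro exI[of _ "min d d0"]) auto
  qed
  moreover from has_derivative_compose[OF this f]
  have "((\<lambda>z. f (\<tau> z)) has_derivative (\<lambda>v. L (K (B v)))) (at y)" .
  then have "L (K (B v)) = B v" for v using has_derivative_unique[OF B] by metis
  ultimately show thesis by (rule that)
qed


subsection \<open>Differentiating a derivative along a map\<close>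

text \<open>The product rule for applying the derivative of \<open>f\<close> at a moving point to a moving vector. Components of
  a vector field along a map change between charts in exactly this way.\<close>

lemma has_derivative_frechet_apply:
  fixes f :: "'b::euclidean_space \<Rightarrow> 'c::euclidean_space" and h w :: "'a::real_normed_vector \<Rightarrow> 'b"
  assumes f: "smooth_on S f" and S: "open S" "h x \<in> S"
    and h: "(h has_derivative h') (at x)" and w: "(w has_derivative w') (at x)"
  shows "((\<lambda>y. frechet_derivative f (at (h y)) (w y)) has_derivative
    (\<lambda>a. frechet_derivative f (at (h x)) (w' a) +
         frechet_derivative (\<lambda>z. frechet_derivative f (at z) (w x)) (at (h x)) (h' a))) (at x)"
proof -
  have D: "smooth_on S (\<lambda>z. frechet_derivative f (at z) v)" for v
    by (rule smooth_on_frechet_derivative[OF f S(1) smooth_on_const])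
  have lin: "frechet_derivative f (at z) v = (\<Sum>b\<in>Basis. (v \<bullet> b) *\<^sub>R frechet_derivative f (at z) b)" if "z \<in> S" for z v
    by (rule frechet_basis_sum[OF smooth_on_differentiable[OF f that]])
  have c: "((\<lambda>y. frechet_derivative f (at (h y)) b) has_derivative
     (\<lambda>a. frechet_derivative (\<lambda>z. frechet_derivative f (at z) b) (at (h x)) (h' a))) (at x)" for b
    by (rule has_derivative_compose[OF h smooth_on_has_derivative[OF D S(2)]])
  have d: "((\<lambda>y. \<Sum>b\<in>Basis. (w y \<bullet> b) *\<^sub>R frechet_derivative f (at (h y)) b) has_derivative
     (\<lambda>a. \<Sum>b\<in>Basis. (w x \<bullet> b) *\<^sub>R frechet_derivative (\<lambda>z. frechet_derivative f (at z) b) (at (h x)) (h' a)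
        + (w' a \<bullet> b) *\<^sub>R frechet_derivative f (at (h x)) b)) (at x)"
    by (intro has_derivative_sum has_derivative_scaleR c has_derivative_inner_left w)
  have "frechet_derivative (\<lambda>z. frechet_derivative f (at z) (w x)) (at (h x)) v
      = (\<Sum>b\<in>Basis. (w x \<bullet> b) *\<^sub>R frechet_derivative (\<lambda>z. frechet_derivative f (at z) b) (at (h x)) v)" for v
  proof -
    have "((\<lambda>z. \<Sum>b\<in>Basis. (w x \<bullet> b) *\<^sub>R frechet_derivative f (at z) b) has_derivative
       (\<lambda>v. \<Sum>b\<in>Basis. (w x \<bullet> b) *\<^sub>R frechet_derivative (\<lambda>z. frechet_derivative f (at z) b) (at (h x)) v)) (at (h x))"
      by (intro has_derivative_sum has_derivative_scaleR_right smooth_on_has_derivative[OF D S(2)])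
    then have "((\<lambda>z. frechet_derivative f (at z) (w x)) has_derivative
       (\<lambda>v. \<Sum>b\<in>Basis. (w x \<bullet> b) *\<^sub>R frechet_derivative (\<lambda>z. frechet_derivative f (at z) b) (at (h x)) v)) (at (h x))"
      by (rule has_derivative_transform_within_open[OF _ S]) (simp add: lin[symmetric])
    from fun_cong[OF frechet_derivative_at[OF this]] show ?thesis by simp
  qed
  then have e: "(\<lambda>a. \<Sum>b\<in>Basis. (w x \<bullet> b) *\<^sub>R frechet_derivative (\<lambda>z. frechet_derivative f (at z) b) (at (h x)) (h' a)
        + (w' a \<bullet> b) *\<^sub>R frechet_derivative f (at (h x)) b) =
    (\<lambda>a. frechet_derivative f (at (h x)) (w' a) +
         frechet_derivative (\<lambda>z. frechet_derivative f (at z) (w x)) (at (h x)) (h' a))"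
    by (simp add: sum.distrib lin[OF S(2), symmetric] add.commute)
  have ev: "\<forall>\<^sub>F y in at x. h y \<in> S"
    using has_derivative_continuous[OF h] S topological_tendstoD[of h "h x" "at x" S]
    by (simp add: continuous_at)
  show ?thesis
    by (rule has_derivative_transform_eventually[OF d[unfolded e]])
      (use ev in \<open>auto elim!: eventually_mono simp: lin[symmetric] S(2)\<close>)
qed

section \<open>Charts, tangent vectors and curves\<close>

lemma tangent_vectorD:
  "tangent_vector A p v \<Longrightarrow> c \<in> A \<Longrightarrow> d \<in> A \<Longrightarrow> p \<in> fst c \<Longrightarrow> p \<in> fst d \<Longrightarrow> v d = trans_deriv c d p (v c)"
  unfolding tangent_vector_def by blast

lemma tangent_vectorI:
  "(\<And>c d. c \<in> A \<Longrightarrow> d \<in> A \<Longrightarrow> p \<in> fst c \<Longrightarrow> p \<in> fst d \<Longrightarrow> v d = trans_deriv c d p (v c)) \<Longrightarrow> tangent_vector A p v"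
  unfolding tangent_vector_def by blast

context
  fixes A :: "('n::topological_space) atlas"
  assumes A: "smooth_atlas A"
begin

lemma chart_exists: "\<exists>c\<in>A. p \<in> fst c"
  using A by (auto simp: smooth_atlas_def)

lemma chart_at_mem: "chart_at A p \<in> A" "p \<in> fst (chart_at A p)"
proof -
  have "chart_at A p \<in> A \<and> p \<in> fst (chart_at A p)"
    unfolding chart_at_def using someI_ex[of "\<lambda>c. c \<in> A \<and> p \<in> fst c"] chart_exists[of p] by blast
  then show "chart_at A p \<in> A" "p \<in> fst (chart_at A p)" by auto
qed

lemma chart_domain_open: "c \<in> A \<Longrightarrow> open (fst c)"
  using A by (auto simp: smooth_atlas_def)

lemma chart_homeomorphism: "c \<in> A \<Longrightarrow> homeomorphism (fst c) (snd c ` fst c) (snd c) (cinv c)"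
  using A by (auto simp: smooth_atlas_def)

lemma chart_inj: "c \<in> A \<Longrightarrow> inj_on (snd c) (fst c)"
  using chart_homeomorphism[of c] by (auto simp: homeomorphism_def intro: inj_on_inverseI[of _ "cinv c"])

lemma cinv_chart [simp]: "c \<in> A \<Longrightarrow> p \<in> fst c \<Longrightarrow> cinv c (snd c p) = p"
  using chart_inj by (rule inv_into_f_f)

lemma chart_image_open:
  assumes "c \<in> A" "open W"
  shows "open (snd c ` (W \<inter> fst c))"
proof -
  have "openin (top_of_set (snd c ` fst c)) (snd c ` (W \<inter> fst c))"
    by (rule homeomorphism_imp_open_map[OF chart_homeomorphism[OF assms(1)]])
      (use assms(2) in \<open>auto simp: openin_open\<close>)
  moreover have "open (snd c ` fst c)" using A assms(1) by (auto simp: smooth_atlas_def)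
  ultimately show ?thesis by (metis openin_open_trans)
qed

lemma cinv_mem: "c \<in> A \<Longrightarrow> y \<in> snd c ` (W \<inter> fst c) \<Longrightarrow> cinv c y \<in> W \<inter> fst c \<and> snd c (cinv c y) = y"
  by auto

lemma transition_smooth: "c \<in> A \<Longrightarrow> d \<in> A \<Longrightarrow> smooth_on (snd c ` (fst c \<inter> fst d)) (snd d \<circ> cinv c)"
  using A unfolding smooth_atlas_def by blast

lemma overlap_open: "c \<in> A \<Longrightarrow> d \<in> A \<Longrightarrow> open (snd c ` (fst c \<inter> fst d))"
  using chart_image_open[OF _ chart_domain_open, of c d] by (simp add: Int_commute)

lemma trans_deriv_has_derivative:
  assumes "c \<in> A" "d \<in> A" "p \<in> fst c" "p \<in> fst d"
  shows "((snd d \<circ> cinv c) has_derivative trans_deriv c d p) (at (snd c p))"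
  unfolding trans_deriv_def
  by (rule smooth_on_has_derivative[OF transition_smooth]) (use assms in auto)

lemma trans_deriv_linear:
  assumes "c \<in> A" "d \<in> A" "p \<in> fst c" "p \<in> fst d"
  shows "linear (trans_deriv c d p)"
  using trans_deriv_has_derivative[OF assms] by (rule has_derivative_linear)

lemma tangent_vector_scaleR:
  assumes "tangent_vector A p v"
  shows "tangent_vector A p (\<lambda>c. k *\<^sub>R v c)"
proof (rule tangent_vectorI)
  fix c d assume cd: "c \<in> A" "d \<in> A" "p \<in> fst c" "p \<in> fst d"
  show "k *\<^sub>R v d = trans_deriv c d p (k *\<^sub>R v c)"
    unfolding tangent_vectorD[OF assms cd] linear_scale[OF trans_deriv_linear[OF cd]] ..
qed

lemma tangent_vector_add:
  assumes "tangent_vector A p v" "tangent_vector A p w"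
  shows "tangent_vector A p (\<lambda>c. v c + w c)"
proof (rule tangent_vectorI)
  fix c d assume cd: "c \<in> A" "d \<in> A" "p \<in> fst c" "p \<in> fst d"
  show "v d + w d = trans_deriv c d p (v c + w c)"
    unfolding tangent_vectorD[OF assms(1) cd] tangent_vectorD[OF assms(2) cd]
      linear_add[OF trans_deriv_linear[OF cd]] ..
qed

lemma tangent_vector_zero: "tangent_vector A p (\<lambda>c. 0)"
  by (rule tangent_vectorI) (simp add: linear_0[OF trans_deriv_linear])

lemma tangent_vector_sum:
  assumes "\<And>i. i \<in> X \<Longrightarrow> tangent_vector A p (v i)"
  shows "tangent_vector A p (\<lambda>c. \<Sum>i\<in>X. v i c)"
  using assms
  by (induction X rule: infinite_finite_induct) (simp_all add: tangent_vector_add tangent_vector_zero)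

lemma tangent_vector_eqI:
  assumes "tangent_vector A p v" "tangent_vector A p w" "c \<in> A" "p \<in> fst c" "v c = w c"
  shows "tv_eq A p v w"
  unfolding tv_eq_def
proof (intro ballI impI)
  fix d assume d: "d \<in> A" "p \<in> fst d"
  show "v d = w d"
    unfolding tangent_vectorD[OF assms(1,3) d(1) assms(4) d(2)] tangent_vectorD[OF assms(2,3) d(1) assms(4) d(2)] assms(5) ..
qed

lemma tangent_vector_tv_eq:
  assumes "tv_eq A p v w" "tangent_vector A p w"
  shows "tangent_vector A p v"
proof (rule tangent_vectorI)
  fix c d assume cd: "c \<in> A" "d \<in> A" "p \<in> fst c" "p \<in> fst d"
  then have "v c = w c" "v d = w d" using assms(1) by (auto simp: tv_eq_def)
  then show "v d = trans_deriv c d p (v c)" using tangent_vectorD[OF assms(2) cd] by simp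
qed

lemma smooth_into_chart:
  assumes "smooth_into A D u" "open D" "c \<in> A"
  shows "open (D \<inter> u -` fst c)" "smooth_on (D \<inter> u -` fst c) (snd c \<circ> u)"
  using assms chart_domain_open by (auto simp: smooth_into_def continuous_on_open_vimage Int_commute)

lemma push_has_derivative:
  assumes "smooth_into A D u" "open D" "x \<in> D" "c \<in> A" "u x \<in> fst c"
  shows "((snd c \<circ> u) has_derivative (\<lambda>a. push u x a c)) (at x)"
  unfolding push_def by (rule smooth_on_has_derivative[OF smooth_into_chart(2)[OF assms(1,2,4)]]) (use assms in auto)

lemma push_linear:
  assumes "smooth_into A D u" "open D" "x \<in> D" "c \<in> A" "u x \<in> fst c"
  shows "linear (\<lambda>a. push u x a c)"
  using push_has_derivative[OF assms] by (rule has_derivative_linear)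

lemma push_smooth:
  assumes "smooth_into A D u" "open D" "c \<in> A"
  shows "smooth_on (D \<inter> u -` fst c) (\<lambda>y. push u y a c)"
  unfolding push_def
  by (rule smooth_on_frechet_derivative[OF smooth_into_chart(2)[OF assms] smooth_into_chart(1)[OF assms] smooth_on_const])

lemma push_tangent_vector:
  assumes u: "smooth_into A D u" "open D" "x \<in> D"
  shows "tangent_vector A (u x) (push u x a)"
  unfolding tangent_vector_def
proof (intro ballI impI)
  fix c d assume c: "c \<in> A" and d: "d \<in> A" and p: "u x \<in> fst c \<inter> fst d"
  have o: "open (D \<inter> u -` fst c)" using smooth_into_chart[OF u(1,2) c] by auto
  have "((\<lambda>y. (snd d \<circ> cinv c) ((snd c \<circ> u) y)) has_derivative (\<lambda>a. trans_deriv c d (u x) (push u x a c))) (at x)"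
    by (rule has_derivative_compose[OF push_has_derivative[OF u c]])
      (use trans_deriv_has_derivative[OF c d, of "u x"] p in \<open>simp_all only: comp_apply[of "snd c" u x] Int_iff\<close>)
  then have "((snd d \<circ> u) has_derivative (\<lambda>a. trans_deriv c d (u x) (push u x a c))) (at x)"
    by (rule has_derivative_transform_within_open[OF _ o]) (use u p c in auto)
  from has_derivative_unique[OF push_has_derivative[OF u d] this] p
  show "push u x a d = trans_deriv c d (u x) (push u x a c)" by (auto simp: fun_eq_iff)
qed

lemma push_cong:
  assumes "smooth_into A D u" "open D" "x \<in> D" "open D'" "x \<in> D'" "\<And>y. y \<in> D' \<Longrightarrow> u y = w y"
  shows "tv_eq A (u x) (push u x a) (push w x a)"
  unfolding tv_eq_def
proof (intro ballI impI)
  fix c assume c: "c \<in> A" "u x \<in> fst c"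
  have "frechet_derivative (snd c \<circ> u) (at x) = frechet_derivative (snd c \<circ> w) (at x)"
    by (rule frechet_derivative_transform_within_open[OF differentiableI[OF push_has_derivative[OF assms(1-3) c]] assms(4,5)])
      (use assms in auto)
  then show "push u x a c = push w x a c" by (simp add: push_def)
qed

lemma smooth_into_compose:
  assumes u: "smooth_into A D u" and h: "smooth_on E h" "open E" "h ` E \<subseteq> D" and D: "open D"
  shows "smooth_into A E (\<lambda>y. u (h y))"
  unfolding smooth_into_def
proof (intro conjI ballI)
  show cont: "continuous_on E (\<lambda>y. u (h y))"
    using u h smooth_on_imp_continuous_on[OF h(1)] unfolding smooth_into_def
    by (auto intro: continuous_on_compose2)
  fix c assume c: "c \<in> A"
  let ?E = "E \<inter> (\<lambda>y. u (h y)) -` fst c"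
  have o: "open ?E"
    using cont h(2) chart_domain_open[OF c] by (auto simp: continuous_on_open_vimage Int_commute)
  have "smooth_on ?E (\<lambda>y. (snd c \<circ> u) (h y))"
    by (rule smooth_on_compose[OF smooth_into_chart(2)[OF u D c] o smooth_on_subset[OF h(1)]]) (use h in auto)
  then show "smooth_on ?E (snd c \<circ> (\<lambda>y. u (h y)))" by (simp add: o_def)
qed

lemma push_compose:
  assumes u: "smooth_into A D u" "open D" "h x \<in> D" and h: "(h has_derivative h') (at x)"
    and c: "c \<in> A" "u (h x) \<in> fst c"
  shows "push (\<lambda>y. u (h y)) x a c = push u (h x) (h' a) c"
proof -
  have "((\<lambda>y. (snd c \<circ> u) (h y)) has_derivative (\<lambda>a. push u (h x) (h' a) c)) (at x)"
    by (rule has_derivative_compose[OF h push_has_derivative[OF u c]])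
  from frechet_derivative_at[OF this] show ?thesis by (simp add: push_def o_def fun_eq_iff)
qed

lemma push_tangent_to:
  assumes u: "smooth_into A D u" "open D" "x \<in> D" and S: "u ` D \<subseteq> S"
  shows "tangent_to A S (u x) (push u x a)"
proof -
  obtain e where e: "e > 0" "ball x e \<subseteq> D" using u(2,3) openE by blast
  define h where "h = (\<lambda>t. x + t *\<^sub>R a)"
  define \<epsilon> where "\<epsilon> = e / (norm a + 1)"
  have \<epsilon>: "\<epsilon> > 0" using e by (simp add: \<epsilon>_def add_nonneg_pos)
  have nz: "norm a + 1 \<noteq> 0" using norm_ge_zero[of a] by linarith
  have h: "h t \<in> D" if "t \<in> {-\<epsilon><..<\<epsilon>}" for t
  proof -
    have "\<bar>t\<bar> * norm a \<le> \<bar>t\<bar> * (norm a + 1)" by (simp add: mult_left_mono)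
    also have "\<dots> < \<epsilon> * (norm a + 1)" using that by (intro mult_strict_right_mono) (auto simp: add_nonneg_pos)
    also have "\<dots> = e" using nz unfolding \<epsilon>_def by simp
    finally show ?thesis using e by (auto simp: h_def dist_norm)
  qed
  have sm: "smooth_on {-\<epsilon><..<\<epsilon>} h" unfolding h_def by (intro smooth_intros) auto
  have d: "(h has_derivative (\<lambda>t. t *\<^sub>R a)) (at 0)"
    unfolding h_def by (auto intro!: derivative_eq_intros)
  have h0: "h 0 = x" by (simp add: h_def)
  have "smooth_into A {-\<epsilon><..<\<epsilon>} (\<lambda>t. u (h t))"
    by (rule smooth_into_compose[OF u(1) sm]) (use h u in auto)
  moreover have "tv_eq A (u x) (push u x a) (push (\<lambda>t. u (h t)) 0 1)"
    unfolding tv_eq_def using push_compose[OF u(1,2) _ d] h0 u(3) by auto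
  ultimately show ?thesis
    unfolding tangent_to_def using \<epsilon> h S h0 by (intro exI[of _ "\<lambda>t. u (h t)"] exI[of _ \<epsilon>]) auto
qed

lemma tangent_to_tangent_vector:
  assumes "tangent_to A S p v"
  shows "tangent_vector A p v"
proof -
  obtain \<gamma> :: "real \<Rightarrow> 'n" and \<epsilon> where "0 < \<epsilon>" "smooth_into A {-\<epsilon><..<\<epsilon>} \<gamma>" "\<gamma> 0 = p" "tv_eq A p v (push \<gamma> 0 1)"
    using assms by (auto simp: tangent_to_def)
  with push_tangent_vector[of "{-\<epsilon><..<\<epsilon>}" \<gamma> 0 1] show ?thesis
    by (auto intro: tangent_vector_tv_eq)
qed

lemma tangent_to_scaleR:
  assumes "tangent_to A S p v" "tv_eq A p w (\<lambda>c. k *\<^sub>R v c)"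
  shows "tangent_to A S p w"
proof -
  obtain \<gamma> :: "real \<Rightarrow> 'n" and \<epsilon> where \<gamma>: "0 < \<epsilon>" "smooth_into A {-\<epsilon><..<\<epsilon>} \<gamma>" "\<gamma> ` {-\<epsilon><..<\<epsilon>} \<subseteq> S"
      "\<gamma> 0 = p" "tv_eq A p v (push \<gamma> 0 1)"
    using assms by (auto simp: tangent_to_def)
  have 0: "0 \<in> {-\<epsilon><..<\<epsilon>}" using \<gamma> by auto
  have "tangent_to A S (\<gamma> 0) (push \<gamma> 0 k)"
    using push_tangent_to[OF \<gamma>(2) _ 0 \<gamma>(3)] by auto
  moreover have "tv_eq A p w (push \<gamma> 0 k)"
    unfolding tv_eq_def
  proof (intro ballI impI)
    fix c assume c: "c \<in> A" "p \<in> fst c"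
    have "push \<gamma> 0 (k *\<^sub>R 1) c = k *\<^sub>R push \<gamma> 0 1 c"
      using linear_scale[OF push_linear[OF \<gamma>(2) _ 0 c(1)], of k 1] c(2) \<gamma>(4) by simp
    then show "w c = push \<gamma> 0 k c" using assms(2) \<gamma>(5) c by (simp add: tv_eq_def)
  qed
  ultimately show ?thesis using \<gamma>(4) unfolding tangent_to_def tv_eq_def by metis
qed

text \<open>A curve in \<open>S\<close> starting at \<open>u x\<close> is \<open>u \<circ> \<tau>\<close> for small times, with \<open>\<tau>\<close> continuous because \<open>u\<close> is a
  homeomorphism onto an open part of \<open>S\<close>; lifting through the immersion makes \<open>\<tau>\<close> differentiable, and
  its velocity is the required parameter vector.\<close>

lemma tangent_to_param_range:
  assumes u: "local_param A S D u" "x \<in> D" and v: "tangent_to A S (u x) v" and c: "c \<in> A" "u x \<in> fst c"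
  obtains a where "v c = push u x a c"
proof -
  obtain \<gamma> :: "real \<Rightarrow> 'n" and \<epsilon> where \<gamma>: "0 < \<epsilon>" "smooth_into A {-\<epsilon><..<\<epsilon>} \<gamma>" "\<gamma> ` {-\<epsilon><..<\<epsilon>} \<subseteq> S"
      "\<gamma> 0 = u x" "tv_eq A (u x) v (push \<gamma> 0 1)"
    using v by (auto simp: tangent_to_def)
  obtain W where W: "open W" "u ` D = S \<inter> W" using u by (auto simp: local_param_def)
  have D: "open D" "smooth_into A D u" and hom: "homeomorphism D (u ` D) u (inv_into D u)"
    and inj: "inj (\<lambda>a. push u x a c)"
    using u c by (auto simp: local_param_def)
  let ?E = "{-\<epsilon><..<\<epsilon>} \<inter> \<gamma> -` W"
  have o: "open ?E" using \<gamma>(2) W(1) by (auto simp: smooth_into_def continuous_on_open_vimage Int_commute)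
  have x: "u x \<in> W" using W u(2) by blast
  have 0: "0 \<in> ?E" using \<gamma> x by auto
  define \<tau> where "\<tau> = (\<lambda>t. inv_into D u (\<gamma> t))"
  have im: "\<gamma> t \<in> u ` D" if "t \<in> ?E" for t using that \<gamma>(3) W(2) by auto
  have \<tau>0: "\<tau> 0 = x" unfolding \<tau>_def \<gamma>(4) using hom u(2) by (auto simp: homeomorphism_def)
  have u\<tau>: "u (\<tau> t) = \<gamma> t" if "t \<in> ?E" for t
    using im[OF that] unfolding \<tau>_def by (rule f_inv_into_f)
  have "continuous_on ?E \<tau>"
    unfolding \<tau>_def
    by (rule continuous_on_compose2[of "u ` D"])
      (use hom \<gamma>(2) im in \<open>auto simp: homeomorphism_def smooth_into_def intro: continuous_on_subset\<close>)
  then have cont: "continuous (at 0) \<tau>" using o 0 by (simp add: continuous_on_eq_continuous_at)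
  have "((snd c \<circ> \<gamma>) has_derivative (\<lambda>a. push \<gamma> 0 a c)) (at 0)"
    by (rule push_has_derivative[OF \<gamma>(2)]) (use \<gamma> c in auto)
  then have B: "((\<lambda>t. (snd c \<circ> u) (\<tau> t)) has_derivative (\<lambda>a. push \<gamma> 0 a c)) (at 0)"
    by (rule has_derivative_transform_within_open[OF _ o 0]) (use u\<tau> in auto)
  have L: "((snd c \<circ> u) has_derivative (\<lambda>a. push u x a c)) (at (\<tau> 0))"
    unfolding \<tau>0 by (rule push_has_derivative[OF D(2,1) u(2) c])
  obtain J where "\<And>t. push u x (J t) c = push \<gamma> 0 t c"
    by (rule has_derivative_lift_immersion[OF L inj cont B]) blast
  then have "push u x (J 1) c = v c" using \<gamma>(5) c by (simp add: tv_eq_def)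
  then show thesis using that by metis
qed

end

section \<open>Inner products\<close>

lemma ip_chart:
  assumes A: "smooth_atlas A" and g: "lorentz_metric A g"
    and v: "tangent_vector A p v" and w: "tangent_vector A p w" and c: "c \<in> A" "p \<in> fst c"
  shows "ip A g p v w = v c \<bullet> (g p c *v w c)"
proof -
  let ?d = "chart_at A p"
  have d: "?d \<in> A" "p \<in> fst ?d" using chart_at_mem[OF A] by auto
  have t: "v ?d = trans_deriv c ?d p (v c)" "w ?d = trans_deriv c ?d p (w c)"
    using v w c d unfolding tangent_vector_def by blast+
  have "trans_deriv c ?d p (v c) \<bullet> (g p ?d *v trans_deriv c ?d p (w c)) = v c \<bullet> (g p c *v w c)"
    using g c d unfolding lorentz_metric_def by blast
  then show ?thesis by (simp only: ip_def Let_def t)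
qed

lemma lorentz_symmetric:
  assumes "lorentz_metric A g" "c \<in> A" "p \<in> fst c"
  shows "v \<bullet> (g p c *v w) = w \<bullet> (g p c *v v)"
proof -
  have t: "transpose (g p c) = g p c" using assms unfolding lorentz_metric_def by blast
  have "v \<bullet> (g p c *v w) = (v v* g p c) \<bullet> w" by (rule dot_lmul_matrix[symmetric])
  also have "v v* g p c = g p c *v v" using transpose_matrix_vector[of "g p c" v] t by simp
  finally show ?thesis by (simp add: inner_commute)
qed

lemma lorentz_invertible:
  assumes "lorentz_metric A g" "c \<in> A" "p \<in> fst c"
  shows "invertible (g p c)"
proof -
  obtain P where P: "transpose P ** g p c ** P = minkowski"
    using assms unfolding lorentz_metric_def by blast
  have "det minkowski = (\<Prod>i\<in>UNIV. minkowski $ i $ i)"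
    by (rule det_diagonal) (simp add: minkowski_def)
  then have "det minkowski \<noteq> 0" by (simp add: minkowski_def)
  then have "det (g p c) \<noteq> 0" unfolding P[symmetric] det_mul by auto
  then show ?thesis by (simp add: invertible_det_nz)
qed

lemma matrix_inv_right: "invertible M \<Longrightarrow> M ** matrix_inv M = mat 1"
  unfolding matrix_inv_def invertible_def by (rule someI2_ex) simp_all

lemma matrix_inv_unique:
  assumes "M ** B = mat 1" "B ** M = mat 1"
  shows "matrix_inv M = B"
proof -
  have "M ** matrix_inv M = mat 1"
    using assms by (intro matrix_inv_right) (auto simp: invertible_def)
  then have "B ** (M ** matrix_inv M) = B" by simp
  then show ?thesis by (simp add: matrix_mul_assoc assms)
qed

lemma invertible_mult_vec_cancel:
  assumes "invertible M" "M *v v = M *v w"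
  shows "v = w"
proof -
  obtain B where "B ** M = mat 1" using assms(1) by (auto simp: invertible_def)
  then show ?thesis using arg_cong[OF assms(2), of "(*v) B"] by (simp add: matrix_vector_mul_assoc)
qed

lemma lorentz_nondegenerate:
  assumes "lorentz_metric A g" "c \<in> A" "p \<in> fst c" "\<And>w. w \<bullet> (g p c *v v) = w \<bullet> (g p c *v v')"
  shows "v = v'"
proof (rule invertible_mult_vec_cancel[OF lorentz_invertible[OF assms(1-3)]])
  show "g p c *v v = g p c *v v'" by (rule vector_eq_ldot[THEN iffD1]) (blast intro: assms(4))
qed

lemma lorentz_smooth:
  "lorentz_metric A g \<Longrightarrow> c \<in> A \<Longrightarrow> smooth_on (snd c ` fst c) (\<lambda>y. g (cinv c y) c)"
  unfolding lorentz_metric_def by blast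


section \<open>Covariant derivatives\<close>

definition metric_D :: "'n metric \<Rightarrow> 'n chart \<Rightarrow> 'n \<Rightarrow> real^4 \<Rightarrow> real^4^4" where
  "metric_D g c p = frechet_derivative (\<lambda>y. g (cinv c y) c) (at (snd c p))"

lemma metric_has_derivative:
  assumes "lorentz_metric A g" "c \<in> A" "p \<in> fst c"
  shows "((\<lambda>y. g (cinv c y) c) has_derivative metric_D g c p) (at (snd c p))"
  unfolding metric_D_def
  by (rule smooth_on_has_derivative[OF lorentz_smooth[OF assms(1,2)]]) (use assms in auto)

lemma metric_D_component:
  assumes "lorentz_metric A g" "c \<in> A" "p \<in> fst c"
  shows "metric_D g c p z $ i $ j = (\<Sum>l\<in>UNIV. z $ l * metric_deriv g c p l i j)"
proof -
  interpret bounded_linear "metric_D g c p"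
    using metric_has_derivative[OF assms] by (rule has_derivative_bounded_linear)
  have "metric_D g c p z = metric_D g c p (\<Sum>l\<in>UNIV. z $ l *\<^sub>R axis l 1)"
    by (metis basis_expansion scalar_mult_eq_scaleR)
  also have "\<dots> = (\<Sum>l\<in>UNIV. z $ l *\<^sub>R metric_D g c p (axis l 1))"
    by (simp add: sum scaleR)
  finally show ?thesis by (simp add: metric_deriv_def metric_D_def)
qed

lemma christoffel_lower:
  assumes "lorentz_metric A g" "c \<in> A" "p \<in> fst c"
  shows "(\<Sum>k\<in>UNIV. g p c $ m $ k * christoffel g c p k i j) =
    (metric_deriv g c p i j m + metric_deriv g c p j i m - metric_deriv g c p m i j) / 2"
proof -
  let ?G = "g p c"
  let ?K = "\<lambda>l. metric_deriv g c p i j l + metric_deriv g c p j i l - metric_deriv g c p l i j"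
  have "(\<Sum>k\<in>UNIV. ?G $ m $ k * christoffel g c p k i j)
      = (1/2) * (\<Sum>k\<in>UNIV. \<Sum>n\<in>UNIV. ?G $ m $ k * matrix_inv ?G $ k $ n * ?K n)"
    unfolding christoffel_def by (simp add: sum_distrib_left ac_simps)
  also have "\<dots> = (1/2) * (\<Sum>n\<in>UNIV. (?G ** matrix_inv ?G) $ m $ n * ?K n)"
    by (subst sum.swap) (simp add: sum_distrib_right matrix_matrix_mult_def)
  also have "\<dots> = (1/2) * (\<Sum>n\<in>UNIV. if n = m then ?K n else 0)"
    unfolding matrix_inv_right[OF lorentz_invertible[OF assms]]
    by (intro arg_cong[where f="(*) (1/2)"] sum.cong) (auto simp: mat_def)
  finally show ?thesis by simp
qed

lemma sum_rotate3:
  "(\<Sum>j\<in>J. \<Sum>m\<in>M. \<Sum>i\<in>I. f i j m) = (\<Sum>m\<in>M. \<Sum>i\<in>I. \<Sum>j\<in>J. f i j m)"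
proof -
  have "(\<Sum>j\<in>J. \<Sum>m\<in>M. \<Sum>i\<in>I. f i j m) = (\<Sum>m\<in>M. \<Sum>j\<in>J. \<Sum>i\<in>I. f i j m)" by (rule sum.swap)
  also have "\<dots> = (\<Sum>m\<in>M. \<Sum>i\<in>I. \<Sum>j\<in>J. f i j m)" by (intro sum.cong refl sum.swap)
  finally show ?thesis .
qed

lemma inner_matrix_vector_sum: "v \<bullet> (M *v w) = (\<Sum>i\<in>UNIV. \<Sum>j\<in>UNIV. v $ i * M $ i $ j * w $ j)"
  for M :: "real^'n^'m"
  by (simp add: inner_vec_def matrix_vector_mult_def sum_distrib_left ac_simps)

text \<open>Lowering the index cancels the inverse metric inside the Christoffel symbols, so that only
  derivatives of the metric remain.\<close>

lemma cov_deriv_lower: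
  assumes g: "lorentz_metric A g" "c \<in> A" "u x \<in> fst c"
  shows "w \<bullet> (g (u x) c *v cov_deriv g u x a V c) =
     w \<bullet> (g (u x) c *v frechet_derivative (\<lambda>y. V y c) (at x) a) +
     (V x c \<bullet> (metric_D g c (u x) (push u x a c) *v w) + push u x a c \<bullet> (metric_D g c (u x) (V x c) *v w)
       - push u x a c \<bullet> (metric_D g c (u x) w *v V x c)) / 2"
proof -
  let ?G = "g (u x) c" and ?P = "push u x a c" and ?V = "V x c" and ?D = "metric_deriv g c (u x)"
  define \<Gamma> :: "real^4" where
    "\<Gamma> = (\<chi> k. \<Sum>i\<in>UNIV. \<Sum>j\<in>UNIV. christoffel g c (u x) k i j * ?P $ i * ?V $ j)"
  have cov: "cov_deriv g u x a V c = frechet_derivative (\<lambda>y. V y c) (at x) a + \<Gamma>"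
    by (simp add: cov_deriv_def \<Gamma>_def vec_eq_iff)
  have "(?G *v \<Gamma>) $ m = (\<Sum>i\<in>UNIV. \<Sum>j\<in>UNIV. (?D i j m + ?D j i m - ?D m i j) / 2 * ?P $ i * ?V $ j)" for m
  proof -
    have "(?G *v \<Gamma>) $ m = (\<Sum>k\<in>UNIV. \<Sum>i\<in>UNIV. \<Sum>j\<in>UNIV. ?G $ m $ k * christoffel g c (u x) k i j * ?P $ i * ?V $ j)"
      by (simp add: matrix_vector_mult_def \<Gamma>_def sum_distrib_left ac_simps)
    also have "\<dots> = (\<Sum>i\<in>UNIV. \<Sum>j\<in>UNIV. (\<Sum>k\<in>UNIV. ?G $ m $ k * christoffel g c (u x) k i j) * ?P $ i * ?V $ j)"
      unfolding sum_distrib_right by (rule sum_rotate3)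
    finally show ?thesis unfolding christoffel_lower[OF g] .
  qed
  then have "w \<bullet> (?G *v \<Gamma>) =
     (\<Sum>m\<in>UNIV. \<Sum>i\<in>UNIV. \<Sum>j\<in>UNIV. w $ m * ((?D i j m + ?D j i m - ?D m i j) / 2 * ?P $ i * ?V $ j))"
    by (simp add: inner_vec_def sum_distrib_left)
  also have "\<dots> = ((\<Sum>m\<in>UNIV. \<Sum>i\<in>UNIV. \<Sum>j\<in>UNIV. ?P $ i * ?D i j m * ?V $ j * w $ m)
      + (\<Sum>m\<in>UNIV. \<Sum>i\<in>UNIV. \<Sum>j\<in>UNIV. ?V $ j * ?D j i m * ?P $ i * w $ m)
      - (\<Sum>m\<in>UNIV. \<Sum>i\<in>UNIV. \<Sum>j\<in>UNIV. w $ m * ?D m i j * ?P $ i * ?V $ j)) / 2"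
    by (simp add: sum.distrib[symmetric] sum_subtractf[symmetric] sum_divide_distrib algebra_simps
        add_divide_distrib diff_divide_distrib)
  also have "(\<Sum>m\<in>UNIV. \<Sum>i\<in>UNIV. \<Sum>j\<in>UNIV. ?P $ i * ?D i j m * ?V $ j * w $ m) = ?V \<bullet> (metric_D g c (u x) ?P *v w)"
    unfolding inner_matrix_vector_sum metric_D_component[OF g] sum_distrib_left sum_distrib_right
    by (subst sum_rotate3[symmetric]) (simp add: ac_simps)
  also have "(\<Sum>m\<in>UNIV. \<Sum>i\<in>UNIV. \<Sum>j\<in>UNIV. ?V $ j * ?D j i m * ?P $ i * w $ m) = ?P \<bullet> (metric_D g c (u x) ?V *v w)"
    unfolding inner_matrix_vector_sum metric_D_component[OF g] sum_distrib_left sum_distrib_right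
    by (subst sum.swap) (simp add: ac_simps)
  also have "(\<Sum>m\<in>UNIV. \<Sum>i\<in>UNIV. \<Sum>j\<in>UNIV. w $ m * ?D m i j * ?P $ i * ?V $ j) = ?P \<bullet> (metric_D g c (u x) w *v ?V)"
    unfolding inner_matrix_vector_sum metric_D_component[OF g] sum_distrib_left sum_distrib_right
    by (subst sum_rotate3) (simp add: ac_simps)
  finally show ?thesis unfolding cov matrix_vector_right_distrib inner_add_right by simp
qed

lemma metric_along_has_derivative:
  assumes A: "smooth_atlas A" and g: "lorentz_metric A g" "c \<in> A" "u x \<in> fst c"
    and u: "smooth_into A D u" "open D" "x \<in> D"
    and v: "(v has_derivative v') (at x)" and w: "(w has_derivative w') (at x)"
  shows "((\<lambda>y. v y \<bullet> (g (u y) c *v w y)) has_derivative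
    (\<lambda>a. v' a \<bullet> (g (u x) c *v w x) + v x \<bullet> (metric_D g c (u x) (push u x a c) *v w x)
       + v x \<bullet> (g (u x) c *v w' a))) (at x)"
proof -
  have "((\<lambda>y. g (cinv c ((snd c \<circ> u) y)) c) has_derivative (\<lambda>a. metric_D g c (u x) (push u x a c))) (at x)"
    by (rule has_derivative_compose[OF push_has_derivative[OF A u g(2,3)]])
      (use metric_has_derivative[OF g] in simp)
  then have G: "((\<lambda>y. g (u y) c) has_derivative (\<lambda>a. metric_D g c (u x) (push u x a c))) (at x)"
    by (rule has_derivative_transform_within_open[OF _ smooth_into_chart(1)[OF A u(1,2) g(2)]])
      (use g u cinv_chart[OF A] in auto)
  show ?thesis
    by (rule has_derivative_eq_rhs[OF has_derivative_inner[OF v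
            bounded_bilinear.FDERIV[OF bounded_bilinear_matrix_vector_mult G w]]])
      (simp add: fun_eq_iff inner_add_right)
qed

lemma lorentz_tensor:
  "lorentz_metric A g \<Longrightarrow> c \<in> A \<Longrightarrow> d \<in> A \<Longrightarrow> p \<in> fst c \<Longrightarrow> p \<in> fst d \<Longrightarrow>
    trans_deriv c d p v \<bullet> (g p d *v trans_deriv c d p w) = v \<bullet> (g p c *v w)"
  unfolding lorentz_metric_def by blast

lemma trans_deriv_inverse:
  assumes A: "smooth_atlas A" and c: "c \<in> A" "p \<in> fst c" and d: "d \<in> A" "p \<in> fst d"
  shows "trans_deriv c d p (trans_deriv d c p v) = v"
proof -
  have "((\<lambda>y. (snd d \<circ> cinv c) ((snd c \<circ> cinv d) y)) has_derivative (\<lambda>v. trans_deriv c d p (trans_deriv d c p v))) (at (snd d p))"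
    by (rule has_derivative_compose[OF trans_deriv_has_derivative[OF A d(1) c(1) d(2) c(2)]])
      (use trans_deriv_has_derivative[OF A c(1) d(1) c(2) d(2)] cinv_chart[OF A d] in \<open>simp add: o_def\<close>)
  moreover have "((\<lambda>y. (snd d \<circ> cinv c) ((snd c \<circ> cinv d) y)) has_derivative (\<lambda>v. v)) (at (snd d p))"
    by (rule has_derivative_transform_within_open[OF has_derivative_ident overlap_open[OF A d(1) c(1)]])
      (use c d cinv_chart[OF A] in auto)
  ultimately show ?thesis by (metis has_derivative_unique)
qed

text \<open>The components of a covariant derivative are defined chart by chart; here they are shown to transform
  as those of a tangent vector. Let \<open>T\<close> and \<open>D2\<close> be the first and second derivative of the transition map.
  The derivative of \<open>V\<close> picks up the inhomogeneous term \<open>D2 P W\<close>, and each of the three metric derivatives in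
  the lowered formula picks up two terms with \<open>D2\<close>; since \<open>D2\<close> is symmetric, four of these six cancel and the other two
  restore \<open>D2 P W\<close>.\<close>

lemma cov_deriv_tangent_vector:
  assumes A: "smooth_atlas A" and g: "lorentz_metric A g"
    and u: "smooth_into A D u" "open D" "x \<in> D"
    and V: "\<And>y. y \<in> D \<Longrightarrow> tangent_vector A (u y) (V y)"
    and dV: "\<And>c. c \<in> A \<Longrightarrow> u x \<in> fst c \<Longrightarrow> (\<lambda>y. V y c) differentiable at x"
  shows "tangent_vector A (u x) (cov_deriv g u x a V)"
proof (rule tangent_vectorI)
  fix c d assume c: "c \<in> A" and d: "d \<in> A" and pc: "u x \<in> fst c" and pd: "u x \<in> fst d"
  define p where "p = u x"
  define \<psi> where "\<psi> = snd d \<circ> cinv c"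
  define y0 where "y0 = snd c p"
  define T where "T = trans_deriv c d p"
  define D2 where "D2 = (\<lambda>z v. frechet_derivative (\<lambda>y. frechet_derivative \<psi> (at y) v) (at y0) z)"
  define E where "E = snd c ` (fst c \<inter> fst d)"
  let ?Gc = "g p c" and ?Gd = "g p d" and ?dGc = "metric_D g c p" and ?dGd = "metric_D g d p"
  have p: "p \<in> fst c" "p \<in> fst d" using pc pd by (auto simp: p_def)
  have oE: "open E" and y0: "y0 \<in> E" and sm: "smooth_on E \<psi>"
    using overlap_open[OF A c d] transition_smooth[OF A c d] p by (auto simp: E_def y0_def \<psi>_def)
  have D2sym: "D2 z v = D2 v z" for z v
    unfolding D2_def by (rule second_derivative_symmetric[OF sm oE y0])
  have T: "frechet_derivative \<psi> (at y0) = T" by (simp add: T_def trans_deriv_def \<psi>_def y0_def)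
  have linT: "linear T" unfolding T_def by (rule trans_deriv_linear[OF A c d p])
  have \<psi>D: "(\<psi> has_derivative T) (at y0)"
    using trans_deriv_has_derivative[OF A c d p] by (simp add: T_def \<psi>_def y0_def)
  have \<psi>y0: "\<psi> y0 = snd d p" using cinv_chart[OF A c p(1)] by (simp add: \<psi>_def y0_def)
  have ap: "((\<lambda>y. frechet_derivative \<psi> (at y) v) has_derivative (\<lambda>z. D2 z v)) (at y0)" for v
    unfolding D2_def by (rule smooth_on_has_derivative[OF smooth_on_frechet_derivative[OF sm oE smooth_on_const] y0])
  \<comment> \<open>the transformation law of the metric, differentiated in direction \<open>z\<close>\<close>
  have dG: "v \<bullet> (?dGc z *v w) = D2 z v \<bullet> (?Gd *v T w) + T v \<bullet> (?dGd (T z) *v T w) + T v \<bullet> (?Gd *v D2 z w)" for v w z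
  proof -
    have a1: "((\<lambda>y. v \<bullet> (g (cinv c y) c *v w)) has_derivative (\<lambda>z. v \<bullet> (?dGc z *v w))) (at y0)"
      unfolding y0_def
      by (rule has_derivative_inner_right[OF bounded_linear.has_derivative[OF
              bounded_bilinear.bounded_linear_left[OF bounded_bilinear_matrix_vector_mult] metric_has_derivative[OF g c p(1)]]])
    have a2: "((\<lambda>y. v \<bullet> (g (cinv c y) c *v w)) has_derivative
      (\<lambda>z. D2 z v \<bullet> (?Gd *v T w) + T v \<bullet> (?dGd (T z) *v T w) + T v \<bullet> (?Gd *v D2 z w))) (at y0)"
    proof (rule has_derivative_transform_within_open[OF _ oE y0])
      have G: "((\<lambda>y. g (cinv d (\<psi> y)) d) has_derivative (\<lambda>z. ?dGd (T z))) (at y0)"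
        by (rule has_derivative_compose[OF \<psi>D]) (use metric_has_derivative[OF g d p(2)] \<psi>y0 in simp)
      have "((\<lambda>y. frechet_derivative \<psi> (at y) v \<bullet> (g (cinv d (\<psi> y)) d *v frechet_derivative \<psi> (at y) w)) has_derivative
        (\<lambda>z. frechet_derivative \<psi> (at y0) v \<bullet> (g (cinv d (\<psi> y0)) d *v D2 z w + ?dGd (T z) *v frechet_derivative \<psi> (at y0) w)
           + D2 z v \<bullet> (g (cinv d (\<psi> y0)) d *v frechet_derivative \<psi> (at y0) w))) (at y0)"
        by (rule has_derivative_inner[OF ap bounded_bilinear.FDERIV[OF bounded_bilinear_matrix_vector_mult G ap]])
      then show "((\<lambda>y. frechet_derivative \<psi> (at y) v \<bullet> (g (cinv d (\<psi> y)) d *v frechet_derivative \<psi> (at y) w)) has_derivative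
        (\<lambda>z. D2 z v \<bullet> (?Gd *v T w) + T v \<bullet> (?dGd (T z) *v T w) + T v \<bullet> (?Gd *v D2 z w))) (at y0)"
        by (rule has_derivative_eq_rhs)
          (use \<psi>y0 cinv_chart[OF A d p(2)] in \<open>simp add: fun_eq_iff T inner_add_right\<close>)
    next
      fix y assume "y \<in> E"
      then obtain q where q: "q \<in> fst c" "q \<in> fst d" "y = snd c q" by (auto simp: E_def)
      have "cinv c y = q" "cinv d (\<psi> y) = q"
        using q cinv_chart[OF A c] cinv_chart[OF A d] by (auto simp: \<psi>_def)
      moreover have "frechet_derivative \<psi> (at y) = trans_deriv c d q" by (simp add: trans_deriv_def \<psi>_def q)
      ultimately show "frechet_derivative \<psi> (at y) v \<bullet> (g (cinv d (\<psi> y)) d *v frechet_derivative \<psi> (at y) w)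
          = v \<bullet> (g (cinv c y) c *v w)"
        using lorentz_tensor[OF g c d q(1,2)] by simp
    qed
    show ?thesis using fun_cong[OF has_derivative_unique[OF a1 a2], of z] .
  qed
  define P where "P = push u x a c"
  define X where "X = frechet_derivative (\<lambda>y. V y c) (at x) a"
  define W where "W = V x c"
  have TP: "push u x a d = T P" and TW: "V x d = T W"
    using tangent_vectorD[OF push_tangent_vector[OF A u] c d] tangent_vectorD[OF V[OF u(3)] c d] p
    by (auto simp: T_def P_def W_def p_def)
  have TX: "frechet_derivative (\<lambda>y. V y d) (at x) a = T X + D2 P W"
  proof -
    let ?D = "D \<inter> u -` (fst c \<inter> fst d)"
    have "?D = (D \<inter> u -` fst c) \<inter> (D \<inter> u -` fst d)" by auto
    then have o: "open ?D"
      using open_Int[OF smooth_into_chart(1)[OF A u(1,2) c] smooth_into_chart(1)[OF A u(1,2) d]] by simp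
    have h0: "(snd c \<circ> u) x = y0" by (simp add: y0_def p_def)
    have "((\<lambda>y. frechet_derivative \<psi> (at ((snd c \<circ> u) y)) (V y c)) has_derivative
      (\<lambda>a. frechet_derivative \<psi> (at ((snd c \<circ> u) x)) (frechet_derivative (\<lambda>y. V y c) (at x) a) +
         frechet_derivative (\<lambda>z. frechet_derivative \<psi> (at z) (V x c)) (at ((snd c \<circ> u) x)) (push u x a c))) (at x)"
      by (rule has_derivative_frechet_apply[OF sm oE _ push_has_derivative[OF A u c pc] dV[OF c pc, unfolded frechet_derivative_works]])
        (use y0 h0 in simp)
    then have "((\<lambda>y. V y d) has_derivative
      (\<lambda>a. frechet_derivative \<psi> (at ((snd c \<circ> u) x)) (frechet_derivative (\<lambda>y. V y c) (at x) a) +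
         frechet_derivative (\<lambda>z. frechet_derivative \<psi> (at z) (V x c)) (at ((snd c \<circ> u) x)) (push u x a c))) (at x)"
    proof (rule has_derivative_transform_within_open[OF _ o])
      fix y assume y: "y \<in> ?D"
      then show "frechet_derivative \<psi> (at ((snd c \<circ> u) y)) (V y c) = V y d"
        using tangent_vectorD[OF V c d, of y] by (simp add: trans_deriv_def \<psi>_def)
    qed (use u pc pd in auto)
    from fun_cong[OF frechet_derivative_at[OF this], of a] show ?thesis
      unfolding h0 T by (simp add: X_def P_def W_def D2_def)
  qed
  define cc where "cc = cov_deriv g u x a V c"
  define cd where "cd = cov_deriv g u x a V d"
  have sym: "v \<bullet> (?Gd *v w) = w \<bullet> (?Gd *v v)" for v w by (rule lorentz_symmetric[OF g d p(2)])
  show "cov_deriv g u x a V d = trans_deriv c d (u x) (cov_deriv g u x a V c)"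
  proof (rule lorentz_nondegenerate[OF g d pd])
    fix w'
    define w where "w = trans_deriv d c p w'"
    have w': "w' = T w" unfolding w_def T_def by (rule trans_deriv_inverse[OF A c p(1) d p(2), symmetric])
    have "w' \<bullet> (?Gd *v T cc) = w \<bullet> (?Gc *v cc)"
      unfolding w' T_def by (rule lorentz_tensor[OF g c d p])
    also have "\<dots> = w \<bullet> (?Gc *v X) + (W \<bullet> (?dGc P *v w) + P \<bullet> (?dGc W *v w) - P \<bullet> (?dGc w *v W)) / 2"
      using cov_deriv_lower[where u=u and x=x and w=w and a=a and V=V, OF g c pc] by (simp add: cc_def P_def W_def X_def p_def)
    also have "w \<bullet> (?Gc *v X) = T w \<bullet> (?Gd *v T X)"
      unfolding T_def by (rule lorentz_tensor[OF g c d p, symmetric])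
    finally have 1: "w' \<bullet> (?Gd *v T cc) = T w \<bullet> (?Gd *v T X) + (W \<bullet> (?dGc P *v w) + P \<bullet> (?dGc W *v w) - P \<bullet> (?dGc w *v W)) / 2" .
    have 2: "w' \<bullet> (?Gd *v cd) = T w \<bullet> (?Gd *v T X) + T w \<bullet> (?Gd *v D2 P W)
        + (T W \<bullet> (?dGd (T P) *v T w) + T P \<bullet> (?dGd (T W) *v T w) - T P \<bullet> (?dGd (T w) *v T W)) / 2"
      using cov_deriv_lower[where u=u and x=x and w="T w" and a=a and V=V, OF g d pd]
      by (simp add: cd_def w' TP TW TX p_def matrix_vector_right_distrib inner_add_right)
    have "w' \<bullet> (?Gd *v cd) = w' \<bullet> (?Gd *v T cc)"
      unfolding 1 2 dG using sym[of "T W" "D2 P w"] sym[of "T P" "D2 W w"] sym[of "T P" "D2 w W"]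
        sym[of "D2 P W" "T w"] sym[of "D2 W P" "T w"] sym[of "D2 w P" "T W"]
        D2sym[of P W] D2sym[of P w] D2sym[of W w] by (simp add: field_simps)
    then show "w' \<bullet> (g (u x) d *v cov_deriv g u x a V d) =
        w' \<bullet> (g (u x) d *v trans_deriv c d (u x) (cov_deriv g u x a V c))"
      by (simp add: cc_def cd_def T_def p_def)
  qed
qed


section \<open>Traces over planes\<close>

text \<open>The trace of \<open>B\<close> with respect to \<open>G\<close> on the plane spanned by \<open>v\<close> and \<open>w\<close>, with the inverse of the Gram
  matrix written out by Cramer's rule. In this form it makes sense for frame fields away from the surface.\<close>

definition plane_trace :: "('a \<Rightarrow> 'a \<Rightarrow> real) \<Rightarrow> ('a \<Rightarrow> 'a \<Rightarrow> real) \<Rightarrow> 'a \<Rightarrow> 'a \<Rightarrow> real" where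
  "plane_trace G B v w = (B v v * G w w - (B v w + B w v) * G v w + B w w * G v v) / (G v v * G w w - (G v w)\<^sup>2)"

text \<open>Numerator and denominator both scale with the square of the determinant of the change of basis.\<close>

lemma plane_trace_change_basis:
  fixes G B :: "'a::real_vector \<Rightarrow> 'a \<Rightarrow> real"
  assumes G: "bilinear G" "\<And>x y. G x y = G y x" and B: "bilinear B"
    and J: "\<alpha> * \<delta> - \<beta> * \<gamma> \<noteq> 0"
  shows "plane_trace G B (\<alpha> *\<^sub>R v + \<beta> *\<^sub>R w) (\<gamma> *\<^sub>R v + \<delta> *\<^sub>R w) = plane_trace G B v w"
proof -
  define J where "J = (\<alpha> * \<delta> - \<beta> * \<gamma>)\<^sup>2"
  have J0: "J \<noteq> 0" using J by (simp add: J_def)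
  note ex = bilinear_ladd bilinear_radd bilinear_lmul bilinear_rmul
  let ?v = "\<alpha> *\<^sub>R v + \<beta> *\<^sub>R w" and ?w = "\<gamma> *\<^sub>R v + \<delta> *\<^sub>R w"
  have num: "B ?v ?v * G ?w ?w - (B ?v ?w + B ?w ?v) * G ?v ?w + B ?w ?w * G ?v ?v
      = J * (B v v * G w w - (B v w + B w v) * G v w + B w w * G v v)"
    unfolding ex[OF G(1)] ex[OF B] G(2)[of w v] J_def by (simp add: power2_eq_square) algebra
  have den: "G ?v ?v * G ?w ?w - (G ?v ?w)\<^sup>2 = J * (G v v * G w w - (G v w)\<^sup>2)"
    unfolding ex[OF G(1)] G(2)[of w v] J_def by (simp add: power2_eq_square) algebra
  show ?thesis unfolding plane_trace_def num den using J0 by simp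
qed

lemma matrix_inv_2:
  fixes h :: "real^2^2"
  assumes "det h \<noteq> 0"
  shows "matrix_inv h $ 1 $ 1 = h $ 2 $ 2 / det h" "matrix_inv h $ 1 $ 2 = - h $ 1 $ 2 / det h"
    "matrix_inv h $ 2 $ 1 = - h $ 2 $ 1 / det h" "matrix_inv h $ 2 $ 2 = h $ 1 $ 1 / det h"
proof -
  define \<delta> where "\<delta> = det h"
  have \<delta>0: "\<delta> \<noteq> 0" and \<delta>: "h $ 1 $ 1 * h $ 2 $ 2 = \<delta> + h $ 1 $ 2 * h $ 2 $ 1"
    using assms by (simp_all add: \<delta>_def det_2)
  define B :: "real^2^2" where
    "B = vector [vector [h $ 2 $ 2 / \<delta>, - h $ 1 $ 2 / \<delta>], vector [- h $ 2 $ 1 / \<delta>, h $ 1 $ 1 / \<delta>]]"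
  have B: "B $ 1 $ 1 = h $ 2 $ 2 / \<delta>" "B $ 1 $ 2 = - h $ 1 $ 2 / \<delta>"
    "B $ 2 $ 1 = - h $ 2 $ 1 / \<delta>" "B $ 2 $ 2 = h $ 1 $ 1 / \<delta>" by (simp_all add: B_def)
  have "h ** B = mat 1" "B ** h = mat 1"
    using \<delta> \<delta>0 by (simp_all add: vec_eq_iff forall_2 matrix_matrix_mult_def sum_2 mat_def B field_simps)
  then have "matrix_inv h = B" by (rule matrix_inv_unique)
  then show "matrix_inv h $ 1 $ 1 = h $ 2 $ 2 / det h" "matrix_inv h $ 1 $ 2 = - h $ 1 $ 2 / det h"
    "matrix_inv h $ 2 $ 1 = - h $ 2 $ 1 / det h" "matrix_inv h $ 2 $ 2 = h $ 1 $ 1 / det h"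
    using B by (simp_all add: \<delta>_def)
qed

lemma matrix_inv_2_trace:
  fixes h :: "real^2^2"
  assumes "det h \<noteq> 0" and "\<And>i j. h $ i $ j = G (b i) (b j)" and "\<And>x y. G x y = G y x"
  shows "(\<Sum>i\<in>UNIV. \<Sum>j\<in>UNIV. matrix_inv h $ i $ j * B (b i) (b j)) = plane_trace G B (b 1) (b 2)"
  using assms(3)[of "b 2" "b 1"]
  by (simp add: sum_2 matrix_inv_2[OF assms(1)] assms(2) plane_trace_def det_2 power2_eq_square
      diff_divide_distrib add_divide_distrib algebra_simps)

section \<open>Mean curvature in a normal direction\<close>

text \<open>The Lie derivative of the metric along \<open>E\<close> in the components of one chart. Christoffel symbols are absent, so it is easy
  to compare for two metrics and to evaluate on frame fields.\<close>

definition lie_metric :: "'n metric \<Rightarrow> 'n chart \<Rightarrow> ('n \<Rightarrow> 'n tvec) \<Rightarrow> 'n \<Rightarrow> real^4 \<Rightarrow> real^4 \<Rightarrow> real" where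
  "lie_metric g c E p v w =
     w \<bullet> (g p c *v frechet_derivative (\<lambda>y. E (cinv c y) c) (at (snd c p)) v)
   + v \<bullet> (g p c *v frechet_derivative (\<lambda>y. E (cinv c y) c) (at (snd c p)) w)
   + v \<bullet> (metric_D g c p (E p c) *v w)"

lemma vfield_has_derivative:
  assumes A: "smooth_atlas A" and E: "smooth_vfield A W E" and c: "c \<in> A" and p: "p \<in> W" "p \<in> fst c"
  shows "((\<lambda>y. E (cinv c y) c) has_derivative frechet_derivative (\<lambda>y. E (cinv c y) c) (at (snd c p))) (at (snd c p))"
  using E c p unfolding smooth_vfield_def
  by (intro smooth_on_has_derivative[of "snd c ` (W \<inter> fst c)"]) auto

lemma vfield_along_has_derivative:
  assumes A: "smooth_atlas A" and E: "smooth_vfield A W E" and c: "c \<in> A" and p: "u x \<in> W" "u x \<in> fst c"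
    and u: "smooth_into A D u" "open D" "x \<in> D"
  shows "((\<lambda>y. E (u y) c) has_derivative
    (\<lambda>a. frechet_derivative (\<lambda>y. E (cinv c y) c) (at (snd c (u x))) (push u x a c))) (at x)"
proof -
  have "((\<lambda>y. E (cinv c ((snd c \<circ> u) y)) c) has_derivative
    (\<lambda>a. frechet_derivative (\<lambda>y. E (cinv c y) c) (at (snd c (u x))) (push u x a c))) (at x)"
    by (rule has_derivative_compose[OF push_has_derivative[OF A u c p(2)]])
      (use vfield_has_derivative[OF A E c p] in simp)
  then show ?thesis
    by (rule has_derivative_transform_within_open[OF _ smooth_into_chart(1)[OF A u(1,2) c]])
      (use u p cinv_chart[OF A c] in auto)
qed

lemma lie_metric_bilinear:
  assumes A: "smooth_atlas A" and E: "smooth_vfield A W E" and c: "c \<in> A" and p: "p \<in> W" "p \<in> fst c"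
  shows "bilinear (lie_metric g c E p)"
proof -
  have l: "linear (frechet_derivative (\<lambda>y. E (cinv c y) c) (at (snd c p)))"
    using vfield_has_derivative[OF assms] by (rule has_derivative_linear)
  show ?thesis
    unfolding bilinear_def lie_metric_def
    by (auto intro!: linearI simp: linear_add[OF l] linear_scale[OF l] matrix_vector_right_distrib
        inner_add_left inner_add_right matrix_vector_mult_scaleR algebra_simps)
qed

text \<open>The derivative of the identity \<open>g(\<partial>\<^sub>b u, E) = 0\<close> in direction \<open>a\<close>.\<close>

lemma normal_field_derivative:
  assumes A: "smooth_atlas A" and g: "lorentz_metric A g" and E: "smooth_vfield A W E" and W: "open W"
    and c: "c \<in> A" and p: "u x \<in> W" "u x \<in> fst c"
    and u: "smooth_into A D u" "open D" "x \<in> D"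
    and normal: "\<And>y. y \<in> D \<Longrightarrow> u y \<in> W \<Longrightarrow> u y \<in> fst c \<Longrightarrow> push u y b c \<bullet> (g (u y) c *v E (u y) c) = 0"
  shows "frechet_derivative (\<lambda>y. push u y b c) (at x) a \<bullet> (g (u x) c *v E (u x) c)
    + push u x b c \<bullet> (metric_D g c (u x) (push u x a c) *v E (u x) c)
    + push u x b c \<bullet> (g (u x) c *v frechet_derivative (\<lambda>y. E (cinv c y) c) (at (snd c (u x))) (push u x a c)) = 0"
proof -
  let ?D = "D \<inter> u -` (W \<inter> fst c)"
  have o: "open ?D"
    using u W chart_domain_open[OF A c] by (auto simp: smooth_into_def continuous_on_open_vimage Int_commute)
  have x: "x \<in> ?D" using u p by auto
  have d: "((\<lambda>y. push u y b c) has_derivative frechet_derivative (\<lambda>y. push u y b c) (at x)) (at x)"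
    by (rule smooth_on_has_derivative[OF push_smooth[OF A u(1,2) c]]) (use u p in auto)
  note d1 = metric_along_has_derivative[OF A g c p(2) u d vfield_along_has_derivative[OF A E c p u]]
  have d2: "((\<lambda>y. push u y b c \<bullet> (g (u y) c *v E (u y) c)) has_derivative (\<lambda>a. 0)) (at x)"
    by (rule has_derivative_transform_within_open[OF has_derivative_const o x]) (use normal in auto)
  show ?thesis using fun_cong[OF has_derivative_unique[OF d1 d2], of a] .
qed

context
  fixes A :: "('n::topological_space) atlas" and g :: "'n metric" and S :: "'n set"
    and D :: "(real^2) set" and u :: "real^2 \<Rightarrow> 'n" and x :: "real^2" and c :: "'n chart"
  assumes A: "smooth_atlas A" and g: "lorentz_metric A g" and u: "local_param A S D u" and x: "x \<in> D"
    and c: "c \<in> A" and p: "u x \<in> fst c" and nd: "det (induced_metric A g u x) \<noteq> 0"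
begin

lemma param_smooth: "smooth_into A D u" "open D"
  using u by (auto simp: local_param_def)

lemma induced_metric_chart:
  "induced_metric A g u x $ i $ j = push u x (axis i 1) c \<bullet> (g (u x) c *v push u x (axis j 1) c)"
  using ip_chart[OF A g push_tangent_vector[OF A param_smooth x] push_tangent_vector[OF A param_smooth x] c p]
  by (simp add: induced_metric_def)

lemma cov_deriv_push_tangent_vector:
  "tangent_vector A (u x) (cov_deriv g u x a (\<lambda>y. push u y b))"
proof (rule cov_deriv_tangent_vector[OF A g param_smooth x])
  fix c assume "c \<in> A" "u x \<in> fst c"
  then show "(\<lambda>y. push u y b c) differentiable at x"
    using smooth_on_differentiable[OF push_smooth[OF A param_smooth]] x by auto
qed (rule push_tangent_vector[OF A param_smooth])

lemma mean_curvature_param_tangent_vector: "tangent_vector A (u x) (mean_curvature_param A g u x)"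
proof -
  have n: "tangent_vector A (u x) (normal_part A g u x v)" if "tangent_vector A (u x) v" for v
  proof -
    have "tangent_vector A (u x) (\<lambda>c. v c + (\<Sum>i\<in>UNIV. \<Sum>j\<in>UNIV.
        (- (matrix_inv (induced_metric A g u x) $ i $ j * ip A g (u x) v (push u x (axis i 1))))
          *\<^sub>R push u x (axis j 1) c))"
      by (intro tangent_vector_add tangent_vector_sum tangent_vector_scaleR that
          push_tangent_vector[OF A param_smooth x] A)
    then show ?thesis by (simp add: normal_part_def sum_negf)
  qed
  show ?thesis
    unfolding mean_curvature_param_def second_ff_def
    by (intro tangent_vector_sum tangent_vector_scaleR n cov_deriv_push_tangent_vector A)
qed

abbreviation "bas i \<equiv> push u x (axis i 1) c"
abbreviation "nab i j \<equiv> cov_deriv g u x (axis i 1) (\<lambda>y. push u y (axis j 1)) c"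
abbreviation "hinv i j \<equiv> matrix_inv (induced_metric A g u x) $ i $ j"
abbreviation "gm v w \<equiv> v \<bullet> (g (u x) c *v w)"

lemma gm_sym: "gm v w = gm w v"
  by (rule lorentz_symmetric[OF g c p])

lemma second_ff_chart:
  "second_ff A g u x i j c = nab i j - (\<Sum>k\<in>UNIV. \<Sum>l\<in>UNIV. (hinv k l * gm (nab i j) (bas k)) *\<^sub>R bas l)"
  using ip_chart[OF A g cov_deriv_push_tangent_vector push_tangent_vector[OF A param_smooth x] c p]
  by (simp add: second_ff_def normal_part_def)

lemma second_ff_orthogonal: "gm (bas m) (second_ff A g u x i j c) = 0"
proof -
  have h: "induced_metric A g u x $ k $ l = gm (bas k) (bas l)" for k l by (rule induced_metric_chart)
  have s: "gm (bas 2) (bas 1) = gm (bas 1) (bas 2)" by (rule gm_sym)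
  have d: "gm (bas 1) (bas 1) * gm (bas 2) (bas 2) - gm (bas 1) (bas 2) * gm (bas 1) (bas 2) \<noteq> 0"
    using nd s by (simp add: det_2 h)
  have "gm (bas m) (second_ff A g u x i j c) = gm (nab i j) (bas m)
      - (\<Sum>k\<in>UNIV. \<Sum>l\<in>UNIV. hinv k l * gm (nab i j) (bas k) * gm (bas m) (bas l))"
    unfolding second_ff_chart
    by (simp add: matrix_vector_mult_diff_distrib inner_diff_right sum_2 matrix_vector_right_distrib
        inner_add_right matrix_vector_mult_scaleR gm_sym[of "bas m" "nab i j"])
  also have "\<dots> = 0"
    using exhaust_2[of m] d
    by (auto simp: sum_2 matrix_inv_2[OF nd] h s det_2) (simp_all add: divide_simps, simp_all add: algebra_simps)
  finally show ?thesis .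
qed

lemma mean_curvature_param_orthogonal: "gm (bas m) (mean_curvature_param A g u x c) = 0"
  by (simp add: mean_curvature_param_def sum_2 matrix_vector_right_distrib inner_add_right
      matrix_vector_mult_scaleR second_ff_orthogonal)

lemma mean_curvature_param_normal_component:
  assumes e: "\<And>m. gm (bas m) e = 0"
  shows "gm e (mean_curvature_param A g u x c) = (\<Sum>i\<in>UNIV. \<Sum>j\<in>UNIV. hinv i j * gm e (nab i j))"
proof -
  have e': "gm e (bas m) = 0" for m using e[of m] gm_sym by simp
  have "gm e (second_ff A g u x i j c) = gm e (nab i j)" for i j
    unfolding second_ff_chart
    by (simp add: matrix_vector_mult_diff_distrib inner_diff_right sum_2 matrix_vector_right_distrib
        inner_add_right matrix_vector_mult_scaleR e')
  then show ?thesis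
    by (simp add: mean_curvature_param_def sum_2 matrix_vector_right_distrib inner_add_right matrix_vector_mult_scaleR)
qed

text \<open>Write \<open>\<nabla>\<^sub>i \<partial>\<^sub>j u\<close> with lowered index and eliminate the second derivatives of \<open>u\<close> by means of the derivative of
  \<open>g(\<partial>\<^sub>j u, E) = 0\<close>. After contraction with the symmetric inverse \<open>h\<^sup>i\<^sup>j\<close>, all that is left is the Lie derivative of
  the metric along \<open>E\<close>, which sees only the tangent plane and not the parametrization.\<close>

lemma mean_curvature_param_lie:
  assumes E: "smooth_vfield A W E" "open W" "u x \<in> W"
    and normal: "\<And>y b. y \<in> D \<Longrightarrow> u y \<in> W \<Longrightarrow> u y \<in> fst c \<Longrightarrow> push u y b c \<bullet> (g (u y) c *v E (u y) c) = 0"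
  shows "gm (E (u x) c) (mean_curvature_param A g u x c) =
    - plane_trace gm (lie_metric g c E (u x)) (bas 1) (bas 2) / 2"
proof -
  let ?e = "E (u x) c" and ?D = "frechet_derivative (\<lambda>y. E (cinv c y) c) (at (snd c (u x)))"
  define dd where "dd = (\<lambda>i j. gm ?e (frechet_derivative (\<lambda>y. push u y (axis j 1) c) (at x) (axis i 1)))"
  define m where "m = (\<lambda>i j. bas j \<bullet> (metric_D g c (u x) (bas i) *v ?e))"
  define q where "q = (\<lambda>i j. gm (bas j) (?D (bas i)))"
  define r where "r = (\<lambda>i j. bas i \<bullet> (metric_D g c (u x) ?e *v bas j))"
  have 1: "dd i j + m i j + q i j = 0" for i j
    using normal_field_derivative[where u=u and x=x and a="axis i 1" and b="axis j 1",
        OF A g E(1,2) c E(3) p param_smooth x normal]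
    by (simp add: dd_def m_def q_def gm_sym[of ?e])
  have 2: "gm ?e (nab i j) = dd i j + (m i j + m j i - r i j) / 2" for i j
    using cov_deriv_lower[where u=u and x=x and w="?e" and a="axis i 1" and V="\<lambda>y. push u y (axis j 1)", OF g c p]
    by (simp add: dd_def m_def r_def)
  have 3: "lie_metric g c E (u x) (bas i) (bas j) = q i j + q j i + r i j" for i j
    by (simp add: lie_metric_def q_def r_def)
  have h: "induced_metric A g u x $ k $ l = gm (bas k) (bas l)" for k l by (rule induced_metric_chart)
  have s: "gm (bas 2) (bas 1) = gm (bas 1) (bas 2)" by (rule gm_sym)
  have hs: "hinv 1 2 = hinv 2 1" by (simp add: matrix_inv_2[OF nd] h s)
  have "gm ?e (mean_curvature_param A g u x c) = (\<Sum>i\<in>UNIV. \<Sum>j\<in>UNIV. hinv i j * gm ?e (nab i j))"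
    by (rule mean_curvature_param_normal_component) (rule normal[OF x E(3) p])
  also have "\<dots> = - (\<Sum>i\<in>UNIV. \<Sum>j\<in>UNIV. hinv i j * lie_metric g c E (u x) (bas i) (bas j)) / 2"
  proof -
    have dd: "dd i j = - m i j - q i j" for i j using 1[of i j] by simp
    show ?thesis unfolding 2 3 dd by (simp add: sum_2 hs field_simps)
  qed
  also have "(\<Sum>i\<in>UNIV. \<Sum>j\<in>UNIV. hinv i j * lie_metric g c E (u x) (bas i) (bas j))
      = plane_trace gm (lie_metric g c E (u x)) (bas 1) (bas 2)"
    by (rule matrix_inv_2_trace[where b="\<lambda>i. bas i"]) (use nd h gm_sym in auto)
  finally show ?thesis .
qed

end


section \<open>Steered metrics\<close>

lemma vector_4:
  "(vector [a, b, c, d] :: 'a::zero^4) $ 1 = a" "(vector [a, b, c, d] :: 'a^4) $ 2 = b"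
  "(vector [a, b, c, d] :: 'a^4) $ 3 = c" "(vector [a, b, c, d] :: 'a^4) $ 4 = d"
  unfolding vector_def by simp_all

lemma frame_inner_cancel:
  fixes v w :: "real^4"
  assumes "det (vector [a, b, c, d] :: real^4^4) \<noteq> 0"
    and "a \<bullet> v = a \<bullet> w" "b \<bullet> v = b \<bullet> w" "c \<bullet> v = c \<bullet> w" "d \<bullet> v = d \<bullet> w"
  shows "v = w"
proof (rule invertible_mult_vec_cancel)
  show "invertible (vector [a, b, c, d] :: real^4^4)" using assms(1) by (simp add: invertible_det_nz)
  show "(vector [a, b, c, d] :: real^4^4) *v v = (vector [a, b, c, d] :: real^4^4) *v w"
    using assms(2-) by (simp add: vec_eq_iff forall_4 matrix_vector_mul_component vector_4)
qed

lemma bilinear_form_eqI: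
  fixes M N :: "real^'n^'n"
  assumes "\<And>v w. v \<bullet> (M *v w) = v \<bullet> (N *v w)"
  shows "M = N"
proof -
  have "M *v w = N *v w" for w
    by (rule vector_eq_ldot[THEN iffD1]) (blast intro: assms)
  then show ?thesis by (simp add: matrix_eq)
qed

lemma symmetrized_product_form:
  fixes a b v w :: "real^'n"
  shows "v \<bullet> ((\<chi> i j. a $ i * b $ j + b $ i * a $ j) *v w) = (a \<bullet> v) * (b \<bullet> w) + (b \<bullet> v) * (a \<bullet> w)"
  unfolding inner_matrix_vector_sum
  by (simp only: inner_vec_def inner_real_def sum_product sum.distrib[symmetric] vec_lambda_beta)
    (intro sum.cong refl, simp add: algebra_simps)

lemma steer_form:
  assumes "p \<in> U"
  shows "v \<bullet> (steer g U \<beta>t \<beta>r Q p c *v w) = v \<bullet> (g p c *v w)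
    + Q p * ((\<beta>t p c \<bullet> v) * (\<beta>r p c \<bullet> w) + (\<beta>r p c \<bullet> v) * (\<beta>t p c \<bullet> w))"
  using assms by (simp add: steer_def matrix_vector_mult_add_rdistrib inner_add_right
      scaleR_matrix_vector_assoc[symmetric] symmetrized_product_form)

lemma steer_zero: "steer g U \<beta>t \<beta>r (\<lambda>_. 0) = g"
  by (simp add: steer_def fun_eq_iff)

text \<open>Adding a multiple of \<open>\<beta>t \<otimes> \<beta>r + \<beta>r \<otimes> \<beta>t\<close> amounts to pulling the form back along a linear
  isomorphism that only moves \<open>r\<close>, to the unit vector completing \<open>t\<close> in the steered plane. So the
  signature cannot change, whatever the size of the multiple.\<close>

lemma steered_form_signature:
  fixes G :: "real^4^4" and t r :: "real^4" and q :: real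
  assumes sym: "transpose G = G" and P: "invertible P" "transpose P ** G ** P = minkowski"
    and tt: "t \<bullet> (G *v t) = -1" and rr: "r \<bullet> (G *v r) = 1" and tr: "t \<bullet> (G *v r) = 0"
    and bt: "bt = - (G *v t)" and br: "br = G *v r"
  shows "\<exists>P. invertible P \<and> transpose P ** (G + q *\<^sub>R (\<chi> i j. bt $ i * br $ j + br $ i * bt $ j)) ** P = minkowski"
proof -
  \<comment> \<open>\<open>r + z = s r - q t\<close> has norm \<open>1\<close> and inner product \<open>q\<close> with \<open>t\<close>, which are the steered values for \<open>r\<close>\<close>
  define s where "s = sqrt (1 + q\<^sup>2)"
  have s: "s\<^sup>2 = 1 + q\<^sup>2" "s > 0" by (simp_all add: s_def add_pos_nonneg)
  define z where "z = (s - 1) *\<^sub>R r - q *\<^sub>R t"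
  define L :: "real^4^4" where "L = mat 1 + (\<chi> i j. z $ i * br $ j)"
  have Gsym: "v \<bullet> (G *v w) = w \<bullet> (G *v v)" for v w
    using dot_lmul_matrix[of v G w] transpose_matrix_vector[of G v] sym by (simp add: inner_commute)
  have rank1: "(\<chi> i j. z $ i * br $ j) *v v = (br \<bullet> v) *\<^sub>R z" for v
    by (simp add: vec_eq_iff matrix_vector_mult_def inner_vec_def sum_distrib_left sum_distrib_right ac_simps)
  have L: "L *v v = v + (br \<bullet> v) *\<^sub>R z" for v
    by (simp add: L_def matrix_vector_mult_add_rdistrib rank1)
  have btv: "bt \<bullet> v = - (v \<bullet> (G *v t))" and brv: "br \<bullet> v = v \<bullet> (G *v r)" for v
    by (simp_all add: bt br inner_commute)
  have brz: "br \<bullet> z = s - 1"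
    unfolding brv by (simp add: z_def inner_diff_left rr tr)
  have vz: "v \<bullet> (G *v z) = (s - 1) * (br \<bullet> v) + q * (bt \<bullet> v)" for v
    by (simp add: z_def matrix_vector_mult_diff_distrib inner_diff_right matrix_vector_mult_scaleR btv brv)
  have zz: "z \<bullet> (G *v z) = (s - 1)\<^sup>2 - q\<^sup>2"
  proof -
    have "bt \<bullet> z = - q" unfolding btv by (simp add: z_def inner_diff_left tt Gsym[of r t] tr)
    then show ?thesis unfolding vz brz by (simp add: power2_eq_square)
  qed
  have "inj ((*v) L)"
  proof (rule injI)
    fix v w assume "L *v v = L *v w"
    then have *: "v - w + (br \<bullet> (v - w)) *\<^sub>R z = 0" by (simp add: L inner_diff_right algebra_simps)
    then have "br \<bullet> (v - w + (br \<bullet> (v - w)) *\<^sub>R z) = 0" by simp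
    then have "s * (br \<bullet> (v - w)) = 0" by (simp add: inner_add_right brz algebra_simps)
    then have "br \<bullet> (v - w) = 0" using s by simp
    then show "v = w" using * by simp
  qed
  then have "\<exists>B. B ** L = mat 1" by (simp add: matrix_left_invertible_injective)
  then have L_inv: "invertible L" by (simp add: invertible_left_inverse)
  have pull: "transpose L ** G ** L = G + q *\<^sub>R (\<chi> i j. bt $ i * br $ j + br $ i * bt $ j)"
  proof (rule bilinear_form_eqI)
    fix v w
    have "v \<bullet> ((transpose L ** G ** L) *v w) = (L *v v) \<bullet> (G *v (L *v w))"
      by (metis dot_lmul_matrix matrix_vector_mul_assoc vector_transpose_matrix transpose_transpose)
    also have "\<dots> = v \<bullet> (G *v w) + (br \<bullet> w) * (v \<bullet> (G *v z)) + (br \<bullet> v) * (w \<bullet> (G *v z))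
        + (br \<bullet> v) * (br \<bullet> w) * (z \<bullet> (G *v z))"
      by (simp add: L matrix_vector_right_distrib matrix_vector_mult_scaleR inner_add_left inner_add_right
          Gsym[of z w] algebra_simps)
    also have "\<dots> = v \<bullet> (G *v w) + q * ((bt \<bullet> v) * (br \<bullet> w) + (br \<bullet> v) * (bt \<bullet> w))
        + (br \<bullet> v) * (br \<bullet> w) * (s\<^sup>2 - 1 - q\<^sup>2)"
      unfolding zz unfolding vz by (simp add: power2_eq_square algebra_simps)
    finally show "v \<bullet> ((transpose L ** G ** L) *v w) =
        v \<bullet> ((G + q *\<^sub>R (\<chi> i j. bt $ i * br $ j + br $ i * bt $ j)) *v w)"
      using s(1) by (simp add: matrix_vector_mult_add_rdistrib inner_add_right
          scaleR_matrix_vector_assoc[symmetric] symmetrized_product_form)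
  qed
  obtain L' where L': "L ** L' = mat 1" "L' ** L = mat 1" using L_inv by (auto simp: invertible_def)
  have t: "transpose L' ** transpose L = mat 1"
    using L'(1) by (metis matrix_transpose_mul transpose_mat)
  have "invertible (L' ** P)" using L' P(1) by (intro invertible_mult) (auto simp: invertible_def)
  moreover have "transpose (L' ** P) ** (transpose L ** G ** L) ** (L' ** P) =
      transpose P ** (transpose L' ** transpose L) ** G ** (L ** L') ** P"
    by (simp add: matrix_transpose_mul matrix_mul_assoc)
  then have "transpose (L' ** P) ** (transpose L ** G ** L) ** (L' ** P) = minkowski"
    unfolding t L'(1) using P(2) by simp
  ultimately show ?thesis unfolding pull by blast
qed

lemma smooth_on_vec_lambda:
  fixes f :: "'i::finite \<Rightarrow> 'a::euclidean_space \<Rightarrow> 'b::euclidean_space"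
  assumes "open S" "\<And>i. smooth_on S (f i)"
  shows "smooth_on S (\<lambda>x. \<chi> i. f i x)"
proof (rule smooth_on_components[OF assms(1)])
  fix b :: "'b^'i" assume "b \<in> Basis"
  then obtain i b' where b: "b = axis i b'" by (auto simp: Basis_vec_def)
  show "smooth_on S (\<lambda>x. (\<chi> i. f i x) \<bullet> b)"
    unfolding b inner_axis by (simp add: smooth_on_inner assms smooth_on_const)
qed

lemma smooth_on_metric_field:
  assumes A: "smooth_atlas A" and g: "lorentz_metric A g" and E: "smooth_vfield A W E"
    and c: "c \<in> A" and W: "open W"
  shows "smooth_on (snd c ` (W \<inter> fst c)) (\<lambda>y. g (cinv c y) c *v E (cinv c y) c)"
proof (rule smooth_on_matrix_vector_mult[OF chart_image_open[OF A c W]])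
  show "smooth_on (snd c ` (W \<inter> fst c)) (\<lambda>y. g (cinv c y) c)"
    by (rule smooth_on_subset[OF lorentz_smooth[OF g c]]) auto
  show "smooth_on (snd c ` (W \<inter> fst c)) (\<lambda>y. E (cinv c y) c)"
    using E c by (auto simp: smooth_vfield_def)
qed

lemma lorentz_transpose: "lorentz_metric A g \<Longrightarrow> c \<in> A \<Longrightarrow> p \<in> fst c \<Longrightarrow> transpose (g p c) = g p c"
  unfolding lorentz_metric_def by blast

lemma lorentz_minkowski:
  "lorentz_metric A g \<Longrightarrow> c \<in> A \<Longrightarrow> p \<in> fst c \<Longrightarrow>
    \<exists>P. invertible P \<and> transpose P ** g p c ** P = minkowski"
  unfolding lorentz_metric_def by blast

text \<open>The two covectors are metric duals of the normal fields, hence tensorial and smooth. As \<open>Q\<close> vanishes outside a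
  closed subset of \<open>U\<close>, every point outside \<open>U\<close> has a neighbourhood in which nothing is changed, so that no
  singularity arises on the boundary of \<open>U\<close>.\<close>

lemma lorentz_steer:
  assumes A: "smooth_atlas A" and g: "lorentz_metric A g" and U: "open U"
    and et: "smooth_vfield A U et" and er: "smooth_vfield A U er"
    and frame: "\<And>p c. p \<in> U \<Longrightarrow> c \<in> A \<Longrightarrow> p \<in> fst c \<Longrightarrow>
      et p c \<bullet> (g p c *v et p c) = -1 \<and> er p c \<bullet> (g p c *v er p c) = 1 \<and> et p c \<bullet> (g p c *v er p c) = 0 \<and>
      \<beta>t p c = - (g p c *v et p c) \<and> \<beta>r p c = g p c *v er p c"
    and Q: "smooth_fun A UNIV Q" and K: "closed K" "K \<subseteq> U" "\<And>p. p \<notin> K \<Longrightarrow> Q p = 0"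
  shows "lorentz_metric A (steer g U \<beta>t \<beta>r Q)"
  unfolding lorentz_metric_def
proof (intro conjI ballI allI)
  let ?g = "steer g U \<beta>t \<beta>r Q"
  fix c assume c: "c \<in> A"
  {
    fix p assume p: "p \<in> fst c"
    show "transpose (?g p c) = ?g p c"
    proof (cases "p \<in> U")
      case True
      have "g p c $ j $ i = g p c $ i $ j" for i j
        using arg_cong[OF lorentz_transpose[OF g c p], of "\<lambda>m. m $ i $ j"] by (simp add: transpose_def)
      then show ?thesis using True by (simp add: steer_def transpose_def vec_eq_iff)
    qed (simp add: steer_def lorentz_transpose[OF g c p])
    show "\<exists>P. invertible P \<and> transpose P ** ?g p c ** P = minkowski"
    proof (cases "p \<in> U")
      case True
      obtain P where "invertible P" "transpose P ** g p c ** P = minkowski"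
        using lorentz_minkowski[OF g c p] by blast
      from steered_form_signature[OF lorentz_transpose[OF g c p] this, of "et p c" "er p c" "\<beta>t p c" "\<beta>r p c" "Q p"]
      show ?thesis using frame[OF True c p] True by (simp add: steer_def)
    qed (simp add: steer_def lorentz_minkowski[OF g c p])
  }
  {
    fix d p v w assume d: "d \<in> A" and p: "p \<in> fst c \<inter> fst d"
    let ?T = "trans_deriv c d p"
    show "?T v \<bullet> (?g p d *v ?T w) = v \<bullet> (?g p c *v w)"
    proof (cases "p \<in> U")
      case True
      have tv: "et p d = ?T (et p c)" "er p d = ?T (er p c)"
        using True et er p c d by (auto simp: smooth_vfield_def intro: tangent_vectorD)
      have t: "?T a \<bullet> (g p d *v ?T b) = a \<bullet> (g p c *v b)" for a b
        by (rule lorentz_tensor[OF g c d]) (use p in auto)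
      have s: "(g p d *v a) \<bullet> b = b \<bullet> (g p d *v a)" "(g p c *v a) \<bullet> b = b \<bullet> (g p c *v a)" for a b
        by (rule inner_commute)+
      have "\<beta>t p d \<bullet> ?T a = \<beta>t p c \<bullet> a" "\<beta>r p d \<bullet> ?T a = \<beta>r p c \<bullet> a" for a
        using frame[OF True c] frame[OF True d] p by (simp_all add: tv s t)
      then show ?thesis by (simp add: steer_form[OF True] t)
    qed (use lorentz_tensor[OF g c d] p in \<open>simp add: steer_def\<close>)
  }
  show "smooth_on (snd c ` fst c) (\<lambda>y. ?g (cinv c y) c)"
  proof (rule smooth_on_local)
    fix y assume "y \<in> snd c ` fst c"
    then obtain p where p: "p \<in> fst c" "y = snd c p" by blast
    show "\<exists>T. open T \<and> y \<in> T \<and> smooth_on T (\<lambda>y. ?g (cinv c y) c)"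
    proof (cases "p \<in> U")
      case True
      let ?T = "snd c ` (U \<inter> fst c)"
      have o: "open ?T" by (rule chart_image_open[OF A c U])
      have sm: "smooth_on ?T (\<lambda>y. g (cinv c y) c)"
        by (rule smooth_on_subset[OF lorentz_smooth[OF g c]]) auto
      have bt: "smooth_on ?T (\<lambda>y. \<beta>t (cinv c y) c)"
        by (rule smooth_on_cong[OF smooth_on_minus[OF o smooth_on_metric_field[OF A g et c U]] o])
          (use frame[OF _ c] cinv_chart[OF A c] in auto)
      have br: "smooth_on ?T (\<lambda>y. \<beta>r (cinv c y) c)"
        by (rule smooth_on_cong[OF smooth_on_metric_field[OF A g er c U] o])
          (use frame[OF _ c] cinv_chart[OF A c] in auto)
      have q: "smooth_on ?T (\<lambda>y. Q (cinv c y))"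
      proof -
        have "smooth_on (snd c ` (UNIV \<inter> fst c)) (Q \<circ> cinv c)" using Q c unfolding smooth_fun_def by blast
        then show ?thesis unfolding o_def by (rule smooth_on_subset) auto
      qed
      have "smooth_on ?T (\<lambda>y. g (cinv c y) c + Q (cinv c y) *\<^sub>R (\<chi> i j.
          \<beta>t (cinv c y) c $ i * \<beta>r (cinv c y) c $ j + \<beta>r (cinv c y) c $ i * \<beta>t (cinv c y) c $ j))"
        by (intro smooth_on_add smooth_on_scaleR smooth_on_vec_lambda smooth_on_mult smooth_on_vec_nth o sm bt br q)
      then have "smooth_on ?T (\<lambda>y. ?g (cinv c y) c)"
        by (rule smooth_on_cong[OF _ o]) (use cinv_chart[OF A c] in \<open>auto simp: steer_def\<close>)
      then show ?thesis using o True p by blast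
    next
      case False
      let ?T = "snd c ` (- K \<inter> fst c)"
      have o: "open ?T" using chart_image_open[OF A c] K(1) by blast
      have "smooth_on ?T (\<lambda>y. g (cinv c y) c)"
        by (rule smooth_on_subset[OF lorentz_smooth[OF g c]]) auto
      then have "smooth_on ?T (\<lambda>y. ?g (cinv c y) c)"
        by (rule smooth_on_cong[OF _ o]) (use cinv_chart[OF A c] K(3) in \<open>auto simp: steer_def\<close>)
      moreover have "y \<in> ?T" using False p K(2) by blast
      ultimately show ?thesis using o by blast
    qed
  qed
qed


section \<open>The mean curvature vector of the surface in a steered metric\<close>

lemma smooth_fun_const: "smooth_fun A W (\<lambda>_. k)"
  by (simp add: smooth_fun_def o_def smooth_on_const)

lemma tangent_to_mono: "tangent_to A S p v \<Longrightarrow> S \<subseteq> M \<Longrightarrow> tangent_to A M p v"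
  unfolding tangent_to_def by blast

lemma local_param_smooth: "local_param A S D u \<Longrightarrow> smooth_into A D u" "local_param A S D u \<Longrightarrow> open D"
  by (auto simp: local_param_def)

lemma local_param_mem: "local_param A S D u \<Longrightarrow> x \<in> D \<Longrightarrow> u x \<in> S"
  by (auto simp: local_param_def)

lemma push_components:
  fixes x :: "real^2"
  assumes "smooth_atlas A" "smooth_into A D u" "open D" "x \<in> D" "c \<in> A" "u x \<in> fst c"
  shows "push u x a c = a $ 1 *\<^sub>R push u x (axis 1 1) c + a $ 2 *\<^sub>R push u x (axis 2 1) c"
proof -
  note l = push_linear[OF assms]
  have "a = a $ 1 *\<^sub>R axis 1 1 + a $ 2 *\<^sub>R axis 2 1"
    by (simp add: vec_eq_iff forall_2 axis_def)
  then have "push u x a c = push u x (a $ 1 *\<^sub>R axis 1 1 + a $ 2 *\<^sub>R axis 2 1) c" by simp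
  then show ?thesis by (simp add: linear_add[OF l] linear_scale[OF l])
qed

lemma has_derivative_mult_zero:
  fixes f h :: "'a::real_normed_vector \<Rightarrow> real"
  assumes "(f has_derivative f') (at x)" "(h has_derivative h') (at x)" "f x = 0" "h x = 0"
  shows "((\<lambda>y. f y * h y) has_derivative (\<lambda>_. 0)) (at x)"
  using has_derivative_mult[OF assms(1,2)] assms(3,4) by simp

locale steering_data =
  fixes A :: "('n::{t2_space,second_countable_topology}) atlas"
    and g :: "'n metric" and T :: "'n \<Rightarrow> 'n tvec"
    and M S U :: "'n set" and I :: "real set" and R :: real and F :: "real \<Rightarrow> 'n \<Rightarrow> 'n"
    and et er :: "'n \<Rightarrow> 'n tvec" and \<beta>t \<beta>r :: "'n \<Rightarrow> 'n chart \<Rightarrow> real^4"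
  assumes spacetime: "spacetime A g T"
    and spacelike: "spacelike A g M"
    and surface: "embedded_surface A S" and S_compact: "compact S" and S_M: "S \<subseteq> M"
    and extension: "frame_extension A g M S I R F U et er"
    and coframe: "dual_coframe A g M S I F U et er \<beta>t \<beta>r"
    and expanding: "area_expanding A g M S I F U et er"
begin

abbreviation "gc p c v w \<equiv> v \<bullet> (g p c *v w)"
abbreviation "adapted W D u X Y \<equiv> adapted_frame A g M S I F et er W D u X Y"
abbreviation "steered Q \<equiv> steer g U \<beta>t \<beta>r Q"

lemma A: "smooth_atlas A" and g: "lorentz_metric A g"
  using spacetime by (auto simp: spacetime_def)

lemma U_open: "open U" and S_U: "S \<subseteq> U" and et: "smooth_vfield A U et" and er: "smooth_vfield A U er"
  using extension by (auto simp: frame_extension_def)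

lemma variation: "normal_variation A g M S I R F"
  using extension by (auto simp: frame_extension_def)

lemma R_I: "R \<in> I" and F_R: "p \<in> S \<Longrightarrow> F R p = p" and F_inj: "inj_on (\<lambda>(r, p). F r p) (I \<times> S)"
  using variation by (auto simp: normal_variation_def)

lemma adapted_frame_at:
  assumes "p \<in> U"
  obtains W D u X Y where "p \<in> W" "W \<subseteq> U" "adapted W D u X Y"
  using extension assms unfolding frame_extension_def by blast

lemma adapted_fields:
  assumes "adapted W D u X Y"
  shows "open W" "local_param A S D u" "smooth_vfield A W et" "smooth_vfield A W er"
    "smooth_vfield A W X" "smooth_vfield A W Y"
  using assms unfolding adapted_frame_def by blast+

lemma vfield_tangent_vector: "smooth_vfield A W X \<Longrightarrow> p \<in> W \<Longrightarrow> tangent_vector A p (X p)"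
  unfolding smooth_vfield_def by blast

lemma adapted_chart:
  assumes ad: "adapted W D u X Y" and p: "p \<in> W" and c: "c \<in> A" "p \<in> fst c"
  shows "det (vector [et p c, er p c, X p c, Y p c] :: real^4^4) \<noteq> 0"
    "gc p c (et p c) (et p c) = -1" "gc p c (er p c) (er p c) = 1" "gc p c (et p c) (er p c) = 0"
    "gc p c (et p c) (X p c) = 0" "gc p c (et p c) (Y p c) = 0"
    "gc p c (er p c) (X p c) = 0" "gc p c (er p c) (Y p c) = 0"
proof -
  note tv = adapted_fields(3-6)[OF ad, THEN vfield_tangent_vector, OF p]
  have "det (vector [et p c, er p c, X p c, Y p c] :: real^4^4) \<noteq> 0 \<and>
    ip A g p (et p) (et p) = -1 \<and> ip A g p (er p) (er p) = 1 \<and> ip A g p (et p) (er p) = 0 \<and>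
    ip A g p (et p) (X p) = 0 \<and> ip A g p (et p) (Y p) = 0 \<and>
    ip A g p (er p) (X p) = 0 \<and> ip A g p (er p) (Y p) = 0"
    using ad p c unfolding adapted_frame_def by blast
  then show "det (vector [et p c, er p c, X p c, Y p c] :: real^4^4) \<noteq> 0"
    "gc p c (et p c) (et p c) = -1" "gc p c (er p c) (er p c) = 1" "gc p c (et p c) (er p c) = 0"
    "gc p c (et p c) (X p c) = 0" "gc p c (et p c) (Y p c) = 0"
    "gc p c (er p c) (X p c) = 0" "gc p c (er p c) (Y p c) = 0"
    using ip_chart[OF A g tv(1) tv(1) c] ip_chart[OF A g tv(2) tv(2) c] ip_chart[OF A g tv(1) tv(2) c]
      ip_chart[OF A g tv(1) tv(3) c] ip_chart[OF A g tv(1) tv(4) c]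
      ip_chart[OF A g tv(2) tv(3) c] ip_chart[OF A g tv(2) tv(4) c] by simp_all
qed

text \<open>Both sides of each formula for a covector take the same values on the adapted frame.\<close>

lemma normal_frame_chart:
  assumes p: "p \<in> U" and c: "c \<in> A" "p \<in> fst c"
  shows "gc p c (et p c) (et p c) = -1" "gc p c (er p c) (er p c) = 1" "gc p c (et p c) (er p c) = 0"
    "\<beta>t p c = - (g p c *v et p c)" "\<beta>r p c = g p c *v er p c"
proof -
  obtain W D u X Y where W: "p \<in> W" "W \<subseteq> U" "adapted W D u X Y" using adapted_frame_at[OF p] .
  note ac = adapted_chart[OF W(3,1) c]
  show "gc p c (et p c) (et p c) = -1" "gc p c (er p c) (er p c) = 1" "gc p c (et p c) (er p c) = 0"
    by (fact ac)+
  have "\<beta>t p c \<bullet> et p c = 1 \<and> \<beta>t p c \<bullet> er p c = 0 \<and> \<beta>t p c \<bullet> X p c = 0 \<and> \<beta>t p c \<bullet> Y p c = 0 \<and>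
     \<beta>r p c \<bullet> et p c = 0 \<and> \<beta>r p c \<bullet> er p c = 1 \<and> \<beta>r p c \<bullet> X p c = 0 \<and> \<beta>r p c \<bullet> Y p c = 0"
    using coframe W c unfolding dual_coframe_def by blast
  then have b: "et p c \<bullet> \<beta>t p c = 1" "er p c \<bullet> \<beta>t p c = 0" "X p c \<bullet> \<beta>t p c = 0" "Y p c \<bullet> \<beta>t p c = 0"
    "et p c \<bullet> \<beta>r p c = 0" "er p c \<bullet> \<beta>r p c = 1" "X p c \<bullet> \<beta>r p c = 0" "Y p c \<bullet> \<beta>r p c = 0"
    by (simp_all add: inner_commute)
  note s = lorentz_symmetric[OF g c]
  show "\<beta>t p c = - (g p c *v et p c)"
    by (rule frame_inner_cancel[OF ac(1)])
      (simp_all add: b ac s[of "er p c" "et p c"] s[of "X p c" "et p c"] s[of "Y p c" "et p c"])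
  show "\<beta>r p c = g p c *v er p c"
    by (rule frame_inner_cancel[OF ac(1)])
      (simp_all add: b ac s[of "X p c" "er p c"] s[of "Y p c" "er p c"])
qed

text \<open>A point of \<open>S\<close> covered by the variation lies on the leaf labelled \<open>R\<close>, because the variation is injective and
  \<open>F R\<close> is the identity on \<open>S\<close>. So on \<open>S\<close> the frame fields are the coordinate fields of the parametrization.\<close>

lemma adapted_frame_on_surface:
  assumes ad: "adapted W D u X Y" and p: "p \<in> W" "p \<in> S"
  obtains x where "x \<in> D" "u x = p" "tv_eq A p (X p) (push u x (axis 1 1))" "tv_eq A p (Y p) (push u x (axis 2 1))"
proof -
  note lp = adapted_fields(2)[OF ad]
  have "p \<in> {F r (u x) |r x. r \<in> I \<and> x \<in> D}"
    using ad p S_M unfolding adapted_frame_def by blast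
  then obtain r x where rx: "r \<in> I" "x \<in> D" "p = F r (u x)" by blast
  have uS: "u y \<in> S" if "y \<in> D" for y by (rule local_param_mem[OF lp that])
  have "F R p = F r (u x)" using rx(3) F_R[OF p(2)] by simp
  then have "(R, p) = (r, u x)" using inj_onD[OF F_inj, of "(R, p)" "(r, u x)"] R_I p(2) rx(1) uS[OF rx(2)] by simp
  then have r: "r = R" and ux: "u x = p" by auto
  have "tv_eq A p (X p) (push (\<lambda>y. F R (u y)) x (axis 1 1)) \<and> tv_eq A p (Y p) (push (\<lambda>y. F R (u y)) x (axis 2 1))"
    using ad rx p r unfolding adapted_frame_def by blast
  moreover have "tv_eq A (u x) (push u x a) (push (\<lambda>y. F R (u y)) x a)" for a
    by (rule push_cong[OF A local_param_smooth[OF lp] rx(2) local_param_smooth(2)[OF lp] rx(2)])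
      (simp add: F_R uS)
  ultimately have "tv_eq A p (X p) (push u x (axis 1 1))" "tv_eq A p (Y p) (push u x (axis 2 1))"
    unfolding tv_eq_def ux by auto
  then show thesis using that rx(2) ux by blast
qed

lemma push_tangent_to_surface:
  assumes "local_param A S D u" "x \<in> D"
  shows "tangent_to A S (u x) (push u x a)"
  using push_tangent_to[OF A local_param_smooth[OF assms(1)] assms(2)] local_param_mem[OF assms(1)] by blast

lemma surface_tangent_in_frame:
  assumes ad: "adapted W D u X Y" and p: "p \<in> W" "p \<in> S" and v: "tangent_to A S p v"
    and c: "c \<in> A" "p \<in> fst c"
  obtains \<alpha> \<beta> where "v c = \<alpha> *\<^sub>R X p c + \<beta> *\<^sub>R Y p c"
proof -
  note lp = adapted_fields(2)[OF ad]
  obtain x where x: "x \<in> D" "u x = p" "tv_eq A p (X p) (push u x (axis 1 1))" "tv_eq A p (Y p) (push u x (axis 2 1))"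
    by (rule adapted_frame_on_surface[OF ad p])
  obtain a where "v c = push u x a c"
    by (rule tangent_to_param_range[OF A lp x(1) v[folded x(2)] c(1)]) (use c x(2) in auto)
  also have "\<dots> = a $ 1 *\<^sub>R push u x (axis 1 1) c + a $ 2 *\<^sub>R push u x (axis 2 1) c"
    by (rule push_components[OF A local_param_smooth[OF lp] x(1) c(1)]) (use c x(2) in auto)
  also have "\<dots> = a $ 1 *\<^sub>R X p c + a $ 2 *\<^sub>R Y p c" using x(3,4) c by (simp add: tv_eq_def)
  finally show thesis by (rule that)
qed

lemma surface_tangent_orthogonal:
  assumes p: "p \<in> S" and v: "tangent_to A S p v" and c: "c \<in> A" "p \<in> fst c"
  shows "gc p c (v c) (et p c) = 0" "gc p c (v c) (er p c) = 0"
    "\<beta>t p c \<bullet> v c = 0" "\<beta>r p c \<bullet> v c = 0"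
proof -
  have pU: "p \<in> U" using p S_U by blast
  obtain W D u X Y where W: "p \<in> W" "W \<subseteq> U" "adapted W D u X Y" using adapted_frame_at[OF pU] .
  obtain \<alpha> \<beta> where v: "v c = \<alpha> *\<^sub>R X p c + \<beta> *\<^sub>R Y p c"
    by (rule surface_tangent_in_frame[OF W(3,1) p v c])
  show 1: "gc p c (v c) (et p c) = 0" "gc p c (v c) (er p c) = 0"
    using adapted_chart[OF W(3,1) c]
    by (simp_all add: v inner_add_left lorentz_symmetric[OF g c, of "X p c" "et p c"] lorentz_symmetric[OF g c, of "Y p c" "et p c"]
      lorentz_symmetric[OF g c, of "X p c" "er p c"] lorentz_symmetric[OF g c, of "Y p c" "er p c"])
  show "\<beta>t p c \<bullet> v c = 0" "\<beta>r p c \<bullet> v c = 0"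
    using 1 by (simp_all add: normal_frame_chart(4,5)[OF pU c] inner_commute)
qed

lemma steered_on_surface_tangent:
  assumes p: "p \<in> S" and v: "tangent_to A S p v" and c: "c \<in> A" "p \<in> fst c"
  shows "v c \<bullet> (steered Q p c *v w) = gc p c (v c) w" "w \<bullet> (steered Q p c *v v c) = gc p c w (v c)"
  using surface_tangent_orthogonal(3,4)[OF assms] p S_U by (simp_all add: steer_form subset_iff)

lemma surface_tangent_positive:
  assumes p: "p \<in> S" and v: "tangent_to A S p v" and c: "c \<in> A" "p \<in> fst c" and nz: "v c \<noteq> 0"
  shows "gc p c (v c) (v c) > 0"
proof -
  have "\<not> tv_eq A p v (\<lambda>c. 0)" using nz c by (auto simp: tv_eq_def)
  then have "ip A g p v v > 0"
    using spacelike tangent_to_mono[OF v S_M] p S_M unfolding spacelike_def by blast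
  then show ?thesis
    using ip_chart[OF A g tangent_to_tangent_vector[OF A v] tangent_to_tangent_vector[OF A v] c] by simp
qed

lemma surface_gram_positive:
  fixes u :: "real^2 \<Rightarrow> 'n"
  assumes lp: "local_param A S D u" and x: "x \<in> D" and c: "c \<in> A" "u x \<in> fst c"
  defines "b1 \<equiv> push u x (axis 1 1) c" and "b2 \<equiv> push u x (axis 2 1) c"
  shows "gc (u x) c b1 b1 * gc (u x) c b2 b2 - (gc (u x) c b1 b2)\<^sup>2 > 0"
proof -
  let ?G = "\<lambda>v w. gc (u x) c v w"
  have inj: "inj (\<lambda>a. push u x a c)" using lp x c by (auto simp: local_param_def)
  have lin: "linear (\<lambda>a. push u x a c)"
    by (rule push_linear[OF A local_param_smooth[OF lp] x c])
  have pos: "?G (push u x a c) (push u x a c) > 0" if "a \<noteq> 0" for a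
  proof (rule surface_tangent_positive[OF local_param_mem[OF lp x] push_tangent_to_surface[OF lp x] c])
    show "push u x a c \<noteq> 0" using that inj linear_injective_0[OF lin] by blast
  qed
  have 11: "?G b1 b1 > 0" unfolding b1_def by (rule pos) (simp add: axis_eq_0_iff)
  \<comment> \<open>the Gram-Schmidt vector for \<open>b2\<close>, cleared of denominators\<close>
  define w where "w = ?G b1 b1 *\<^sub>R axis 2 1 - ?G b1 b2 *\<^sub>R (axis 1 1 :: real^2)"
  have "w $ 2 \<noteq> 0" using 11 by (simp add: w_def axis_def)
  then have "w \<noteq> 0" by auto
  then have "?G (push u x w c) (push u x w c) > 0" by (rule pos)
  moreover have "push u x w c = ?G b1 b1 *\<^sub>R b2 - ?G b1 b2 *\<^sub>R b1"
    unfolding w_def by (simp add: linear_diff[OF lin] linear_scale[OF lin] b1_def b2_def)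
  moreover have "?G (?G b1 b1 *\<^sub>R b2 - ?G b1 b2 *\<^sub>R b1) (?G b1 b1 *\<^sub>R b2 - ?G b1 b2 *\<^sub>R b1)
      = ?G b1 b1 * (?G b1 b1 * ?G b2 b2 - (?G b1 b2)\<^sup>2)"
    using lorentz_symmetric[OF g c, of b2 b1]
    by (simp add: inner_diff_left inner_diff_right matrix_vector_mult_diff_distrib
        matrix_vector_mult_scaleR power2_eq_square algebra_simps)
  ultimately show ?thesis using 11 by (simp add: zero_less_mult_iff)
qed

text \<open>The steering term is a sum of products of two functions which both vanish at \<open>p\<close>, so its derivative vanishes
  there, whatever the derivatives of \<open>Q\<close> and of the coframe are.\<close>

lemma metric_D_steered:
  assumes Q: "smooth_fun A UNIV Q" and g': "lorentz_metric A (steered Q)"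
    and p: "p \<in> S" and c: "c \<in> A" "p \<in> fst c"
    and v: "tangent_to A S p v" and w: "tangent_to A S p w"
  shows "v c \<bullet> (metric_D (steered Q) c p z *v w c) = v c \<bullet> (metric_D g c p z *v w c)"
proof -
  have pU: "p \<in> U" using p S_U by blast
  let ?T = "snd c ` (U \<inter> fst c)" and ?y = "snd c p"
  have o: "open ?T" by (rule chart_image_open[OF A c(1) U_open])
  have y: "?y \<in> ?T" using pU c by blast
  have form: "((\<lambda>y. v c \<bullet> (h (cinv c y) c *v w c)) has_derivative (\<lambda>z. v c \<bullet> (metric_D h c p z *v w c))) (at ?y)"
    if "lorentz_metric A h" for h
    by (rule has_derivative_inner_right[OF bounded_linear.has_derivative[OF
            bounded_bilinear.bounded_linear_left[OF bounded_bilinear_matrix_vector_mult] metric_has_derivative[OF that c]]])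
  have "smooth_on ?T (\<lambda>y. \<beta>t (cinv c y) c)"
    by (rule smooth_on_cong[OF smooth_on_minus[OF o smooth_on_metric_field[OF A g et c(1) U_open]] o])
      (auto simp: normal_frame_chart(4) c cinv_chart[OF A])
  moreover have "smooth_on ?T (\<lambda>y. \<beta>r (cinv c y) c)"
    by (rule smooth_on_cong[OF smooth_on_metric_field[OF A g er c(1) U_open] o])
      (auto simp: normal_frame_chart(5) c cinv_chart[OF A])
  ultimately have b: "\<exists>D. ((\<lambda>y. \<beta> (cinv c y) c \<bullet> a) has_derivative D) (at ?y)" if "\<beta> = \<beta>t \<or> \<beta> = \<beta>r" for \<beta> a
    using that smooth_on_has_derivative[OF smooth_on_inner[OF o _ smooth_on_const] y] by blast
  have zero: "((\<lambda>y. (\<beta> (cinv c y) c \<bullet> v c) * (\<beta>' (cinv c y) c \<bullet> w c)) has_derivative (\<lambda>_. 0)) (at ?y)"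
    if h: "\<beta> = \<beta>t \<or> \<beta> = \<beta>r" "\<beta>' = \<beta>t \<or> \<beta>' = \<beta>r" for \<beta> \<beta>'
  proof -
    obtain D1 D2 where "((\<lambda>y. \<beta> (cinv c y) c \<bullet> v c) has_derivative D1) (at ?y)"
      "((\<lambda>y. \<beta>' (cinv c y) c \<bullet> w c) has_derivative D2) (at ?y)"
      using b[OF h(1), of "v c"] b[OF h(2), of "w c"] by blast
    then show ?thesis
      by (rule has_derivative_mult_zero)
        (use h surface_tangent_orthogonal(3,4)[OF p v c] surface_tangent_orthogonal(3,4)[OF p w c]
          cinv_chart[OF A c] in auto)
  qed
  let ?B = "\<lambda>y. (\<beta>t (cinv c y) c \<bullet> v c) * (\<beta>r (cinv c y) c \<bullet> w c) + (\<beta>r (cinv c y) c \<bullet> v c) * (\<beta>t (cinv c y) c \<bullet> w c)"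
  have dB: "(?B has_derivative (\<lambda>_. 0)) (at ?y)"
    using has_derivative_add[OF zero[of \<beta>t \<beta>r] zero[of \<beta>r \<beta>t]] by simp
  have B0: "?B ?y = 0"
    using surface_tangent_orthogonal(3,4)[OF p v c] surface_tangent_orthogonal(3,4)[OF p w c] cinv_chart[OF A c] by simp
  have "smooth_on (snd c ` (UNIV \<inter> fst c)) (Q \<circ> cinv c)" using Q c unfolding smooth_fun_def by blast
  from smooth_on_has_derivative[OF this, of ?y]
  have dQ: "((\<lambda>y. Q (cinv c y)) has_derivative frechet_derivative (Q \<circ> cinv c) (at ?y)) (at ?y)"
    using c by (simp add: o_def)
  have "((\<lambda>y. v c \<bullet> (g (cinv c y) c *v w c) + Q (cinv c y) * ?B y) has_derivative
      (\<lambda>z. v c \<bullet> (metric_D g c p z *v w c))) (at ?y)"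
    by (rule has_derivative_eq_rhs[OF has_derivative_add[OF form[OF g] has_derivative_mult[OF dQ dB]]])
      (use B0 in simp)
  then have "((\<lambda>y. v c \<bullet> (steered Q (cinv c y) c *v w c)) has_derivative
      (\<lambda>z. v c \<bullet> (metric_D g c p z *v w c))) (at ?y)"
    by (rule has_derivative_transform_within_open[OF _ o y])
      (use cinv_chart[OF A c(1)] in \<open>auto simp: steer_form\<close>)
  from fun_cong[OF has_derivative_unique[OF form[OF g'] this]] show ?thesis .
qed

lemma lie_metric_steered:
  assumes Q: "smooth_fun A UNIV Q" and g': "lorentz_metric A (steered Q)"
    and p: "p \<in> S" and c: "c \<in> A" "p \<in> fst c"
    and v: "tangent_to A S p v" and w: "tangent_to A S p w"
  shows "lie_metric (steered Q) c E p (v c) (w c) = lie_metric g c E p (v c) (w c)"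
  unfolding lie_metric_def metric_D_steered[OF assms]
    steered_on_surface_tangent(1)[OF p v c] steered_on_surface_tangent(1)[OF p w c] ..

text \<open>The two bases of the tangent plane are related by an invertible matrix: were it singular, the Gram determinant of the
  parametrization would vanish.\<close>

lemma plane_trace_frame:
  fixes u :: "real^2 \<Rightarrow> 'n"
  assumes ad: "adapted W D' u' X Y" and p: "u x \<in> W"
    and lp: "local_param A S D u" and x: "x \<in> D" and c: "c \<in> A" "u x \<in> fst c" and B: "bilinear B"
  shows "plane_trace (gc (u x) c) B (push u x (axis 1 1) c) (push u x (axis 2 1) c) =
    plane_trace (gc (u x) c) B (X (u x) c) (Y (u x) c)"
proof -
  note lp' = adapted_fields(2)[OF ad]
  have uS: "u x \<in> S" by (rule local_param_mem[OF lp x])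
  obtain a1 a2 where a: "push u x (axis 1 1) c = a1 *\<^sub>R X (u x) c + a2 *\<^sub>R Y (u x) c"
    by (rule surface_tangent_in_frame[OF ad p uS push_tangent_to_surface[OF lp x] c])
  obtain b1 b2 where b: "push u x (axis 2 1) c = b1 *\<^sub>R X (u x) c + b2 *\<^sub>R Y (u x) c"
    by (rule surface_tangent_in_frame[OF ad p uS push_tangent_to_surface[OF lp x] c])
  let ?G = "gc (u x) c"
  have G: "bilinear ?G"
    unfolding bilinear_def by (auto intro!: linearI simp: matrix_vector_right_distrib
        inner_add_left inner_add_right matrix_vector_mult_scaleR)
  note s = lorentz_symmetric[OF g c]
  note ex = bilinear_ladd[OF G] bilinear_radd[OF G] bilinear_lmul[OF G] bilinear_rmul[OF G]
  have "a1 * b2 - a2 * b1 \<noteq> 0"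
  proof
    assume J: "a1 * b2 - a2 * b1 = 0"
    have "?G (push u x (axis 1 1) c) (push u x (axis 1 1) c) * ?G (push u x (axis 2 1) c) (push u x (axis 2 1) c)
        - (?G (push u x (axis 1 1) c) (push u x (axis 2 1) c))\<^sup>2
      = (a1 * b2 - a2 * b1)\<^sup>2 * (?G (X (u x) c) (X (u x) c) * ?G (Y (u x) c) (Y (u x) c) - (?G (X (u x) c) (Y (u x) c))\<^sup>2)"
      unfolding a b ex s[of "Y (u x) c" "X (u x) c"] by (simp add: power2_eq_square) algebra
    then show False using surface_gram_positive[OF lp x c] J by simp
  qed
  from plane_trace_change_basis[OF G s B this] show ?thesis unfolding a b .
qed

lemma mean_curvature_vector_param:
  assumes "p \<in> S"
  obtains D and u :: "real^2 \<Rightarrow> 'n" and x where "local_param A S D u" "x \<in> D" "u x = p"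
    "mean_curvature_vector A h S p = mean_curvature_param A h u x"
proof -
  obtain D and u :: "real^2 \<Rightarrow> 'n" where "local_param A S D u" "p \<in> u ` D"
    using surface assms unfolding embedded_surface_def by blast
  then have "\<exists>H D u x. local_param A S D u \<and> x \<in> D \<and> u x = p \<and> H = mean_curvature_param A h u x"
    by blast
  from someI_ex[OF this] show thesis using that unfolding mean_curvature_vector_def by blast
qed

text \<open>The normal components of the mean curvature vector of the steered metric, measured in that metric, are given by an
  expression in the original metric alone. They depend on \<open>Q\<close> only through the form used to measure them.\<close>

lemma steered_mean_curvature:
  assumes Q: "smooth_fun A UNIV Q" and g': "lorentz_metric A (steered Q)" and p: "p \<in> S"
  defines "H \<equiv> mean_curvature_vector A (steered Q) S p"
  shows "tangent_vector A p H"
    and "c \<in> A \<Longrightarrow> p \<in> fst c \<Longrightarrow> tangent_to A S p v \<Longrightarrow> gc p c (v c) (H c) = 0"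
    and "c \<in> A \<Longrightarrow> p \<in> fst c \<Longrightarrow> adapted W D' u' X Y \<Longrightarrow> p \<in> W \<Longrightarrow> E = et \<or> E = er \<Longrightarrow>
      E p c \<bullet> (steered Q p c *v H c) = - plane_trace (gc p c) (lie_metric g c E p) (X p c) (Y p c) / 2"
proof -
  obtain D u x where lp: "local_param A S D u" and x: "x \<in> D" and ux: "u x = p"
    and H: "H = mean_curvature_param A (steered Q) u x"
    unfolding H_def by (rule mean_curvature_vector_param[OF p])
  have tan: "tangent_to A S p (push u x a)" for a
    using push_tangent_to_surface[OF lp x] unfolding ux .
  have st: "push u x a c \<bullet> (steered Q p c *v w) = gc p c (push u x a c) w"
    if "c \<in> A" "p \<in> fst c" for a w c by (rule steered_on_surface_tangent(1)[OF p tan that])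
  have nd: "det (induced_metric A (steered Q) u x) \<noteq> 0"
  proof -
    let ?c = "chart_at A p"
    have c: "?c \<in> A" "p \<in> fst ?c" using chart_at_mem[OF A] by auto
    have "induced_metric A (steered Q) u x $ i $ j = gc p ?c (push u x (axis i 1) ?c) (push u x (axis j 1) ?c)" for i j
      by (simp add: induced_metric_def ip_def ux Let_def st[OF c])
    then show ?thesis
      using surface_gram_positive[OF lp x c(1)] c(2) ux
        lorentz_symmetric[OF g c, of "push u x (axis 2 1) ?c" "push u x (axis 1 1) ?c"]
      by (simp add: det_2 power2_eq_square)
  qed
  show tv: "tangent_vector A p H"
    using mean_curvature_param_tangent_vector[OF A g' lp x chart_at_mem[OF A] nd] unfolding H ux .
  show "gc p c (v c) (H c) = 0" if c: "c \<in> A" "p \<in> fst c" and v: "tangent_to A S p v"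
  proof -
    have pc: "u x \<in> fst c" using c ux by simp
    obtain a where a: "v c = push u x a c"
      by (rule tangent_to_param_range[OF A lp x _ c(1) pc]) (use v ux in auto)
    have o: "gc p c (push u x (axis m 1) c) (H c) = 0" for m
      using mean_curvature_param_orthogonal[OF A g' lp x c(1) pc nd, of m] st[OF c] by (simp add: H ux)
    show ?thesis
      unfolding a push_components[OF A local_param_smooth[OF lp] x c(1) pc, of a]
      by (simp add: inner_add_left o)
  qed
  show "E p c \<bullet> (steered Q p c *v H c) = - plane_trace (gc p c) (lie_metric g c E p) (X p c) (Y p c) / 2"
    if c: "c \<in> A" "p \<in> fst c" and ad: "adapted W D' u' X Y" and W: "p \<in> W" and E: "E = et \<or> E = er"
  proof -
    have pc: "u x \<in> fst c" using c ux by simp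
    have EU: "smooth_vfield A U E" using E et er by blast
    have pU: "p \<in> U" using p S_U by blast
    have normal: "push u y b c \<bullet> (steered Q (u y) c *v E (u y) c) = 0" if y: "y \<in> D" "u y \<in> fst c" for y b
      unfolding steered_on_surface_tangent(1)[OF local_param_mem[OF lp y(1)] push_tangent_to_surface[OF lp y(1)] c(1) y(2)]
      using surface_tangent_orthogonal(1,2)[OF local_param_mem[OF lp y(1)] push_tangent_to_surface[OF lp y(1)] c(1) y(2)] E
      by blast
    have "E p c \<bullet> (steered Q p c *v H c) = - plane_trace (\<lambda>v w. v \<bullet> (steered Q p c *v w)) (lie_metric (steered Q) c E p)
        (push u x (axis 1 1) c) (push u x (axis 2 1) c) / 2"
      using mean_curvature_param_lie[OF A g' lp x c(1) pc nd EU U_open _ normal] pU ux by (simp add: H)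
    also have "plane_trace (\<lambda>v w. v \<bullet> (steered Q p c *v w)) (lie_metric (steered Q) c E p)
        (push u x (axis 1 1) c) (push u x (axis 2 1) c)
      = plane_trace (gc p c) (lie_metric g c E p) (push u x (axis 1 1) c) (push u x (axis 2 1) c)"
      unfolding plane_trace_def st[OF c] lie_metric_steered[OF Q g' p c tan tan] ..
    also have "\<dots> = plane_trace (gc p c) (lie_metric g c E p) (X p c) (Y p c)"
      using plane_trace_frame[OF ad _ lp x c(1) pc lie_metric_bilinear[OF A EU c(1) pU c(2), of g]] W ux by simp
    finally show ?thesis .
  qed
qed

end


context steering_data
begin

section \<open>Tangency as a linear equation for the steering parameter\<close>

definition mean_curvature_along :: "('n \<Rightarrow> 'n tvec) \<Rightarrow> 'n \<Rightarrow> real" where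
  "mean_curvature_along E p = ip A g p (E p) (mean_curvature_vector A g S p)"

text \<open>The case \<open>Q = 0\<close>. It shows that on \<open>S\<close> the trace depends neither on the chart nor on the frame, which is what
  makes local formulas for the steering parameter agree.\<close>

lemma mean_curvature_along_trace:
  assumes p: "p \<in> S" and c: "c \<in> A" "p \<in> fst c" and ad: "adapted W D u X Y" "p \<in> W"
    and E: "E = et \<or> E = er"
  shows "mean_curvature_along E p = - plane_trace (gc p c) (lie_metric g c E p) (X p c) (Y p c) / 2"
proof -
  have g0: "lorentz_metric A (steered (\<lambda>_. 0))" using g by (simp add: steer_zero)
  have "tangent_vector A p (E p)" using E et er p S_U vfield_tangent_vector by blast
  then have "mean_curvature_along E p = E p c \<bullet> (g p c *v mean_curvature_vector A g S p c)"
    unfolding mean_curvature_along_def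
    using ip_chart[OF A g _ steered_mean_curvature(1)[OF smooth_fun_const[of A UNIV 0] g0 p, unfolded steer_zero] c] by blast
  then show ?thesis
    using steered_mean_curvature(3)[OF smooth_fun_const[of A UNIV 0] g0 p c ad E] by (simp add: steer_zero)
qed

lemma steered_mean_curvature_along:
  assumes Q: "smooth_fun A UNIV Q" and g': "lorentz_metric A (steered Q)" and p: "p \<in> S"
    and c: "c \<in> A" "p \<in> fst c" and E: "E = et \<or> E = er"
  shows "E p c \<bullet> (steered Q p c *v mean_curvature_vector A (steered Q) S p c) = mean_curvature_along E p"
proof -
  have pU: "p \<in> U" using p S_U by blast
  obtain W D u X Y where W: "p \<in> W" "W \<subseteq> U" "adapted W D u X Y" using adapted_frame_at[OF pU] .
  show ?thesis
    using steered_mean_curvature(3)[OF Q g' p c W(3,1) E] mean_curvature_along_trace[OF p c W(3,1) E] by simp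
qed

lemma er_tangent_to_M: "p \<in> S \<Longrightarrow> tangent_to A M p (er p)"
  and er_radial: "r \<in> I \<Longrightarrow> p \<in> S \<Longrightarrow> F r p \<in> U \<Longrightarrow>
    \<exists>l. tv_eq A (F r p) (er (F r p)) (\<lambda>c. l *\<^sub>R push (\<lambda>s. F s p) r 1 c)"
proof -
  have *: "unit_normal_in A g M (F r ` S) (F r p) (er (F r p)) \<and>
      (\<exists>l. tv_eq A (F r p) (er (F r p)) (\<lambda>c. l *\<^sub>R push (\<lambda>s. F s p) r 1 c))"
    if "r \<in> I" "p \<in> S" "F r p \<in> U" for r p
    using extension that unfolding frame_extension_def by blast
  show "tangent_to A M p (er p)" if "p \<in> S"
    using *[of R p] R_I F_R[OF that] that S_U by (auto simp: unit_normal_in_def)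
  show "\<exists>l. tv_eq A (F r p) (er (F r p)) (\<lambda>c. l *\<^sub>R push (\<lambda>s. F s p) r 1 c)"
    if "r \<in> I" "p \<in> S" "F r p \<in> U" using *[OF that] by blast
qed

lemma variation_param:
  fixes u :: "real^2 \<Rightarrow> 'n"
  assumes "local_param A S D u"
  shows "local_param A M (I \<times> D) (\<lambda>z. F (fst z) (u (snd z)))"
  using variation assms unfolding normal_variation_def by (simp add: case_prod_beta')

lemma variation_push:
  fixes u :: "real^2 \<Rightarrow> 'n"
  assumes lp: "local_param A S D u" and r: "r \<in> I" and x: "x \<in> D" and c: "c \<in> A" "F r (u x) \<in> fst c"
  shows "push (\<lambda>s. F s (u x)) r a c = push (\<lambda>z. F (fst z) (u (snd z))) (r, x) (a, 0) c"
    and "push (\<lambda>y. F r (u y)) x b c = push (\<lambda>z. F (fst z) (u (snd z))) (r, x) (0, b) c"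
proof -
  note v = variation_param[OF lp]
  have d1: "((\<lambda>s. (s, x)) has_derivative (\<lambda>a. (a, 0))) (at r)"
    by (intro has_derivative_Pair has_derivative_ident has_derivative_const)
  have d2: "((\<lambda>y. (r, y)) has_derivative (\<lambda>b. (0, b))) (at x)"
    by (intro has_derivative_Pair has_derivative_ident has_derivative_const)
  show "push (\<lambda>s. F s (u x)) r a c = push (\<lambda>z. F (fst z) (u (snd z))) (r, x) (a, 0) c"
    using push_compose[OF A local_param_smooth[OF v] _ d1 c(1), of a] r x c(2) by simp
  show "push (\<lambda>y. F r (u y)) x b c = push (\<lambda>z. F (fst z) (u (snd z))) (r, x) (0, b) c"
    using push_compose[OF A local_param_smooth[OF v] _ d2 c(1), of b] r x c(2) by simp
qed

text \<open>The factor in \<open>e\<^sub>r = l \<partial>\<^sub>r\<close> cannot vanish, so \<open>\<partial>\<^sub>r\<close> is a multiple of \<open>e\<^sub>r\<close> as well.\<close>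

lemma radial_multiple_of_er:
  assumes r: "r \<in> I" and p: "p \<in> S" and FU: "F r p \<in> U" and c: "c \<in> A" "F r p \<in> fst c"
  obtains k where "push (\<lambda>s. F s p) r 1 c = k *\<^sub>R er (F r p) c"
proof -
  obtain l where l: "tv_eq A (F r p) (er (F r p)) (\<lambda>c. l *\<^sub>R push (\<lambda>s. F s p) r 1 c)"
    using er_radial[OF r p FU] by blast
  then have e: "er (F r p) c = l *\<^sub>R push (\<lambda>s. F s p) r 1 c" using c by (simp add: tv_eq_def)
  have "er (F r p) c \<noteq> 0" using normal_frame_chart(2)[OF FU c] by auto
  then have "l \<noteq> 0" using e by auto
  then have "push (\<lambda>s. F s p) r 1 c = inverse l *\<^sub>R er (F r p) c" using e by simp
  then show thesis by (rule that)
qed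

text \<open>The variation, composed with a parametrization of \<open>S\<close>, parametrizes \<open>M\<close> near \<open>p\<close>. A tangent vector of \<open>M\<close> is therefore a
  radial vector plus a tangent vector of \<open>S\<close>, and \<open>e\<^sub>t\<close> is orthogonal to both.\<close>

lemma hypersurface_tangent_orthogonal_et:
  assumes p: "p \<in> S" and v: "tangent_to A M p v" and c: "c \<in> A" "p \<in> fst c"
  shows "gc p c (v c) (et p c) = 0"
proof -
  have pU: "p \<in> U" using p S_U by blast
  obtain W D u X Y where W: "p \<in> W" "W \<subseteq> U" "adapted W D u X Y" using adapted_frame_at[OF pU] .
  note lp = adapted_fields(2)[OF W(3)]
  obtain x where x: "x \<in> D" "u x = p" using adapted_frame_on_surface[OF W(3,1) p] by metis
  let ?\<Phi> = "\<lambda>z. F (fst z) (u (snd z))"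
  note vp = variation_param[OF lp]
  have z: "(R, x) \<in> I \<times> D" and \<Phi>z: "?\<Phi> (R, x) = p" using R_I x F_R[OF p] by auto
  obtain a where a: "v c = push ?\<Phi> (R, x) a c"
    by (rule tangent_to_param_range[OF A vp z _ c(1)]) (use v \<Phi>z c in auto)
  have lin: "linear (\<lambda>a. push ?\<Phi> (R, x) a c)"
    by (rule push_linear[OF A local_param_smooth[OF vp] z c(1)]) (use \<Phi>z c in simp)
  have FR: "F R (u x) \<in> fst c" using \<Phi>z c by simp
  have "push ?\<Phi> (R, x) a c = push ?\<Phi> (R, x) (fst a *\<^sub>R (1, 0) + (0, snd a)) c" by simp
  also have "\<dots> = fst a *\<^sub>R push ?\<Phi> (R, x) (1, 0) c + push ?\<Phi> (R, x) (0, snd a) c"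
    unfolding linear_add[OF lin] linear_scale[OF lin] ..
  also have "\<dots> = fst a *\<^sub>R push (\<lambda>s. F s p) R 1 c + push (\<lambda>y. F R (u y)) x (snd a) c"
    using variation_push[OF lp R_I x(1) c(1) FR] x(2) by simp
  also have "push (\<lambda>y. F R (u y)) x (snd a) c = push u x (snd a) c"
    using push_cong[OF A local_param_smooth[OF lp] x(1) local_param_smooth(2)[OF lp] x(1), of "\<lambda>y. F R (u y)" "snd a"]
      F_R local_param_mem[OF lp] c x(2) by (simp add: tv_eq_def)
  finally have v_eq: "v c = fst a *\<^sub>R push (\<lambda>s. F s p) R 1 c + push u x (snd a) c" using a by simp
  obtain k where k: "push (\<lambda>s. F s p) R 1 c = k *\<^sub>R er (F R p) c"
    by (rule radial_multiple_of_er[OF R_I p _ c(1)]) (use F_R[OF p] pU c in auto)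
  have "gc p c (push u x (snd a) c) (et p c) = 0"
    by (rule surface_tangent_orthogonal(1)[OF p _ c]) (use push_tangent_to_surface[OF lp x(1)] x(2) in auto)
  moreover have "gc p c (er p c) (et p c) = 0"
    using normal_frame_chart(3)[OF pU c] lorentz_symmetric[OF g c, of "er p c" "et p c"] by simp
  ultimately show ?thesis using F_R[OF p] by (simp add: v_eq k inner_add_left)
qed

text \<open>Write \<open>\<alpha> = g(H, e\<^sub>t)\<close> and \<open>\<beta> = g(H, e\<^sub>r)\<close> for the mean curvature vector \<open>H\<close> of the steered metric.
  Pairing it with the normal frame in the steered metric gives \<open>\<alpha> + Q \<beta>\<close> and \<open>\<beta> - Q \<alpha>\<close>, which equal the
  mean curvatures along \<open>e\<^sub>t\<close> and \<open>e\<^sub>r\<close> in the original metric; eliminating \<open>\<beta>\<close>, the condition \<open>\<alpha> = 0\<close> becomes linear in \<open>Q\<close>.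
  If it holds, \<open>H\<close> is orthogonal to \<open>S\<close> and to \<open>e\<^sub>t\<close>, hence a multiple of \<open>e\<^sub>r\<close>.\<close>

lemma mean_curvature_tangential_iff:
  assumes Q: "smooth_fun A UNIV Q" and g': "lorentz_metric A (steered Q)" and p: "p \<in> S"
  shows "tangent_to A M p (mean_curvature_vector A (steered Q) S p) \<longleftrightarrow>
    Q p * mean_curvature_along er p = mean_curvature_along et p"
proof -
  define H where "H = mean_curvature_vector A (steered Q) S p"
  have pU: "p \<in> U" using p S_U by blast
  obtain c where c: "c \<in> A" "p \<in> fst c" using chart_exists[OF A] by blast
  define \<alpha> where "\<alpha> = gc p c (H c) (et p c)"
  define \<beta> where "\<beta> = gc p c (H c) (er p c)"
  note nf = normal_frame_chart[OF pU c]
  note sy = lorentz_symmetric[OF g c]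
  have b: "\<beta>t p c \<bullet> w = - gc p c w (et p c)" "\<beta>r p c \<bullet> w = gc p c w (er p c)" for w
    by (simp_all add: nf(4,5) inner_commute)
  have t: "mean_curvature_along et p = \<alpha> + Q p * \<beta>"
    unfolding steered_mean_curvature_along[OF Q g' p c disjI1[OF refl], symmetric] H_def[symmetric] steer_form[OF pU] b
    by (simp add: nf \<alpha>_def \<beta>_def sy[of "et p c" "H c"])
  have r: "mean_curvature_along er p = \<beta> - Q p * \<alpha>"
    unfolding steered_mean_curvature_along[OF Q g' p c disjI2[OF refl], symmetric] H_def[symmetric] steer_form[OF pU] b
    by (simp add: nf \<alpha>_def \<beta>_def sy[of "er p c" "H c"] sy[of "er p c" "et p c"])
  have "Q p * mean_curvature_along er p - mean_curvature_along et p = - \<alpha> * (1 + (Q p)\<^sup>2)"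
    unfolding t r by (simp add: power2_eq_square algebra_simps)
  moreover have "1 + (Q p)\<^sup>2 \<noteq> 0" by (metis add.commute add_pos_nonneg less_irrefl zero_le_power2 zero_less_one)
  ultimately have iff: "Q p * mean_curvature_along er p = mean_curvature_along et p \<longleftrightarrow> \<alpha> = 0"
    by (metis eq_iff_diff_eq_0 minus_mult_left mult_eq_0_iff neg_equal_0_iff_equal)
  note H_tangent = steered_mean_curvature(1)[OF Q g' p, folded H_def]
  have "tangent_to A M p H" if "\<alpha> = 0"
  proof -
    obtain W D u X Y where W: "p \<in> W" "W \<subseteq> U" "adapted W D u X Y" using adapted_frame_at[OF pU] .
    note lp = adapted_fields(2)[OF W(3)]
    note ac = adapted_chart[OF W(3,1) c]
    obtain x where x: "x \<in> D" "u x = p" "tv_eq A p (X p) (push u x (axis 1 1))" "tv_eq A p (Y p) (push u x (axis 2 1))"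
      by (rule adapted_frame_on_surface[OF W(3,1) p])
    have "gc p c (push u x a c) (H c) = 0" for a
      using steered_mean_curvature(2)[OF Q g' p c] push_tangent_to_surface[OF lp x(1)] x(2) by (simp add: H_def)
    then have XY: "gc p c (X p c) (H c) = 0" "gc p c (Y p c) (H c) = 0"
      using x(3,4) c by (simp_all add: tv_eq_def)
    have "g p c *v H c = g p c *v (\<beta> *\<^sub>R er p c)"
      by (rule frame_inner_cancel[OF ac(1)])
        (use that XY in \<open>simp_all add: matrix_vector_mult_scaleR ac \<alpha>_def \<beta>_def sy[of "et p c" "H c"]
          sy[of "er p c" "H c"] sy[of "X p c" "er p c"] sy[of "Y p c" "er p c"]\<close>)
    then have "H c = \<beta> *\<^sub>R er p c" by (rule invertible_mult_vec_cancel[OF lorentz_invertible[OF g c]])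
    then have "tv_eq A p H (\<lambda>c. \<beta> *\<^sub>R er p c)"
      by (intro tangent_vector_eqI[OF A H_tangent tangent_vector_scaleR[OF A vfield_tangent_vector[OF er pU]] c])
    then show ?thesis by (rule tangent_to_scaleR[OF A er_tangent_to_M[OF p]])
  qed
  moreover have "\<alpha> = 0" if "tangent_to A M p H"
    unfolding \<alpha>_def by (rule hypersurface_tangent_orthogonal_et[OF p that c])
  ultimately show ?thesis unfolding iff H_def by blast
qed

section \<open>Area expansion and the outward mean curvature\<close>

text \<open>For a coordinate field \<open>V\<close> of the leaves this says that \<open>[e\<^sub>r, V]\<close> is orthogonal to \<open>V2\<close> on \<open>S\<close>. In the coordinates of
  the variation \<open>V\<close> and the radial field \<open>N\<close> commute, and \<open>e\<^sub>r\<close> is a multiple of \<open>N\<close>, so the bracket is a multiple of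
  \<open>e\<^sub>r\<close>. To avoid differentiating the factor, one differentiates the identity \<open>g(e\<^sub>r - l N, V2) = 0\<close> with \<open>l\<close> frozen
  at its value at \<open>p\<close>, where \<open>e\<^sub>r - l N\<close> vanishes.\<close>

lemma radial_bracket_orthogonal:
  assumes ad: "adapted W D u X Y" and W: "W \<subseteq> U" and p: "p \<in> W" "p \<in> S" and c: "c \<in> A" "p \<in> fst c"
    and V: "smooth_vfield A W V" and V2: "smooth_vfield A W V2"
    and Vpush: "\<And>r y. r \<in> I \<Longrightarrow> y \<in> D \<Longrightarrow> F r (u y) \<in> W \<Longrightarrow>
      tv_eq A (F r (u y)) (V (F r (u y))) (push (\<lambda>y. F r (u y)) y b)"
    and orth: "\<And>q. q \<in> W \<Longrightarrow> q \<in> fst c \<Longrightarrow> gc q c (er q c) (V2 q c) = 0"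
  shows "gc p c (frechet_derivative (\<lambda>y. V (cinv c y) c) (at (snd c p)) (er p c)) (V2 p c) =
    gc p c (frechet_derivative (\<lambda>y. er (cinv c y) c) (at (snd c p)) (V p c)) (V2 p c)"
proof -
  note lp = adapted_fields(2)[OF ad]
  obtain x where x: "x \<in> D" "u x = p" using adapted_frame_on_surface[OF ad p] by metis
  define \<Phi> where "\<Phi> = (\<lambda>z. F (fst z) (u (snd z)))"
  note vp = variation_param[OF lp, folded \<Phi>_def]
  note sm = local_param_smooth[OF vp]
  define z0 where "z0 = (R, x)"
  have z0: "z0 \<in> I \<times> D" and \<Phi>z0: "\<Phi> z0 = p" using R_I x F_R[OF p(2)] by (auto simp: z0_def \<Phi>_def)
  define \<Omega> where "\<Omega> = (I \<times> D) \<inter> \<Phi> -` (W \<inter> fst c)"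
  have o: "open \<Omega>"
    using sm adapted_fields(1)[OF ad] chart_domain_open[OF A c(1)]
    by (auto simp: \<Omega>_def smooth_into_def continuous_on_open_vimage Int_commute)
  have z0\<Omega>: "z0 \<in> \<Omega>" using z0 \<Phi>z0 p c by (auto simp: \<Omega>_def)
  have pW: "\<Phi> z0 \<in> W" "\<Phi> z0 \<in> fst c" using \<Phi>z0 p c by auto
  define N where "N = (\<lambda>z. push \<Phi> z (1, 0) c)"
  define Z where "Z = (\<lambda>z. push \<Phi> z (0, b) c)"
  have V\<Phi>: "V (\<Phi> z) c = Z z" if "z \<in> \<Omega>" for z
    using Vpush[of "fst z" "snd z"] variation_push(2)[OF lp, of "fst z" "snd z" c b] that c
    by (auto simp: \<Omega>_def \<Phi>_def Z_def tv_eq_def)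
  have N\<Phi>: "\<exists>k. N z = k *\<^sub>R er (\<Phi> z) c" if "z \<in> \<Omega>" for z
  proof -
    have z: "fst z \<in> I" "snd z \<in> D" "F (fst z) (u (snd z)) \<in> W" "F (fst z) (u (snd z)) \<in> fst c"
      using that by (auto simp: \<Omega>_def \<Phi>_def)
    obtain k where "push (\<lambda>s. F s (u (snd z))) (fst z) 1 c = k *\<^sub>R er (F (fst z) (u (snd z))) c"
      by (rule radial_multiple_of_er[OF z(1) local_param_mem[OF lp z(2)] _ c(1) z(4)]) (use z W in auto)
    then show ?thesis
      using variation_push(1)[OF lp z(1,2) c(1) z(4), of 1] by (auto simp: N_def \<Phi>_def)
  qed
  obtain l where l: "er p c = l *\<^sub>R N z0"
  proof -
    have "F R p \<in> U" using p S_U F_R by auto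
    then obtain l where "tv_eq A (F R p) (er (F R p)) (\<lambda>c. l *\<^sub>R push (\<lambda>s. F s p) R 1 c)"
      using er_radial[OF R_I p(2)] by blast
    then have "er p c = l *\<^sub>R push (\<lambda>s. F s p) R 1 c" using F_R[OF p(2)] c by (simp add: tv_eq_def)
    moreover have "push (\<lambda>s. F s (u x)) R 1 c = N z0"
      unfolding N_def \<Phi>_def z0_def by (rule variation_push(1)[OF lp R_I x(1) c(1)]) (use F_R[OF p(2)] x c in simp)
    ultimately have "er p c = l *\<^sub>R N z0" using x(2) by simp
    then show thesis by (rule that)
  qed
  let ?DV = "frechet_derivative (\<lambda>y. V (cinv c y) c) (at (snd c p))"
  let ?DE = "frechet_derivative (\<lambda>y. er (cinv c y) c) (at (snd c p))"
  have push_d: "((\<lambda>z. push \<Phi> z a c) has_derivative frechet_derivative (\<lambda>z. push \<Phi> z a c) (at z0)) (at z0)" for a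
    by (rule smooth_on_has_derivative[OF push_smooth[OF A sm c(1)]]) (use z0 pW in auto)
  have mixed: "frechet_derivative Z (at z0) (1, 0) = frechet_derivative N (at z0) (0, b)"
    unfolding Z_def N_def push_def
    by (rule second_derivative_symmetric[OF smooth_into_chart(2)[OF A sm c(1)] smooth_into_chart(1)[OF A sm c(1)]])
      (use z0 pW in auto)
  have "((\<lambda>z. V (\<Phi> z) c) has_derivative (\<lambda>a. ?DV (push \<Phi> z0 a c))) (at z0)"
    using vfield_along_has_derivative[OF A V c(1) pW sm z0] unfolding \<Phi>z0 .
  then have "(Z has_derivative (\<lambda>a. ?DV (push \<Phi> z0 a c))) (at z0)"
    by (rule has_derivative_transform_within_open[OF _ o z0\<Omega>]) (rule V\<Phi>)
  from fun_cong[OF has_derivative_unique[OF this push_d[of "(0, b)", folded Z_def]], of "(1, 0)"]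
  have DV: "?DV (N z0) = frechet_derivative Z (at z0) (1, 0)" by (simp add: N_def)
  have linDV: "linear ?DV" using vfield_has_derivative[OF A V c(1) p(1) c(2)] by (rule has_derivative_linear)
  have dv: "((\<lambda>z. er (\<Phi> z) c - l *\<^sub>R N z) has_derivative
      (\<lambda>a. ?DE (push \<Phi> z0 a c) - l *\<^sub>R frechet_derivative N (at z0) a)) (at z0)"
    using has_derivative_diff[OF vfield_along_has_derivative[OF A adapted_fields(4)[OF ad] c(1) pW sm z0]
        has_derivative_scaleR_right[OF push_d[of "(1, 0)", folded N_def]]] unfolding \<Phi>z0 .
  have "((\<lambda>z. gc (\<Phi> z) c (er (\<Phi> z) c - l *\<^sub>R N z) (V2 (\<Phi> z) c)) has_derivative (\<lambda>a. 0)) (at z0)"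
  proof (rule has_derivative_transform_within_open[OF has_derivative_const o z0\<Omega>])
    fix z assume z: "z \<in> \<Omega>"
    obtain k where k: "N z = k *\<^sub>R er (\<Phi> z) c" using N\<Phi>[OF z] by blast
    have "gc (\<Phi> z) c (er (\<Phi> z) c) (V2 (\<Phi> z) c) = 0" using z orth by (auto simp: \<Omega>_def)
    then show "0 = gc (\<Phi> z) c (er (\<Phi> z) c - l *\<^sub>R N z) (V2 (\<Phi> z) c)"
      by (simp add: k inner_diff_left)
  qed
  from fun_cong[OF has_derivative_unique[OF metric_along_has_derivative[OF A g c(1) pW(2) sm z0 dv
        vfield_along_has_derivative[OF A V2 c(1) pW sm z0]] this], of "(0, b)"]
  have "gc p c (?DE (push \<Phi> z0 (0, b) c) - l *\<^sub>R frechet_derivative N (at z0) (0, b)) (V2 p c) = 0"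
    unfolding \<Phi>z0 by (simp add: l)
  moreover have "push \<Phi> z0 (0, b) c = V p c" using V\<Phi>[OF z0\<Omega>] \<Phi>z0 by (simp add: Z_def)
  moreover have "l *\<^sub>R frechet_derivative N (at z0) (0, b) = ?DV (er p c)"
    unfolding l linear_scale[OF linDV] DV mixed ..
  ultimately show ?thesis by (simp add: inner_diff_left)
qed

text \<open>The product rule for \<open>e\<^sub>r(g(X\<^sub>i, X\<^sub>j))\<close> differs from the Lie derivative of \<open>g\<close> along \<open>e\<^sub>r\<close> by bracket terms, which vanish on the tangent
  plane. So the numerator of the trace is \<open>e\<^sub>r(ab - c\<^sup>2)\<close>, positive by area expansion, and its denominator
  is the Gram determinant.\<close>

lemma outward_mean_curvature_negative:
  assumes p: "p \<in> S"
  shows "mean_curvature_along er p < 0"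
proof -
  define c where "c = chart_at A p"
  have c: "c \<in> A" "p \<in> fst c" using chart_at_mem[OF A] by (auto simp: c_def)
  have pU: "p \<in> U" using p S_U by blast
  obtain W D u X Y where W: "p \<in> W" "W \<subseteq> U" "adapted W D u X Y" using adapted_frame_at[OF pU] .
  note af = adapted_fields[OF W(3)]
  obtain x where x: "x \<in> D" "u x = p" "tv_eq A p (X p) (push u x (axis 1 1))" "tv_eq A p (Y p) (push u x (axis 2 1))"
    by (rule adapted_frame_on_surface[OF W(3,1) p])
  let ?y = "snd c p" and ?e = "er p c"
  let ?T = "snd c ` (W \<inter> fst c)"
  have o: "open ?T" by (rule chart_image_open[OF A c(1) af(1)])
  have y: "?y \<in> ?T" using W c by blast
  let ?G = "\<lambda>v w. gc p c v w"
  define k where "k = (\<lambda>y. gc (cinv c y) c (X (cinv c y) c) (X (cinv c y) c) * gc (cinv c y) c (Y (cinv c y) c) (Y (cinv c y) c)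
    - (gc (cinv c y) c (X (cinv c y) c) (Y (cinv c y) c))\<^sup>2)"
  let ?f = "\<lambda>q. ip A g q (X q) (X q) * ip A g q (Y q) (Y q) - (ip A g q (X q) (Y q))\<^sup>2"
  define \<delta> where "\<delta> = (\<lambda>V V2. gc p c (frechet_derivative (\<lambda>y. V (cinv c y) c) (at ?y) ?e) (V2 p c)
     + V p c \<bullet> (metric_D g c p ?e *v V2 p c) + gc p c (V p c) (frechet_derivative (\<lambda>y. V2 (cinv c y) c) (at ?y) ?e))"
  have d: "\<exists>D. ((\<lambda>y. gc (cinv c y) c (V (cinv c y) c) (V2 (cinv c y) c)) has_derivative D) (at ?y) \<and> D ?e = \<delta> V V2"
    if "smooth_vfield A W V" "smooth_vfield A W V2" for V V2
    by (rule exI, rule conjI, rule has_derivative_inner[OF vfield_has_derivative[OF A that(1) c(1) W(1) c(2)]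
        bounded_bilinear.FDERIV[OF bounded_bilinear_matrix_vector_mult metric_has_derivative[OF g c]
          vfield_has_derivative[OF A that(2) c(1) W(1) c(2)]]])
      (simp add: \<delta>_def cinv_chart[OF A c] inner_add_right)
  obtain D11 D12 D22 where
    D11: "((\<lambda>y. gc (cinv c y) c (X (cinv c y) c) (X (cinv c y) c)) has_derivative D11) (at ?y)" "D11 ?e = \<delta> X X" and
    D12: "((\<lambda>y. gc (cinv c y) c (X (cinv c y) c) (Y (cinv c y) c)) has_derivative D12) (at ?y)" "D12 ?e = \<delta> X Y" and
    D22: "((\<lambda>y. gc (cinv c y) c (Y (cinv c y) c) (Y (cinv c y) c)) has_derivative D22) (at ?y)" "D22 ?e = \<delta> Y Y"
    using d[OF af(5,5)] d[OF af(5,6)] d[OF af(6,6)] by blast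
  have dk: "(k has_derivative (\<lambda>a. (?G (X p c) (X p c) * D22 a + D11 a * ?G (Y p c) (Y p c)) - 2 * (?G (X p c) (Y p c) * D12 a))) (at ?y)"
    unfolding k_def power2_eq_square
    by (rule has_derivative_eq_rhs[OF has_derivative_diff[OF has_derivative_mult[OF D11(1) D22(1)] has_derivative_mult[OF D12(1) D12(1)]]])
      (simp add: cinv_chart[OF A c] fun_eq_iff)
  have "((?f \<circ> cinv c) has_derivative (\<lambda>a. (?G (X p c) (X p c) * D22 a + D11 a * ?G (Y p c) (Y p c)) - 2 * (?G (X p c) (Y p c) * D12 a))) (at ?y)"
  proof (rule has_derivative_transform_within_open[OF dk o y])
    fix y assume "y \<in> ?T"
    then obtain q where q: "q \<in> W" "q \<in> fst c" "cinv c y = q" using cinv_mem[OF A c(1)] by blast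
    have tv: "tangent_vector A q (X q)" "tangent_vector A q (Y q)"
      using vfield_tangent_vector af(5,6) q(1) by blast+
    show "k y = (?f \<circ> cinv c) y"
      using ip_chart[OF A g tv(1) tv(1) c(1) q(2)] ip_chart[OF A g tv(1) tv(2) c(1) q(2)] ip_chart[OF A g tv(2) tv(2) c(1) q(2)]
      by (simp add: k_def q(3))
  qed
  from frechet_derivative_at[OF this]
  have "deriv_along A p (er p) ?f = (?G (X p c) (X p c) * \<delta> Y Y + \<delta> X X * ?G (Y p c) (Y p c)) - 2 * (?G (X p c) (Y p c) * \<delta> X Y)"
    unfolding deriv_along_def c_def[symmetric] Let_def by (metis D11(2) D12(2) D22(2))
  moreover have "deriv_along A p (er p) ?f > 0"
    using expanding W p unfolding area_expanding_def by blast
  ultimately have pos: "(?G (X p c) (X p c) * \<delta> Y Y + \<delta> X X * ?G (Y p c) (Y p c)) - 2 * (?G (X p c) (Y p c) * \<delta> X Y) > 0"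
    by simp
  have Xpush: "tv_eq A (F r (u y)) (X (F r (u y))) (push (\<lambda>y. F r (u y)) y (axis 1 1))"
    and Ypush: "tv_eq A (F r (u y)) (Y (F r (u y))) (push (\<lambda>y. F r (u y)) y (axis 2 1))"
    if "r \<in> I" "y \<in> D" "F r (u y) \<in> W" for r y
    using W(3) that unfolding adapted_frame_def by blast+
  have orthX: "gc q c (er q c) (X q c) = 0" and orthY: "gc q c (er q c) (Y q c) = 0" if "q \<in> W" "q \<in> fst c" for q
    using adapted_chart(7,8)[OF W(3) that(1) c(1) that(2)] by auto
  note sy = lorentz_symmetric[OF g c]
  note rb = radial_bracket_orthogonal[OF W(3,2,1) p c]
  have lie: "lie_metric g c er p (V p c) (V2 p c) = \<delta> V V2"
    if "gc p c (frechet_derivative (\<lambda>y. V (cinv c y) c) (at ?y) ?e) (V2 p c) =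
        gc p c (frechet_derivative (\<lambda>y. er (cinv c y) c) (at ?y) (V p c)) (V2 p c)"
      "gc p c (frechet_derivative (\<lambda>y. V2 (cinv c y) c) (at ?y) ?e) (V p c) =
        gc p c (frechet_derivative (\<lambda>y. er (cinv c y) c) (at ?y) (V2 p c)) (V p c)" for V V2
    unfolding lie_metric_def \<delta>_def that(1)
      sy[of "V p c" "frechet_derivative (\<lambda>y. V2 (cinv c y) c) (at ?y) ?e"] that(2)
    by (simp add: sy[of "V2 p c" "frechet_derivative (\<lambda>y. er (cinv c y) c) (at ?y) (V p c)"]
        sy[of "V p c" "frechet_derivative (\<lambda>y. er (cinv c y) c) (at ?y) (V2 p c)"])
  have XX: "lie_metric g c er p (X p c) (X p c) = \<delta> X X"
    by (rule lie) (rule rb[OF af(5,5) Xpush orthX], assumption+)+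
  have XY: "lie_metric g c er p (X p c) (Y p c) = \<delta> X Y"
    by (rule lie, rule rb[OF af(5,6) Xpush orthY], assumption+, rule rb[OF af(6,5) Ypush orthX], assumption+)
  have YY: "lie_metric g c er p (Y p c) (Y p c) = \<delta> Y Y"
    by (rule lie) (rule rb[OF af(6,6) Ypush orthY], assumption+)+
  have YX: "lie_metric g c er p (Y p c) (X p c) = \<delta> X Y"
  proof -
    have "transpose (metric_D g c p ?e) = metric_D g c p ?e"
      by (simp add: vec_eq_iff transpose_def metric_D_component[OF g c] metric_deriv_sym[OF A g c, of _ _ _])
    then have "Y p c \<bullet> (metric_D g c p ?e *v X p c) = X p c \<bullet> (metric_D g c p ?e *v Y p c)"
      using dot_lmul_matrix[of "X p c" "metric_D g c p ?e" "Y p c"] transpose_matrix_vector[of "metric_D g c p ?e" "X p c"]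
      by (simp add: inner_commute)
    then show ?thesis unfolding XY[symmetric] lie_metric_def by simp
  qed
  have den: "?G (X p c) (X p c) * ?G (Y p c) (Y p c) - (?G (X p c) (Y p c))\<^sup>2 > 0"
    using surface_gram_positive[OF af(2) x(1) c(1)] x c by (simp add: tv_eq_def)
  have "plane_trace ?G (lie_metric g c er p) (X p c) (Y p c) > 0"
    unfolding plane_trace_def XX XY YX YY using pos den by (intro divide_pos_pos) (simp_all add: algebra_simps)
  then show ?thesis
    using mean_curvature_along_trace[OF p c W(3,1), of er] by simp
qed

end


section \<open>Smooth bump functions\<close>

text \<open>The factors \<open>x\<^sup>-\<^sup>n\<close> make the family stable under differentiation, so that all orders of smoothness follow from one
  induction.\<close>

definition flat :: "nat \<Rightarrow> real \<Rightarrow> real" where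
  "flat n x = (if x \<le> 0 then 0 else inverse x ^ n / exp (inverse x))"

lemma flat_tendsto_zero: "(flat n \<longlongrightarrow> 0) (at 0)"
proof (rule filterlim_split_at)
  show "(flat n \<longlongrightarrow> 0) (at_left 0)"
    by (rule tendsto_eventually) (auto simp: flat_def eventually_at_filter)
  have "((\<lambda>x::real. inverse x ^ n / exp (inverse x)) \<longlongrightarrow> 0) (at_right 0)"
    by (rule filterlim_compose[OF tendsto_power_div_exp_0 filterlim_inverse_at_top_right])
  then show "(flat n \<longlongrightarrow> 0) (at_right 0)"
    by (rule tendsto_cong[THEN iffD1, rotated]) (auto simp: flat_def eventually_at_filter)
qed

lemma flat_derivative:
  "(flat n has_real_derivative (flat (n + 2) x - real n * flat (n + 1) x)) (at x)"
proof -
  consider "x < 0" | "x = 0" | "x > 0" by linarith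
  then show ?thesis
  proof cases
    case 1
    have "((\<lambda>_. 0) has_real_derivative 0) (at x)" by simp
    then have "(flat n has_real_derivative 0) (at x)"
      by (rule has_field_derivative_transform_within_open[of _ _ _ "{..<0}"]) (use 1 in \<open>auto simp: flat_def\<close>)
    then show ?thesis using 1 by (simp add: flat_def)
  next
    case 2
    have "((\<lambda>y. (flat n y - flat n 0) / (y - 0)) \<longlongrightarrow> 0) (at 0)"
      by (rule tendsto_cong[THEN iffD1, OF _ flat_tendsto_zero[of "n + 1"]])
        (auto simp: flat_def eventually_at_filter field_simps)
    then show ?thesis using 2 by (simp add: has_field_derivative_iff flat_def)
  next
    case 3
    have x0: "x \<noteq> 0" using 3 by simp
    have "((\<lambda>x. inverse x ^ n) has_real_derivative - real n * inverse x ^ (n + 1)) (at x)"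
      by (rule DERIV_cong[OF DERIV_power[OF DERIV_inverse[OF x0]]]) (cases n, simp_all add: algebra_simps)
    moreover have "((\<lambda>x. exp (- inverse x)) has_real_derivative exp (- inverse x) * inverse x ^ 2) (at x)"
      by (rule DERIV_cong[OF DERIV_fun_exp[OF DERIV_minus[OF DERIV_inverse[OF x0]]]]) (simp add: numeral_2_eq_2)
    ultimately have "((\<lambda>x. inverse x ^ n * exp (- inverse x)) has_real_derivative
        - real n * inverse x ^ (n + 1) * exp (- inverse x) + exp (- inverse x) * inverse x ^ 2 * inverse x ^ n) (at x)"
      by (rule DERIV_mult)
    then have "((\<lambda>x. inverse x ^ n / exp (inverse x)) has_real_derivative (flat (n + 2) x - real n * flat (n + 1) x)) (at x)"
      using 3 by (simp add: flat_def exp_minus divide_inverse power_add power2_eq_square algebra_simps)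
    then show ?thesis
      by (rule has_field_derivative_transform_within_open[of _ _ _ "{0<..}"]) (use 3 in \<open>auto simp: flat_def\<close>)
  qed
qed

lemma smooth_on_flat: "smooth_on UNIV (flat n)"
proof -
  have d: "(flat n has_derivative (\<lambda>v. v * (flat (n + 2) x - real n * flat (n + 1) x))) (at x)" for n x
    using flat_derivative[of n x] by (simp add: has_field_derivative_def mult_commute_abs)
  have "Ck_on k (flat n) UNIV" for k n
  proof (induction k arbitrary: n)
    case 0
    show ?case using has_derivative_continuous[OF d] by (simp add: continuous_at_imp_continuous_on)
  next
    case (Suc k)
    have "Ck_on k (\<lambda>x. v * (flat (n + 2) x + (- real n) * flat (n + 1) x)) UNIV" for v
      by (intro Ck_on_bilinear[OF open_UNIV bounded_bilinear_mult] Ck_on_const Ck_on_add[OF open_UNIV] Suc)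
    then have "Ck_on k (\<lambda>x. frechet_derivative (flat n) (at x) v) UNIV" for v
      using frechet_derivative_at[OF d, symmetric] by simp
    then show ?case using d by (auto intro: differentiableI)
  qed
  then show ?thesis by (simp add: smooth_on_def)
qed

definition smooth_step :: "real \<Rightarrow> real" where
  "smooth_step x = flat 0 x / (flat 0 x + flat 0 (1 - x))"

lemma smooth_step_values: "x \<le> 0 \<Longrightarrow> smooth_step x = 0" "x \<ge> 1 \<Longrightarrow> smooth_step x = 1"
  by (auto simp: smooth_step_def flat_def)

lemma smooth_on_smooth_step: "smooth_on UNIV smooth_step"
proof -
  have pos: "flat 0 x + flat 0 (1 - x) \<noteq> 0" for x
    by (cases "x \<le> 0"; cases "x \<ge> 1") (auto simp: flat_def add_pos_pos less_imp_neq[symmetric])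
  have "smooth_on UNIV (\<lambda>x. flat 0 (1 - x))"
    by (rule smooth_on_compose[OF smooth_on_flat]) (auto intro!: smooth_intros)
  then have "smooth_on UNIV (\<lambda>x. flat 0 x / (flat 0 x + flat 0 (1 - x)))"
    by (intro smooth_intros smooth_on_flat) (use pos in auto)
  then show ?thesis by (simp add: smooth_step_def[abs_def])
qed

section \<open>Extending functions from a compact set\<close>

context
  fixes A :: "('n::t2_space) atlas"
  assumes A: "smooth_atlas A"
begin

lemma smooth_fun_local:
  assumes "\<And>p. p \<in> W \<Longrightarrow> \<exists>N. open N \<and> p \<in> N \<and> smooth_fun A N f"
  shows "smooth_fun A W f"
  unfolding smooth_fun_def
proof (intro ballI smooth_on_local)
  fix c y assume c: "c \<in> A" and "y \<in> snd c ` (W \<inter> fst c)"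
  then obtain p where p: "p \<in> W" "p \<in> fst c" "y = snd c p" by blast
  obtain N where N: "open N" "p \<in> N" "smooth_fun A N f" using assms[OF p(1)] by blast
  have "smooth_on (snd c ` (N \<inter> fst c)) (f \<circ> cinv c)" using N(3) c unfolding smooth_fun_def by blast
  then show "\<exists>T. open T \<and> y \<in> T \<and> smooth_on T (f \<circ> cinv c)"
    using chart_image_open[OF A c N(1)] p N(2) by blast
qed

lemma smooth_fun_cong:
  assumes "smooth_fun A W f" "open W" "\<And>p. p \<in> W \<Longrightarrow> f p = h p"
  shows "smooth_fun A W h"
  unfolding smooth_fun_def
proof
  fix c assume c: "c \<in> A"
  have "smooth_on (snd c ` (W \<inter> fst c)) (f \<circ> cinv c)" using assms(1) c unfolding smooth_fun_def by blast
  then show "smooth_on (snd c ` (W \<inter> fst c)) (h \<circ> cinv c)"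
    by (rule smooth_on_cong[OF _ chart_image_open[OF A c assms(2)]]) (use assms(3) cinv_chart[OF A c] in auto)
qed

lemma smooth_fun_subset:
  assumes "smooth_fun A W f" "V \<subseteq> W"
  shows "smooth_fun A V f"
  using assms smooth_on_subset[of "snd c ` (W \<inter> fst c)" _ "snd c ` (V \<inter> fst c)" for c]
  unfolding smooth_fun_def by blast

lemma smooth_fun_combine:
  assumes "smooth_fun A W \<rho>" "smooth_fun A W f" "smooth_fun A W h" "open W"
  shows "smooth_fun A W (\<lambda>p. \<rho> p * f p + (1 - \<rho> p) * h p)"
  unfolding smooth_fun_def
proof
  fix c assume c: "c \<in> A"
  note o = chart_image_open[OF A c assms(4)]
  have s: "smooth_on (snd c ` (W \<inter> fst c)) (\<lambda>y. f (cinv c y))" if "smooth_fun A W f" for f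
    using that c unfolding smooth_fun_def o_def by blast
  show "smooth_on (snd c ` (W \<inter> fst c)) ((\<lambda>p. \<rho> p * f p + (1 - \<rho> p) * h p) \<circ> cinv c)"
    unfolding o_def by (intro smooth_intros o s assms)
qed

lemma smooth_fun_in_chart:
  assumes c: "c \<in> A" and W: "open W" "W \<subseteq> fst c" and f: "smooth_on (snd c ` W) (f \<circ> cinv c)"
  shows "smooth_fun A W f"
  unfolding smooth_fun_def
proof
  fix d assume d: "d \<in> A"
  note o = chart_image_open[OF A d W(1)]
  have "smooth_on (snd d ` (W \<inter> fst d)) (\<lambda>y. (f \<circ> cinv c) ((snd c \<circ> cinv d) y))"
  proof (rule smooth_on_compose[OF f o smooth_on_subset[OF transition_smooth[OF A d c]]])
    show "snd d ` (W \<inter> fst d) \<subseteq> snd d ` (fst d \<inter> fst c)" using W(2) by blast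
    show "(snd c \<circ> cinv d) ` (snd d ` (W \<inter> fst d)) \<subseteq> snd c ` W"
      using cinv_chart[OF A d] by auto
  qed
  then show "smooth_on (snd d ` (W \<inter> fst d)) (f \<circ> cinv d)"
    by (rule smooth_on_cong[OF _ o]) (use W(2) cinv_chart[OF A c] cinv_chart[OF A d] in auto)
qed

lemma bump_exists:
  assumes W: "open W" "p \<in> W"
  obtains \<rho> K V where "smooth_fun A UNIV \<rho>" "closed K" "K \<subseteq> W" "\<forall>q. q \<notin> K \<longrightarrow> \<rho> q = 0"
    "open V" "p \<in> V" "\<forall>q\<in>V. \<rho> q = 1"
proof -
  obtain c where c: "c \<in> A" "p \<in> fst c" using chart_exists[OF A] by blast
  define y0 where "y0 = snd c p"
  have "open (snd c ` (W \<inter> fst c))" "y0 \<in> snd c ` (W \<inter> fst c)"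
    using chart_image_open[OF A c(1) W(1)] W(2) c(2) by (auto simp: y0_def)
  then obtain r where r: "r > 0" "cball y0 r \<subseteq> snd c ` (W \<inter> fst c)" using open_contains_cball by blast
  define e where "e = r / 2"
  have e: "e > 0" "cball y0 (2 * e) \<subseteq> snd c ` (W \<inter> fst c)" using r by (auto simp: e_def)
  \<comment> \<open>equal to \<open>1\<close> at distance at most \<open>e\<close> from \<open>y0\<close>, and to \<open>0\<close> from distance \<open>sqrt 2 e < 2 e\<close> on\<close>
  define s where "s = (\<lambda>y. smooth_step (2 - ((y - y0) \<bullet> (y - y0)) / e\<^sup>2))"
  define \<rho> where "\<rho> = (\<lambda>q. if q \<in> fst c then s (snd c q) else 0)"
  define K where "K = cinv c ` cball y0 (2 * e)"
  define V where "V = fst c \<inter> snd c -` ball y0 e"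
  note hom = chart_homeomorphism[OF A c(1)]
  have cont: "continuous_on (snd c ` fst c) (cinv c)" "continuous_on (fst c) (snd c)"
    using hom by (auto simp: homeomorphism_def)
  have K_W: "K \<subseteq> W"
    using e(2) cinv_mem[OF A c(1), of _ W] unfolding K_def by blast
  have "compact K"
    unfolding K_def by (intro compact_continuous_image continuous_on_subset[OF cont(1)] compact_cball) (use e(2) in blast)
  then have K_closed: "closed K" by (rule compact_imp_closed)
  have s_smooth: "smooth_on UNIV s"
    unfolding s_def by (rule smooth_on_compose[OF smooth_on_smooth_step]) (use e(1) in \<open>auto intro!: smooth_intros\<close>)
  have \<rho>0: "\<rho> q = 0" if "q \<notin> K" for q
  proof (cases "q \<in> fst c")
    case True
    have "snd c q \<notin> cball y0 (2 * e)"
    proof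
      assume "snd c q \<in> cball y0 (2 * e)"
      then have "cinv c (snd c q) \<in> K" unfolding K_def by blast
      then show False using that cinv_chart[OF A c(1) True] by simp
    qed
    then have "norm (snd c q - y0) > 2 * e" by (simp add: dist_norm norm_minus_commute)
    then have "(norm (snd c q - y0))\<^sup>2 > (2 * e)\<^sup>2" using e(1) by (intro power_strict_mono) auto
    then have "4 * e\<^sup>2 < (snd c q - y0) \<bullet> (snd c q - y0)"
      by (simp add: power2_norm_eq_inner power_mult_distrib)
    moreover have "0 \<le> e\<^sup>2" by simp
    ultimately have "(snd c q - y0) \<bullet> (snd c q - y0) \<ge> 2 * e\<^sup>2" by linarith
    then have "2 - ((snd c q - y0) \<bullet> (snd c q - y0)) / e\<^sup>2 \<le> 0" using e(1) by (simp add: field_simps)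
    then show ?thesis using True by (simp add: \<rho>_def s_def smooth_step_values)
  qed (simp add: \<rho>_def)
  have \<rho>1: "\<rho> q = 1" if "q \<in> V" for q
  proof -
    have "norm (snd c q - y0) < e" using that by (simp add: V_def dist_norm norm_minus_commute)
    then have "(norm (snd c q - y0))\<^sup>2 < e\<^sup>2" by (intro power_strict_mono) auto
    then have "1 \<le> 2 - ((snd c q - y0) \<bullet> (snd c q - y0)) / e\<^sup>2"
      unfolding power2_norm_eq_inner using e(1) by (simp add: field_simps)
    then show ?thesis using that by (simp add: \<rho>_def V_def s_def smooth_step_values)
  qed
  have "smooth_fun A UNIV \<rho>"
  proof (rule smooth_fun_local)
    fix q
    show "\<exists>N. open N \<and> q \<in> N \<and> smooth_fun A N \<rho>"
    proof (cases "q \<in> fst c")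
      case True
      have oc: "open (snd c ` fst c)" using chart_image_open[OF A c(1) open_UNIV] by simp
      have "smooth_on (snd c ` fst c) s" by (rule smooth_on_subset[OF s_smooth]) simp
      then have "smooth_on (snd c ` fst c) (\<rho> \<circ> cinv c)"
        by (rule smooth_on_cong[OF _ oc]) (use cinv_chart[OF A c(1)] in \<open>auto simp: \<rho>_def\<close>)
      then have "smooth_fun A (fst c) \<rho>"
        by (rule smooth_fun_in_chart[OF c(1) chart_domain_open[OF A c(1)] order_refl])
      then show ?thesis using True chart_domain_open[OF A c(1)] by blast
    next
      case False
      have K_c: "K \<subseteq> fst c" using e(2) cinv_mem[OF A c(1), of _ W] unfolding K_def by blast
      have "smooth_fun A (- K) \<rho>"
        by (rule smooth_fun_cong[OF smooth_fun_const[of A _ 0]]) (use K_closed \<rho>0 in auto)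
      then show ?thesis using False K_c K_closed by blast
    qed
  qed
  moreover have "open V" unfolding V_def
    using cont(2) chart_domain_open[OF A c(1)] by (auto simp: continuous_on_open_vimage Int_commute)
  moreover have "p \<in> V" using c(2) e(1) by (simp add: V_def y0_def)
  ultimately show thesis using that K_closed K_W \<rho>0 \<rho>1 by blast
qed

text \<open>Cover \<open>S\<close> by finitely many open sets on each of which some bump function \<open>\<rho>\<close> is \<open>1\<close>, and add the local
  extensions \<open>f\<close> one at a time by \<open>Q' = \<rho> f + (1 - \<rho>) Q\<close>. On \<open>S\<close> this is right where \<open>\<rho> = 1\<close>, and remains right where
  \<open>Q\<close> was, as an affine combination of equal values.\<close>

lemma smooth_extension_from_compact:
  assumes S: "compact S" "S \<subseteq> U" and U: "open U"
    and loc: "\<And>p. p \<in> S \<Longrightarrow> \<exists>N f. open N \<and> p \<in> N \<and> smooth_fun A N f \<and> (\<forall>q\<in>S \<inter> N. f q = \<phi> q)"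
  obtains Q K where "smooth_fun A UNIV Q" "closed K" "K \<subseteq> U" "\<forall>p. p \<notin> K \<longrightarrow> Q p = 0"
    "\<forall>p\<in>S. Q p = \<phi> p"
proof -
  define good where "good V \<longleftrightarrow> open V \<and> (\<exists>\<rho> K N f. smooth_fun A UNIV \<rho> \<and> closed K \<and> K \<subseteq> N \<and> N \<subseteq> U \<and> open N \<and>
      (\<forall>q. q \<notin> K \<longrightarrow> \<rho> q = 0) \<and> (\<forall>q\<in>V. \<rho> q = 1) \<and> smooth_fun A N f \<and> (\<forall>q\<in>S \<inter> N. f q = \<phi> q))" for V
  have "\<exists>V. p \<in> V \<and> good V" if p: "p \<in> S" for p
  proof -
    obtain N f where N: "open N" "p \<in> N" "smooth_fun A N f" "\<forall>q\<in>S \<inter> N. f q = \<phi> q"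
      using loc[OF p] by blast
    have "open (N \<inter> U)" "p \<in> N \<inter> U" using N U p S by auto
    then obtain \<rho> K V where b: "smooth_fun A UNIV \<rho>" "closed K" "K \<subseteq> N \<inter> U" "\<forall>q. q \<notin> K \<longrightarrow> \<rho> q = 0"
      "open V" "p \<in> V" "\<forall>q\<in>V. \<rho> q = 1" by (rule bump_exists)
    have "smooth_fun A (N \<inter> U) f" by (rule smooth_fun_subset[OF N(3)]) blast
    then have "good V" unfolding good_def
      using b N(4) \<open>open (N \<inter> U)\<close> by (intro conjI exI[of _ \<rho>] exI[of _ K] exI[of _ "N \<inter> U"] exI[of _ f]) auto
    then show ?thesis using b(6) by blast
  qed
  then have "S \<subseteq> \<Union> {V. good V}" by blast
  moreover have "\<forall>V\<in>{V. good V}. open V" by (simp add: good_def)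
  ultimately obtain \<V> where \<V>: "\<V> \<subseteq> {V. good V}" "finite \<V>" "S \<subseteq> \<Union> \<V>"
    using compactE[OF S(1)] by metis
  have "\<exists>Q K. smooth_fun A UNIV Q \<and> closed K \<and> K \<subseteq> U \<and> (\<forall>p. p \<notin> K \<longrightarrow> Q p = 0) \<and> (\<forall>p\<in>S \<inter> \<Union> \<V>. Q p = \<phi> p)"
    using \<V>(2,1)
  proof (induction \<V>)
    case empty
    show ?case by (intro exI[of _ "\<lambda>_. 0"] exI[of _ "{}"]) (simp add: smooth_fun_const)
  next
    case (insert V \<V>)
    have "\<V> \<subseteq> {V. good V}" and V: "good V" using insert.prems by simp_all
    from insert.IH[OF this(1)]
    obtain Q K where Q: "smooth_fun A UNIV Q" "closed K" "K \<subseteq> U" "\<forall>p. p \<notin> K \<longrightarrow> Q p = 0"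
      "\<forall>p\<in>S \<inter> \<Union> \<V>. Q p = \<phi> p" by blast
    obtain \<rho> L N f where b: "smooth_fun A UNIV \<rho>" "closed L" "L \<subseteq> N" "N \<subseteq> U" "open N"
      "\<forall>q. q \<notin> L \<longrightarrow> \<rho> q = 0" "\<forall>q\<in>V. \<rho> q = 1" "smooth_fun A N f" "\<forall>q\<in>S \<inter> N. f q = \<phi> q"
      using V unfolding good_def by blast
    define Q' where "Q' = (\<lambda>p. \<rho> p * f p + (1 - \<rho> p) * Q p)"
    have "smooth_fun A UNIV Q'"
    proof (rule smooth_fun_local)
      fix p
      show "\<exists>N. open N \<and> p \<in> N \<and> smooth_fun A N Q'"
      proof (cases "p \<in> N")
        case True
        have "smooth_fun A N Q'" unfolding Q'_def
          by (rule smooth_fun_combine[OF smooth_fun_subset[OF b(1)] b(8) smooth_fun_subset[OF Q(1)] b(5)]) auto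
        then show ?thesis using True b(5) by blast
      next
        case False
        have "smooth_fun A (- L) Q'"
          by (rule smooth_fun_cong[OF smooth_fun_subset[OF Q(1)]]) (use b(2,6) in \<open>auto simp: Q'_def\<close>)
        then show ?thesis using False b(2,3) by blast
      qed
    qed
    moreover have "closed (K \<union> L)" "K \<union> L \<subseteq> U" using Q b by auto
    moreover have "\<forall>p. p \<notin> K \<union> L \<longrightarrow> Q' p = 0" using Q(4) b(6) by (simp add: Q'_def)
    moreover have "\<forall>p\<in>S \<inter> \<Union> (insert V \<V>). Q' p = \<phi> p"
    proof
      fix p assume p: "p \<in> S \<inter> \<Union> (insert V \<V>)"
      have f: "\<rho> p * f p = \<rho> p * \<phi> p" using b(3,6,9) p by (cases "p \<in> L") auto
      show "Q' p = \<phi> p"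
      proof (cases "p \<in> V")
        case True
        then show ?thesis using f b(7) by (simp add: Q'_def)
      next
        case False
        then have "Q p = \<phi> p" using p Q(5) by auto
        then show ?thesis unfolding Q'_def f by (simp add: algebra_simps)
      qed
    qed
    ultimately show ?case by blast
  qed
  then show thesis using that \<V>(3) by (metis IntI subsetD)
qed

end

section \<open>Smoothness of the steering parameter\<close>

context steering_data
begin

text \<open>Both traces have the Gram determinant of the frame as denominator, so the quotient of the mean curvatures is that of
  the numerators. These are smooth functions on an open set of the manifold, and the second one does not
  vanish near \<open>p\<close>.\<close>

lemma local_steering_function:
  assumes p: "p \<in> S"
  shows "\<exists>N f. open N \<and> p \<in> N \<and> smooth_fun A N f \<and>
    (\<forall>q\<in>S \<inter> N. f q = mean_curvature_along et q / mean_curvature_along er q)"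
proof -
  have pU: "p \<in> U" using p S_U by blast
  obtain W D u X Y where W: "p \<in> W" "W \<subseteq> U" "adapted W D u X Y" using adapted_frame_at[OF pU] .
  note af = adapted_fields[OF W(3)]
  obtain c where c: "c \<in> A" "p \<in> fst c" using chart_exists[OF A] by blast
  let ?T = "snd c ` (W \<inter> fst c)"
  have o: "open ?T" by (rule chart_image_open[OF A c(1) af(1)])
  have G: "smooth_on ?T (\<lambda>y. g (cinv c y) c)"
    by (rule smooth_on_subset[OF lorentz_smooth[OF g c(1)]]) auto
  have V: "smooth_on ?T (\<lambda>y. V (cinv c y) c)" if "smooth_vfield A W V" for V
    using that c unfolding smooth_vfield_def by blast
  have lie: "smooth_on ?T (\<lambda>y. lie_metric g c E (cinv c y) (V1 (cinv c y) c) (V2 (cinv c y) c))"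
    if E: "smooth_vfield A W E" and V1: "smooth_vfield A W V1" and V2: "smooth_vfield A W V2" for E V1 V2
  proof -
    have "smooth_on ?T (\<lambda>y. V2 (cinv c y) c \<bullet> (g (cinv c y) c *v frechet_derivative (\<lambda>y. E (cinv c y) c) (at y) (V1 (cinv c y) c))
      + V1 (cinv c y) c \<bullet> (g (cinv c y) c *v frechet_derivative (\<lambda>y. E (cinv c y) c) (at y) (V2 (cinv c y) c))
      + V1 (cinv c y) c \<bullet> (frechet_derivative (\<lambda>y. g (cinv c y) c) (at y) (E (cinv c y) c) *v V2 (cinv c y) c))"
      by (intro smooth_on_add smooth_on_inner smooth_on_matrix_vector_mult smooth_on_frechet_derivative o G V that)
    then show ?thesis
      by (rule smooth_on_cong[OF _ o]) (use cinv_chart[OF A c(1)] in \<open>auto simp: lie_metric_def metric_D_def\<close>)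
  qed
  define num where "num E q = lie_metric g c E q (X q c) (X q c) * gc q c (Y q c) (Y q c)
      - (lie_metric g c E q (X q c) (Y q c) + lie_metric g c E q (Y q c) (X q c)) * gc q c (X q c) (Y q c)
      + lie_metric g c E q (Y q c) (Y q c) * gc q c (X q c) (X q c)" for E q
  have num_smooth: "smooth_on ?T (\<lambda>y. num E (cinv c y))" if "smooth_vfield A W E" for E
    unfolding num_def
    by (intro smooth_on_add smooth_on_diff smooth_on_mult smooth_on_inner smooth_on_matrix_vector_mult o G lie V that af)
  have vals: "mean_curvature_along E q = - (num E q / den) / 2" "den \<noteq> 0"
    if q: "q \<in> S" "q \<in> W" "q \<in> fst c" and E: "E = et \<or> E = er"
      and den: "den = gc q c (X q c) (X q c) * gc q c (Y q c) (Y q c) - (gc q c (X q c) (Y q c))\<^sup>2" for E q den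
  proof -
    show "mean_curvature_along E q = - (num E q / den) / 2"
      unfolding mean_curvature_along_trace[OF q(1) c(1) q(3) W(3) q(2) E] plane_trace_def num_def den ..
    obtain x where "x \<in> D" "u x = q" "tv_eq A q (X q) (push u x (axis 1 1))" "tv_eq A q (Y q) (push u x (axis 2 1))"
      by (rule adapted_frame_on_surface[OF W(3) q(2,1)])
    then show "den \<noteq> 0"
      using surface_gram_positive[OF af(2) _ c(1), of x] c(1) q(3) by (simp add: den tv_eq_def)
  qed
  have num_er: "num er q \<noteq> 0" if q: "q \<in> S" "q \<in> W" "q \<in> fst c" for q
    using vals(1)[OF q disjI2[OF refl] refl] outward_mean_curvature_negative[OF q(1)] by auto
  define O' where "O' = ?T \<inter> (\<lambda>y. num er (cinv c y)) -` (- {0})"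
  have O': "open O'"
    using smooth_on_imp_continuous_on[OF num_smooth[OF af(4)]] o
    by (auto simp: O'_def continuous_on_open_vimage Int_commute open_Compl)
  define N where "N = fst c \<inter> snd c -` O'"
  have "continuous_on (fst c) (snd c)" using chart_homeomorphism[OF A c(1)] by (simp add: homeomorphism_def)
  then have N: "open N"
    using O' chart_domain_open[OF A c(1)] by (auto simp: N_def continuous_on_open_vimage Int_commute)
  have N_W: "q \<in> W \<and> q \<in> fst c \<and> num er q \<noteq> 0" if "q \<in> N" for q
  proof -
    have q: "q \<in> fst c" "snd c q \<in> ?T" "num er (cinv c (snd c q)) \<noteq> 0"
      using that by (auto simp: N_def O'_def)
    moreover from q(2) obtain q' where "q' \<in> W" "q' \<in> fst c" "snd c q = snd c q'" by blast
    ultimately show ?thesis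
      using cinv_chart[OF A c(1)] inj_onD[OF chart_inj[OF A c(1)], of q q'] by simp
  qed
  have pN: "p \<in> N" using num_er[OF p W(1) c(2)] W(1) c cinv_chart[OF A c] by (auto simp: N_def O'_def)
  have im: "snd c ` N \<subseteq> ?T" using N_W by blast
  have oN: "open (snd c ` N)"
    using chart_image_open[OF A c(1) N] N_W by (metis Int_absorb2 subsetI)
  have "smooth_on (snd c ` N) (\<lambda>y. num et (cinv c y) / num er (cinv c y))"
    by (intro smooth_on_divide oN smooth_on_subset[OF num_smooth im] af) (use N_W cinv_chart[OF A c(1)] in auto)
  then have "smooth_fun A N (\<lambda>q. num et q / num er q)"
    by (intro smooth_fun_in_chart[OF A c(1) N]) (use N_W in \<open>auto simp: o_def\<close>)
  moreover have "num et q / num er q = mean_curvature_along et q / mean_curvature_along er q" if "q \<in> S \<inter> N" for q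
  proof -
    have q: "q \<in> S" "q \<in> W" "q \<in> fst c" using that N_W by auto
    define d where "d = gc q c (X q c) (X q c) * gc q c (Y q c) (Y q c) - (gc q c (X q c) (Y q c))\<^sup>2"
    have "d \<noteq> 0" by (rule vals(2)[OF q disjI1[OF refl] d_def])
    then show ?thesis
      unfolding vals(1)[OF q disjI1[OF refl] d_def] vals(1)[OF q disjI2[OF refl] d_def] by simp
  qed
  ultimately show ?thesis using N pN by blast
qed

lemma steering_parameter_exists_unique:
  "\<exists>Q. steering_parameter A g U \<beta>t \<beta>r Q \<and> mean_curvature_tangential A (steered Q) M S \<and>
     (\<forall>Q'. steering_parameter A g U \<beta>t \<beta>r Q' \<and> mean_curvature_tangential A (steered Q') M S \<longrightarrow>
        (\<forall>p\<in>S. Q' p = Q p))"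
proof -
  obtain Q K where Q: "smooth_fun A UNIV Q" "closed K" "K \<subseteq> U" "\<forall>p. p \<notin> K \<longrightarrow> Q p = 0"
    "\<forall>p\<in>S. Q p = mean_curvature_along et p / mean_curvature_along er p"
    by (rule smooth_extension_from_compact[OF A S_compact S_U U_open local_steering_function])
  have nz: "mean_curvature_along er p \<noteq> 0" if "p \<in> S" for p
    using outward_mean_curvature_negative[OF that] by simp
  have sQ: "steering_parameter A g U \<beta>t \<beta>r Q"
    unfolding steering_parameter_def
    using lorentz_steer[OF A g U_open et er _ Q(1-3)] Q(4) normal_frame_chart Q(1) by blast
  moreover have "mean_curvature_tangential A (steered Q) M S"
    unfolding mean_curvature_tangential_def
    using mean_curvature_tangential_iff[of Q] sQ nz Q(5) by (simp add: steering_parameter_def)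
  moreover have "Q' p = Q p" if "steering_parameter A g U \<beta>t \<beta>r Q'"
      "mean_curvature_tangential A (steered Q') M S" "p \<in> S" for Q' p
  proof -
    have "Q' p * mean_curvature_along er p = mean_curvature_along et p"
      using that mean_curvature_tangential_iff[of Q' p]
      by (simp add: steering_parameter_def mean_curvature_tangential_def)
    then have "Q' p = mean_curvature_along et p / mean_curvature_along er p"
      using nz[OF that(3)] by (simp add: nonzero_eq_divide_eq)
    then show ?thesis using Q(5) that(3) by simp
  qed
  ultimately show ?thesis by blast
qed

end

theorem theorem1p5:
  fixes A :: "('n::{t2_space,second_countable_topology}) atlas"
    and g :: "'n metric" and T :: "'n \<Rightarrow> 'n tvec"
    and M S U :: "'n set" and I :: "real set" and R :: real and F :: "real \<Rightarrow> 'n \<Rightarrow> 'n"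
    and et er :: "'n \<Rightarrow> 'n tvec" and \<beta>t \<beta>r :: "'n \<Rightarrow> 'n chart \<Rightarrow> real^4"
  assumes "spacetime A g T"
    and "embedded_hypersurface A M" and "spacelike A g M"
    and "embedded_surface A S" and "compact S" and "S \<subseteq> M"
    and "frame_extension A g M S I R F U et er"
    and "dual_coframe A g M S I F U et er \<beta>t \<beta>r"
    and "area_expanding A g M S I F U et er"
  shows "\<exists>Q. steering_parameter A g U \<beta>t \<beta>r Q \<and>
             mean_curvature_tangential A (steer g U \<beta>t \<beta>r Q) M S \<and>
             (\<forall>Q'. steering_parameter A g U \<beta>t \<beta>r Q' \<and>
                   mean_curvature_tangential A (steer g U \<beta>t \<beta>r Q') M S \<longrightarrow>
                   (\<forall>p\<in>S. Q' p = Q p))"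
proof -
  interpret steering_data A g T M S U I R F et er \<beta>t \<beta>r
    using assms by unfold_locales
  show ?thesis by (rule steering_parameter_exists_unique)
qed

end
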